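(* Let $R=S\times_kT$ be a fiber product as in the setting described in the context, with $\mathfrak m=\mathfrak p\oplus\mathfrak q$. Let $M$ be an $S$-module with a minimal free resolution $P$ over $S$, let $E$ be a minimal free resolution of $k=S/\mathfrak p$ over $S$ with $E_0=S$, and let $F$ be a minimal free resolution of $k=T/\mathfrak q$ over $T$ with $F_0=T$. Then the graded free $R$-module $G$ with the maps $\partial^G_i$ constructed in the context from $P,E,F$, $$G\colon\quad \cdots\to G_i\xrightarrow{\partial^G_i}G_{i-1}\to\cdots\to G_1\xrightarrow{\partial^G_1}G_0\to0,$$ is a free resolution of the $R$-module $M$ (where $M$ is an $R$-module via the projection $R\to S$), and it satisfies $\partial^G(G)\subseteq\mathfrak mG$.
   Context: Setting. $\pi_S\colon S\to k$ and $\pi_T\colon T\to k$ are surjective ring homomorphisms onto a field $k$; $R = S\times_k T=\{(s,t)\in S\times T : \pi_S(s)=\pi_T(t)\}$, $\mathfrak p=\ker\pi_S$, $\mathfrak q=\ker\pi_T$, and $\mathfrak m=\ker(R\to k)=\mathfrak p\oplus\mathfrak q$; we identify $\mathfrak p$ and $\mathfrak q$ with subsets (ideals) of $R$. One of the following holds: (local case) $S$ and $T$ are commutative noetherian local rings with common residue field $k$ and maximal ideals $\mathfrak p$, $\mathfrak q$, and $M$ is finitely generated; or (graded case) $S$ and $T$ are non-negatively graded, connected, degree-wise finite (not necessarily commutative) $k$-algebras, $\mathfrak p=S_+$, $\mathfrak q=T_+$, and $M$ is a graded, bounded below, degree-wise finite $S$-module. All modules are left modules. A complex of free modules $X$ over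 a ring $A$ with (homogeneous) maximal ideal $\mathfrak a$ is minimal if $\partial(X)\subseteq\mathfrak aX$. Construction of $G$. Choose bases $\mathsf P$, $\mathsf E$, $\mathsf F$ of the graded free modules $P$, $E$, $F$ (over $S$, $S$, $T$ respectively) with $\mathsf E_0=\{1_S\}$ and $\mathsf F_0=\{1_T\}$. Regard the elements of $\mathsf P$, $\mathsf E_{\ge1}$, $\mathsf F_{\ge1}$ as letters of an alphabet; the degree of a word is the sum of the (homological) degrees of its letters. Let $\mathsf G$ be the set of all words ending in exactly one letter of $\mathsf P$, preceded by a (possibly empty) alternating string of letters from $\mathsf E_{\ge1}$ and $\mathsf F_{\ge1}$ whose last letter (the one adjacent to the letter of $\mathsf P$), if any, is in $\mathsf F_{\geq 1}$; that is, all words $$f_1e_2f_3\cdots e_{2l-2}f_{2l-1}p_{2l}\ (l\ge1)\quad\text{and}\quad e_1f_2e_3\cdots e_{2l-1}f_{2l}p_{2l+1}\ (l\ge0),$$ with $e_i\in\mathsf E_{\ge1}$, $f_i\in\mathsf F_{\ge1}$, $p_i\in\mathsf P$. Let $G$ be the graded free $R$-module with basis $\mathsf G$. Write each word as $w=xw'$ with $x$ its first letter and $w'$ the (possibly empty) rest, and define $\partial^G$ as the $R$-linear map with $$\partial^G(w)=\begin{cases}\partial^P(x)&x\in\mathsf P\\ \partial^E(x)w'&x\in\mathsf E\\ \partial^F(x)w'&x\in\mathsf F,\end{cases}$$ where: by minimality $\partial^P(x)$, $\partial^E(x)$, $\partial^F(x)$ are linear combinations of basis elements with coefficients in $\mathfrak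 p$, $\mathfrak p$, $\mathfrak q$ respectively; these coefficients are regarded as elements of $R$; if $\partial^E(x)=\sum_e s_e e$ then $\partial^E(x)w'=\sum_e s_e\,ew'$, and likewise for $F$; and $1_Sw'$, $1_Tw'$ are read as $w'$. Put $\partial^G_i=\partial^G|_{G_i}$. The augmentation $G_0\to M$ is the $R$-linear map sending each $p\in\mathsf P_0$ to its image under $P_0\to M$. *)

theory Defs
  imports "HOL-Algebra.Chinese_Remainder" "HOL-Algebra.Ring_Divisibility" "HOL-Algebra.Generated_Groups"
begin

section \<open>Left modules over not necessarily commutative rings\<close>

text \<open>The axioms are those of the locale \<^locale>\<open>module\<close>, which insists on a commutative
  ring. The fields \<^const>\<open>mult\<close> and \<^const>\<open>one\<close> of the record type of modules play no role.\<close>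

locale left_module = R?: ring R + M?: abelian_group M
    for R :: "('a, 'x) ring_scheme" (structure) and M :: "('a, 'm, 'z) module_scheme" (structure) +
  assumes smult_closed:
      "\<lbrakk>a \<in> carrier R; x \<in> carrier M\<rbrakk> \<Longrightarrow> a \<odot>\<^bsub>M\<^esub> x \<in> carrier M"
    and smult_l_distr:
      "\<lbrakk>a \<in> carrier R; b \<in> carrier R; x \<in> carrier M\<rbrakk> \<Longrightarrow>
        (a \<oplus>\<^bsub>R\<^esub> b) \<odot>\<^bsub>M\<^esub> x = a \<odot>\<^bsub>M\<^esub> x \<oplus>\<^bsub>M\<^esub> b \<odot>\<^bsub>M\<^esub> x"
    and smult_r_distr:
      "\<lbrakk>a \<in> carrier R; x \<in> carrier M; y \<in> carrier M\<rbrakk> \<Longrightarrow>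
        a \<odot>\<^bsub>M\<^esub> (x \<oplus>\<^bsub>M\<^esub> y) = a \<odot>\<^bsub>M\<^esub> x \<oplus>\<^bsub>M\<^esub> a \<odot>\<^bsub>M\<^esub> y"
    and smult_assoc1:
      "\<lbrakk>a \<in> carrier R; b \<in> carrier R; x \<in> carrier M\<rbrakk> \<Longrightarrow>
        (a \<otimes>\<^bsub>R\<^esub> b) \<odot>\<^bsub>M\<^esub> x = a \<odot>\<^bsub>M\<^esub> (b \<odot>\<^bsub>M\<^esub> x)"
    and smult_one:
      "x \<in> carrier M \<Longrightarrow> \<one>\<^bsub>R\<^esub> \<odot>\<^bsub>M\<^esub> x = x"

lemma left_module_iff_module: "cring R \<Longrightarrow> left_module R M \<longleftrightarrow> module R M"
  by (simp add: left_module_def left_module_axioms_def module_def module_axioms_def cring.axioms(1))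

definition lmod_hom ::
    "('a, 'x) ring_scheme \<Rightarrow> ('a, 'm) module \<Rightarrow> ('a, 'n) module \<Rightarrow> ('m \<Rightarrow> 'n) set" where
  "lmod_hom A M N = {f \<in> carrier M \<rightarrow> carrier N.
     (\<forall>x\<in>carrier M. \<forall>y\<in>carrier M. f (x \<oplus>\<^bsub>M\<^esub> y) = f x \<oplus>\<^bsub>N\<^esub> f y) \<and>
     (\<forall>a\<in>carrier A. \<forall>x\<in>carrier M. f (a \<odot>\<^bsub>M\<^esub> x) = a \<odot>\<^bsub>N\<^esub> f x)}"

definition lmod_iso ::
    "('a, 'x) ring_scheme \<Rightarrow> ('a, 'm) module \<Rightarrow> ('a, 'n) module \<Rightarrow> ('m \<Rightarrow> 'n) set" where
  "lmod_iso A M N = {f \<in> lmod_hom A M N. bij_betw f (carrier M) (carrier N)}"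

definition regular_module :: "('a, 'x) ring_scheme \<Rightarrow> ('a, 'a) module" where
  "regular_module A = \<lparr>carrier = carrier A, monoid.mult = monoid.mult A, one = one A,
     ring.zero = ring.zero A, ring.add = ring.add A, smult = monoid.mult A\<rparr>"

text \<open>Restriction of scalars along a ring homomorphism \<open>h\<close>.\<close>

definition restrict_scalars :: "('a \<Rightarrow> 'b) \<Rightarrow> ('b, 'm) module \<Rightarrow> ('a, 'm) module" where
  "restrict_scalars h M = \<lparr>carrier = carrier M, monoid.mult = monoid.mult M, one = one M,
     ring.zero = ring.zero M, ring.add = ring.add M, smult = (\<lambda>a x. h a \<odot>\<^bsub>M\<^esub> x)\<rparr>"

text \<open>The subgroup \<open>I M\<close> of finite sums of products.\<close>

definition ideal_smult :: "'a set \<Rightarrow> ('a, 'm) module \<Rightarrow> 'm set" where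
  "ideal_smult I M = generate (add_monoid M) {a \<odot>\<^bsub>M\<^esub> x | a x. a \<in> I \<and> x \<in> carrier M}"

definition spanned_by ::
    "('a, 'x) ring_scheme \<Rightarrow> ('a, 'm) module \<Rightarrow> 'm set \<Rightarrow> 'm set \<Rightarrow> bool" where
  "spanned_by A M X N \<longleftrightarrow> X \<subseteq> N \<and>
     (\<forall>v\<in>N. \<exists>c \<in> X \<rightarrow> carrier A. v = (\<Oplus>\<^bsub>M\<^esub>x\<in>X. c x \<odot>\<^bsub>M\<^esub> x))"

text \<open>With \<open>N = carrier M\<close> this says that \<open>M\<close> is finitely generated; for a subspace \<open>N\<close> of a
  vector space it says that \<open>N\<close> is finite-dimensional.\<close>

definition finitely_spanned ::
    "('a, 'x) ring_scheme \<Rightarrow> ('a, 'm) module \<Rightarrow> 'm set \<Rightarrow> bool" where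
  "finitely_spanned A M N \<longleftrightarrow> (\<exists>X. finite X \<and> spanned_by A M X N)"


section \<open>Free modules and bases\<close>

text \<open>The free module on a set \<open>B\<close> consists of the finitely supported coefficient functions,
  extended by zero outside \<open>B\<close>; \<open>single A b\<close> is the basis element belonging to \<open>b\<close>.\<close>

definition free_module :: "('a, 'x) ring_scheme \<Rightarrow> 'b set \<Rightarrow> ('a, 'b \<Rightarrow> 'a) module" where
  "free_module A B = \<lparr>
     carrier = {c. (\<forall>b. c b \<in> carrier A) \<and> (\<forall>b. b \<notin> B \<longrightarrow> c b = \<zero>\<^bsub>A\<^esub>)
                   \<and> finite {b. c b \<noteq> \<zero>\<^bsub>A\<^esub>}},
     monoid.mult = undefined, one = undefined,
     ring.zero = (\<lambda>_. \<zero>\<^bsub>A\<^esub>), ring.add = (\<lambda>c d b. c b \<oplus>\<^bsub>A\<^esub> d b),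
     smult = (\<lambda>a c b. a \<otimes>\<^bsub>A\<^esub> c b)\<rparr>"

definition single :: "('a, 'x) ring_scheme \<Rightarrow> 'b \<Rightarrow> 'b \<Rightarrow> 'a" where
  "single A b = (\<lambda>b'. if b' = b then \<one>\<^bsub>A\<^esub> else \<zero>\<^bsub>A\<^esub>)"

text \<open>The linear map from a free module to \<open>N\<close> that sends \<open>single A b\<close> to \<open>f b\<close>.\<close>

definition lin_ext ::
    "('a, 'x) ring_scheme \<Rightarrow> ('a, 'n) module \<Rightarrow> ('b \<Rightarrow> 'n) \<Rightarrow> ('b \<Rightarrow> 'a) \<Rightarrow> 'n" where
  "lin_ext A N f c = (\<Oplus>\<^bsub>N\<^esub>b\<in>{b. c b \<noteq> \<zero>\<^bsub>A\<^esub>}. c b \<odot>\<^bsub>N\<^esub> f b)"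

definition is_basis :: "('a, 'x) ring_scheme \<Rightarrow> ('a, 'm) module \<Rightarrow> 'm set \<Rightarrow> bool" where
  "is_basis A M B \<longleftrightarrow> B \<subseteq> carrier M \<and>
     (\<forall>v\<in>carrier M. \<exists>!c. c \<in> carrier (free_module A B) \<and> v = lin_ext A M (\<lambda>b. b) c)"

definition coords ::
    "('a, 'x) ring_scheme \<Rightarrow> ('a, 'm) module \<Rightarrow> 'm set \<Rightarrow> 'm \<Rightarrow> 'm \<Rightarrow> 'a" where
  "coords A M B v = (THE c. c \<in> carrier (free_module A B) \<and> v = lin_ext A M (\<lambda>b. b) c)"


section \<open>Free resolutions\<close>

text \<open>A complex in non-negative degrees. The map \<open>bdy X i\<close> goes from degree \<open>i\<close> to degree
  \<open>i - 1\<close>; the value of \<open>bdy X 0\<close> is irrelevant.\<close>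

record ('a, 'm) cpx =
  chn :: "nat \<Rightarrow> ('a, 'm) module"
  bdy :: "nat \<Rightarrow> 'm \<Rightarrow> 'm"

record ('a, 'm) based_cpx = "('a, 'm) cpx" +
  bas :: "nat \<Rightarrow> 'm set"

definition free_resolution ::
    "('a, 'x) ring_scheme \<Rightarrow> ('a, 'm, 'z) cpx_scheme \<Rightarrow> ('m \<Rightarrow> 'n) \<Rightarrow> ('a, 'n) module \<Rightarrow> bool"
  where
  "free_resolution A X \<epsilon> N \<longleftrightarrow>
     left_module A N \<and>
     (\<forall>i. left_module A (chn X i) \<and> (\<exists>B. is_basis A (chn X i) B)) \<and>
     (\<forall>i. bdy X (Suc i) \<in> lmod_hom A (chn X (Suc i)) (chn X i)) \<and>
     \<epsilon> \<in> lmod_hom A (chn X 0) N \<and>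
     (\<forall>i. bdy X (Suc (Suc i)) ` carrier (chn X (Suc (Suc i)))
          = a_kernel (chn X (Suc i)) (chn X i) (bdy X (Suc i))) \<and>
     bdy X (Suc 0) ` carrier (chn X (Suc 0)) = a_kernel (chn X 0) N \<epsilon> \<and>
     \<epsilon> ` carrier (chn X 0) = carrier N"

definition minimal_cpx :: "'a set \<Rightarrow> ('a, 'm, 'z) cpx_scheme \<Rightarrow> bool" where
  "minimal_cpx I X \<longleftrightarrow>
     (\<forall>i. bdy X (Suc i) ` carrier (chn X (Suc i)) \<subseteq> ideal_smult I (chn X i))"

definition based :: "('a, 'x) ring_scheme \<Rightarrow> ('a, 'm) based_cpx \<Rightarrow> bool" where
  "based A X \<longleftrightarrow> (\<forall>i. is_basis A (chn X i) (bas X i))"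


section \<open>Internal gradings\<close>

definition direct_decomp :: "('a, 'x) ring_scheme \<Rightarrow> (int \<Rightarrow> 'a set) \<Rightarrow> bool" where
  "direct_decomp M gM \<longleftrightarrow> (\<forall>n. additive_subgroup (gM n) M) \<and>
     (\<forall>x\<in>carrier M. \<exists>!c. (\<forall>n. c n \<in> gM n) \<and> finite {n. c n \<noteq> \<zero>\<^bsub>M\<^esub>} \<and>
        x = (\<Oplus>\<^bsub>M\<^esub>n\<in>{n. c n \<noteq> \<zero>\<^bsub>M\<^esub>}. c n))"

definition graded_ring :: "('a, 'x) ring_scheme \<Rightarrow> (int \<Rightarrow> 'a set) \<Rightarrow> bool" where
  "graded_ring A gA \<longleftrightarrow> ring A \<and> direct_decomp A gA \<and> \<one>\<^bsub>A\<^esub> \<in> gA 0 \<and>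
     (\<forall>m n. \<forall>a\<in>gA m. \<forall>b\<in>gA n. a \<otimes>\<^bsub>A\<^esub> b \<in> gA (m + n))"

definition graded_module ::
    "('a, 'x) ring_scheme \<Rightarrow> (int \<Rightarrow> 'a set) \<Rightarrow> ('a, 'm) module \<Rightarrow> (int \<Rightarrow> 'm set) \<Rightarrow> bool" where
  "graded_module A gA M gM \<longleftrightarrow> graded_ring A gA \<and> left_module A M \<and> direct_decomp M gM \<and>
     (\<forall>m n. \<forall>a\<in>gA m. \<forall>x\<in>gM n. a \<odot>\<^bsub>M\<^esub> x \<in> gM (m + n))"

definition irrelevant_part :: "('a, 'x) ring_scheme \<Rightarrow> (int \<Rightarrow> 'a set) \<Rightarrow> 'a set" where
  "irrelevant_part A gA = generate (add_monoid A) (\<Union>n\<in>{0<..}. gA n)"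

text \<open>Connected, non-negatively graded, degree-wise finite \<open>k\<close>-algebras with structure map
  \<open>\<eta>\<close>, which identifies \<open>k\<close> with the component of degree \<open>0\<close>.\<close>

definition connected_algebra ::
    "'k ring \<Rightarrow> 'a ring \<Rightarrow> (int \<Rightarrow> 'a set) \<Rightarrow> ('k \<Rightarrow> 'a) \<Rightarrow> bool" where
  "connected_algebra k A gA \<eta> \<longleftrightarrow> graded_ring A gA \<and>
     \<eta> \<in> ring_hom k A \<and>
     (\<forall>u\<in>carrier k. \<forall>a\<in>carrier A. \<eta> u \<otimes>\<^bsub>A\<^esub> a = a \<otimes>\<^bsub>A\<^esub> \<eta> u) \<and>
     (\<forall>n<0. gA n = {\<zero>\<^bsub>A\<^esub>}) \<and>
     bij_betw \<eta> (carrier k) (gA 0) \<and>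
     (\<forall>n. finitely_spanned k (restrict_scalars \<eta> (regular_module A)) (gA n))"

definition concentrated_in_0 :: "('a, 'x) ring_scheme \<Rightarrow> int \<Rightarrow> 'a set" where
  "concentrated_in_0 A n = (if n = 0 then carrier A else {\<zero>\<^bsub>A\<^esub>})"

definition homogeneous :: "(int \<Rightarrow> 'm set) \<Rightarrow> 'm set \<Rightarrow> bool" where
  "homogeneous gM B \<longleftrightarrow> B \<subseteq> (\<Union>n. gM n)"

definition graded_free_resolution ::
    "('a, 'x) ring_scheme \<Rightarrow> (int \<Rightarrow> 'a set) \<Rightarrow> ('a, 'm, 'z) cpx_scheme \<Rightarrow> (nat \<Rightarrow> int \<Rightarrow> 'm set) \<Rightarrow>
     ('m \<Rightarrow> 'n) \<Rightarrow> ('a, 'n) module \<Rightarrow> (int \<Rightarrow> 'n set) \<Rightarrow> bool" where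
  "graded_free_resolution A gA X gX \<epsilon> N gN \<longleftrightarrow>
     free_resolution A X \<epsilon> N \<and> graded_module A gA N gN \<and>
     (\<forall>i. graded_module A gA (chn X i) (gX i) \<and>
          (\<exists>B. is_basis A (chn X i) B \<and> homogeneous (gX i) B)) \<and>
     (\<forall>i n. bdy X (Suc i) ` gX (Suc i) n \<subseteq> gX i n) \<and>
     (\<forall>n. \<epsilon> ` gX 0 n \<subseteq> gN n)"


section \<open>The fiber product\<close>

definition fiber_product ::
    "'s ring \<Rightarrow> 't ring \<Rightarrow> ('s \<Rightarrow> 'k) \<Rightarrow> ('t \<Rightarrow> 'k) \<Rightarrow> ('s \<times> 't) ring" where
  "fiber_product S T \<pi>S \<pi>T = (RDirProd S T)
     \<lparr>carrier := {(s, t). s \<in> carrier S \<and> t \<in> carrier T \<and> \<pi>S s = \<pi>T t}\<rparr>"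

definition fiber_max ::
    "'s ring \<Rightarrow> 't ring \<Rightarrow> 'k ring \<Rightarrow> ('s \<Rightarrow> 'k) \<Rightarrow> ('t \<Rightarrow> 'k) \<Rightarrow> ('s \<times> 't) set" where
  "fiber_max S T k \<pi>S \<pi>T = a_kernel (fiber_product S T \<pi>S \<pi>T) k (\<lambda>(s, t). \<pi>S s)"

lemma fiber_max_eq:
  "fiber_max S T k \<pi>S \<pi>T = a_kernel S k \<pi>S \<times> a_kernel T k \<pi>T"
  unfolding fiber_max_def fiber_product_def a_kernel_def' by (auto simp: split_def)

text \<open>The grading of the fiber product of two graded rings.\<close>

definition fiber_grading ::
    "(int \<Rightarrow> 's set) \<Rightarrow> (int \<Rightarrow> 't set) \<Rightarrow> ('s \<Rightarrow> 'k) \<Rightarrow> ('t \<Rightarrow> 'k) \<Rightarrow> int \<Rightarrow> ('s \<times> 't) set" where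
  "fiber_grading gS gT \<pi>S \<pi>T n = {(s, t). s \<in> gS n \<and> t \<in> gT n \<and> \<pi>S s = \<pi>T t}"

definition local_ring_with :: "'a ring \<Rightarrow> 'a set \<Rightarrow> bool" where
  "local_ring_with A I \<longleftrightarrow> cring A \<and> (\<forall>J. maximalideal J A \<longleftrightarrow> J = I)"

definition local_case ::
    "'s ring \<Rightarrow> 't ring \<Rightarrow> 'k ring \<Rightarrow> ('s \<Rightarrow> 'k) \<Rightarrow> ('t \<Rightarrow> 'k) \<Rightarrow> ('s, 'm) module \<Rightarrow> bool" where
  "local_case S T k \<pi>S \<pi>T M \<longleftrightarrow>
     noetherian_ring S \<and> local_ring_with S (a_kernel S k \<pi>S) \<and>
     noetherian_ring T \<and> local_ring_with T (a_kernel T k \<pi>T) \<and>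
     finitely_spanned S M (carrier M)"

definition graded_case ::
    "'s ring \<Rightarrow> 't ring \<Rightarrow> 'k ring \<Rightarrow> ('s \<Rightarrow> 'k) \<Rightarrow> ('t \<Rightarrow> 'k) \<Rightarrow> ('s, 'm) module \<Rightarrow>
     (int \<Rightarrow> 's set) \<Rightarrow> ('k \<Rightarrow> 's) \<Rightarrow> (int \<Rightarrow> 't set) \<Rightarrow> ('k \<Rightarrow> 't) \<Rightarrow> (int \<Rightarrow> 'm set) \<Rightarrow> bool" where
  "graded_case S T k \<pi>S \<pi>T M gS \<eta>S gT \<eta>T gM \<longleftrightarrow>
     connected_algebra k S gS \<eta>S \<and> (\<forall>u\<in>carrier k. \<pi>S (\<eta>S u) = u) \<and>
     a_kernel S k \<pi>S = irrelevant_part S gS \<and>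
     connected_algebra k T gT \<eta>T \<and> (\<forall>u\<in>carrier k. \<pi>T (\<eta>T u) = u) \<and>
     a_kernel T k \<pi>T = irrelevant_part T gT \<and>
     graded_module S gS M gM \<and> (\<exists>b. \<forall>n<b. gM n = {\<zero>\<^bsub>M\<^esub>}) \<and>
     (\<forall>n. finitely_spanned k (restrict_scalars \<eta>S M) (gM n))"


section \<open>The complex of words\<close>

text \<open>A letter carries its homological degree, since the modules of a complex need not have
  disjoint carriers.\<close>

datatype ('p, 'e, 'f) letter =
    is_P: LetP nat 'p
  | is_E: LetE nat 'e
  | is_F: LetF nat 'f

fun letter_deg :: "('p, 'e, 'f) letter \<Rightarrow> nat" where
  "letter_deg (LetP i p) = i"
| "letter_deg (LetE i e) = i"
| "letter_deg (LetF i f) = i"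

type_synonym ('p, 'e, 'f) word = "('p, 'e, 'f) letter list"

definition word_deg :: "('p, 'e, 'f) word \<Rightarrow> nat" where
  "word_deg w = (\<Sum>x\<leftarrow>w. letter_deg x)"

definition EF_letters ::
    "('s, 'e) based_cpx \<Rightarrow> ('t, 'f) based_cpx \<Rightarrow> ('p, 'e, 'f) letter set" where
  "EF_letters E F = {LetE i e | i e. 1 \<le> i \<and> e \<in> bas E i} \<union> {LetF i f | i f. 1 \<le> i \<and> f \<in> bas F i}"

definition words ::
    "('s, 'p) based_cpx \<Rightarrow> ('s, 'e) based_cpx \<Rightarrow> ('t, 'f) based_cpx \<Rightarrow> ('p, 'e, 'f) word set" where
  "words P E F = {us @ [LetP j p] | us j p.
     p \<in> bas P j \<and> set us \<subseteq> EF_letters E F \<and>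
     successively (\<lambda>x y. is_E x \<noteq> is_E y) us \<and> (us \<noteq> [] \<longrightarrow> is_F (last us))}"

definition words_of_deg ::
    "('s, 'p) based_cpx \<Rightarrow> ('s, 'e) based_cpx \<Rightarrow> ('t, 'f) based_cpx \<Rightarrow> nat \<Rightarrow> ('p, 'e, 'f) word set"
  where
  "words_of_deg P E F i = {w \<in> words P E F. word_deg w = i}"

definition word_module ::
    "'s ring \<Rightarrow> 't ring \<Rightarrow> ('s \<Rightarrow> 'k) \<Rightarrow> ('t \<Rightarrow> 'k) \<Rightarrow>
     ('s, 'p) based_cpx \<Rightarrow> ('s, 'e) based_cpx \<Rightarrow> ('t, 'f) based_cpx \<Rightarrow>
     nat \<Rightarrow> ('s \<times> 't, ('p, 'e, 'f) word \<Rightarrow> 's \<times> 't) module" where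
  "word_module S T \<pi>S \<pi>T P E F i = free_module (fiber_product S T \<pi>S \<pi>T) (words_of_deg P E F i)"

text \<open>Putting a basis element in front of a word. In degree \<open>0\<close> the only basis element of \<open>E\<close>
  and of \<open>F\<close> is the unit of the ring, which is dropped.\<close>

definition consE :: "nat \<Rightarrow> 'e \<Rightarrow> ('p, 'e, 'f) word \<Rightarrow> ('p, 'e, 'f) word" where
  "consE i e w = (if i = 0 then w else LetE i e # w)"

definition consF :: "nat \<Rightarrow> 'f \<Rightarrow> ('p, 'e, 'f) word \<Rightarrow> ('p, 'e, 'f) word" where
  "consF i f w = (if i = 0 then w else LetF i f # w)"

text \<open>The element \<open>\<Sum>\<^sub>y c\<^sub>y (y w)\<close>, where \<open>emb\<close> regards a coefficient as an element of the fiber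
  product and \<open>cns\<close> puts the basis element \<open>y\<close> in front of \<open>w\<close>.\<close>

definition prepend ::
    "('r, 'x) ring_scheme \<Rightarrow> ('r, 'w \<Rightarrow> 'r) module \<Rightarrow> ('a, 'y) ring_scheme \<Rightarrow> ('a \<Rightarrow> 'r) \<Rightarrow>
     ('b \<Rightarrow> 'w \<Rightarrow> 'w) \<Rightarrow> ('b \<Rightarrow> 'a) \<Rightarrow> 'w \<Rightarrow> 'w \<Rightarrow> 'r" where
  "prepend R N A emb cns c w =
     (\<Oplus>\<^bsub>N\<^esub>y\<in>{y. c y \<noteq> \<zero>\<^bsub>A\<^esub>}. emb (c y) \<odot>\<^bsub>N\<^esub> single R (cns y w))"

text \<open>The value of the differential on a basis word of positive degree. A letter from \<open>P\<close> only
  occurs at the end of a word, so that \<open>w = []\<close> in the first equation.\<close>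

fun word_bdy ::
    "'s ring \<Rightarrow> 't ring \<Rightarrow> ('s \<Rightarrow> 'k) \<Rightarrow> ('t \<Rightarrow> 'k) \<Rightarrow>
     ('s, 'p) based_cpx \<Rightarrow> ('s, 'e) based_cpx \<Rightarrow> ('t, 'f) based_cpx \<Rightarrow>
     ('s \<times> 't, ('p, 'e, 'f) word \<Rightarrow> 's \<times> 't) module \<Rightarrow>
     ('p, 'e, 'f) word \<Rightarrow> ('p, 'e, 'f) word \<Rightarrow> 's \<times> 't" where
  "word_bdy S T \<pi>S \<pi>T P E F N (LetP i p # w) =
     prepend (fiber_product S T \<pi>S \<pi>T) N S (\<lambda>s. (s, \<zero>\<^bsub>T\<^esub>)) (\<lambda>y w. LetP (i - 1) y # w)
       (coords S (chn P (i - 1)) (bas P (i - 1)) (bdy P i p)) w"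
| "word_bdy S T \<pi>S \<pi>T P E F N (LetE i e # w) =
     prepend (fiber_product S T \<pi>S \<pi>T) N S (\<lambda>s. (s, \<zero>\<^bsub>T\<^esub>)) (consE (i - 1))
       (coords S (chn E (i - 1)) (bas E (i - 1)) (bdy E i e)) w"
| "word_bdy S T \<pi>S \<pi>T P E F N (LetF i f # w) =
     prepend (fiber_product S T \<pi>S \<pi>T) N T (\<lambda>t. (\<zero>\<^bsub>S\<^esub>, t)) (consF (i - 1))
       (coords T (chn F (i - 1)) (bas F (i - 1)) (bdy F i f)) w"
| "word_bdy S T \<pi>S \<pi>T P E F N [] = undefined"

definition word_cpx ::
    "'s ring \<Rightarrow> 't ring \<Rightarrow> ('s \<Rightarrow> 'k) \<Rightarrow> ('t \<Rightarrow> 'k) \<Rightarrow>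
     ('s, 'p) based_cpx \<Rightarrow> ('s, 'e) based_cpx \<Rightarrow> ('t, 'f) based_cpx \<Rightarrow>
     ('s \<times> 't, ('p, 'e, 'f) word \<Rightarrow> 's \<times> 't) cpx" where
  "word_cpx S T \<pi>S \<pi>T P E F = \<lparr>
     chn = word_module S T \<pi>S \<pi>T P E F,
     bdy = (\<lambda>i. let N = word_module S T \<pi>S \<pi>T P E F (i - 1) in
              lin_ext (fiber_product S T \<pi>S \<pi>T) N (word_bdy S T \<pi>S \<pi>T P E F N))\<rparr>"

text \<open>The words of degree \<open>0\<close> are the one-letter words \<open>[LetP 0 p]\<close>.\<close>

fun word_aug :: "('p \<Rightarrow> 'm) \<Rightarrow> ('p, 'e, 'f) word \<Rightarrow> 'm" where
  "word_aug \<epsilon> [LetP i p] = \<epsilon> p"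
| "word_aug \<epsilon> _ = undefined"

definition cpx_aug ::
    "'s ring \<Rightarrow> 't ring \<Rightarrow> ('s \<Rightarrow> 'k) \<Rightarrow> ('t \<Rightarrow> 'k) \<Rightarrow> ('s, 'm) module \<Rightarrow> ('p \<Rightarrow> 'm) \<Rightarrow>
     (('p, 'e, 'f) word \<Rightarrow> 's \<times> 't) \<Rightarrow> 'm" where
  "cpx_aug S T \<pi>S \<pi>T M \<epsilon> =
     lin_ext (fiber_product S T \<pi>S \<pi>T) (restrict_scalars fst M) (word_aug \<epsilon>)"

text \<open>The internal degree of a homogeneous basis element, and of a word as the sum of the
  internal degrees of its letters.\<close>

definition idegree :: "(int \<Rightarrow> 'm set) \<Rightarrow> 'm \<Rightarrow> int" where
  "idegree gM x = (THE n. x \<in> gM n)"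

fun letter_ideg ::
    "(nat \<Rightarrow> int \<Rightarrow> 'p set) \<Rightarrow> (nat \<Rightarrow> int \<Rightarrow> 'e set) \<Rightarrow> (nat \<Rightarrow> int \<Rightarrow> 'f set) \<Rightarrow>
     ('p, 'e, 'f) letter \<Rightarrow> int" where
  "letter_ideg gP gE gF (LetP i p) = idegree (gP i) p"
| "letter_ideg gP gE gF (LetE i e) = idegree (gE i) e"
| "letter_ideg gP gE gF (LetF i f) = idegree (gF i) f"

definition word_ideg ::
    "(nat \<Rightarrow> int \<Rightarrow> 'p set) \<Rightarrow> (nat \<Rightarrow> int \<Rightarrow> 'e set) \<Rightarrow> (nat \<Rightarrow> int \<Rightarrow> 'f set) \<Rightarrow>
     ('p, 'e, 'f) word \<Rightarrow> int" where
  "word_ideg gP gE gF w = (\<Sum>x\<leftarrow>w. letter_ideg gP gE gF x)"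

text \<open>The grading of a free module for which the basis element \<open>b\<close> has degree \<open>\<delta> b\<close>.\<close>

definition free_grading ::
    "(int \<Rightarrow> 'r set) \<Rightarrow> ('b \<Rightarrow> int) \<Rightarrow> ('r, 'b \<Rightarrow> 'r) module \<Rightarrow> int \<Rightarrow> ('b \<Rightarrow> 'r) set" where
  "free_grading gR \<delta> N n = {c \<in> carrier N. \<forall>b. c b \<in> gR (n - \<delta> b)}"

end

theory Submission
  imports Defs
begin

text \<open>Sort the words into blocks in two ways. The first components of the coefficients of an
  element of \<open>G\<close> split into the coefficients of a chain of \<open>P\<close> and, for every word \<open>w\<close> beginning
  with a letter from \<open>F\<close>, of a chain of \<open>E\<close> placed in front of \<open>w\<close>; here \<open>w\<close> itself belongs to the
  basis element of \<open>E\<^sub>0\<close>. The second components split into chains of \<open>F\<close> placed in front of the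
  remaining words. The differential of \<open>G\<close> acts on each block as the differential of \<open>P\<close>, \<open>E\<close> or
  \<open>F\<close>, so that \<open>G\<close> is a fiber product of a complex over \<open>S\<close> and a complex over \<open>T\<close> over a complex
  over \<open>k\<close> with zero differential. A word that lies in degree \<open>0\<close> of its block on one side lies in
  positive degree (or in \<open>P\<close>) on the other side, where the coefficients of cycles are in \<open>\<pp>\<close> or
  \<open>\<qq>\<close>. Hence all coefficients of a cycle of \<open>G\<close> are in \<open>\<pp> \<times> \<qq>\<close>, every block of it is a boundary,
  and the preimages can be completed to an element of \<open>G\<close>.\<close>


section \<open>Left modules and free modules\<close>

text \<open>The obstacle is that a coefficient of \<open>G\<close> is a pair with a common residue
  in \<open>k\<close>, so a preimage found over \<open>S\<close> and one found over \<open>T\<close>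
  need not fit together. The alternation rule for words is what resolves this: at each word a
  preimage is prescribed in only one of its two components, and surjectivity of the residue maps
  supplies the other. At the bottom of a block everything rests on \<open>E\<close> and
  \<open>F\<close> being resolutions of \<open>k\<close> itself: an element of degree 0 bounds
  exactly when its coefficient has residue zero. Minimality acts twice. It makes
  \<open>(s, 0)\<close> and \<open>(0, t)\<close> elements of the fiber product, so that the
  differential exists at all, and it makes the residues of boundary coefficients vanish. The bases
  may be infinite, so infinitely many blocks can occur in one degree. Supports stay finite because
  zero blocks get zero preimages and the residue zero is lifted to zero. The given resolutions are
  replaced by their coefficient functions, since the boundary of a word is itself defined through
  coordinates.\<close>

lemma additive_map_zero:
  assumes "abelian_group G" "abelian_group H" "f \<in> carrier G \<rightarrow> carrier H"
    and "\<And>x y. x \<in> carrier G \<Longrightarrow> y \<in> carrier G \<Longrightarrow> f (x \<oplus>\<^bsub>G\<^esub> y) = f x \<oplus>\<^bsub>H\<^esub> f y"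
  shows "f \<zero>\<^bsub>G\<^esub> = \<zero>\<^bsub>H\<^esub>"
proof -
  interpret G: abelian_group G by fact
  interpret H: abelian_group H by fact
  have c: "f \<zero>\<^bsub>G\<^esub> \<in> carrier H" using assms(3) by auto
  have "f \<zero>\<^bsub>G\<^esub> \<oplus>\<^bsub>H\<^esub> f \<zero>\<^bsub>G\<^esub> = f \<zero>\<^bsub>G\<^esub>"
    using assms(4)[of "\<zero>\<^bsub>G\<^esub>" "\<zero>\<^bsub>G\<^esub>"] by simp
  then show ?thesis using c H.add.l_cancel_one by blast
qed

text \<open>Stated for abelian groups, so that it also covers maps that are linear only along a
  change of rings and the evaluation of a coefficient function at a point.\<close>

lemma additive_map_finsum:
  assumes "abelian_group G" "abelian_group H" "f \<in> carrier G \<rightarrow> carrier H"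
    and "\<And>x y. x \<in> carrier G \<Longrightarrow> y \<in> carrier G \<Longrightarrow> f (x \<oplus>\<^bsub>G\<^esub> y) = f x \<oplus>\<^bsub>H\<^esub> f y"
    and "g \<in> I \<rightarrow> carrier G"
  shows "f (\<Oplus>\<^bsub>G\<^esub>i\<in>I. g i) = (\<Oplus>\<^bsub>H\<^esub>i\<in>I. f (g i))"
proof -
  interpret G: abelian_group G by fact
  interpret H: abelian_group H by fact
  note z = additive_map_zero[OF assms(1-4)]
  show ?thesis
  proof (cases "finite I")
    case True
    then show ?thesis using assms(5)
    proof (induction I)
      case empty
      then show ?case using z by simp
    next
      case (insert x F)
      have "finsum G g F \<in> carrier G" using insert by (intro G.finsum_closed) auto
      moreover have "f \<circ> g \<in> F \<rightarrow> carrier H" using insert assms(3) by auto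
      ultimately show ?case using insert assms(3,4)
        by (simp add: Pi_iff)
    qed
  next
    case False
    \<comment> \<open>Over an infinite index set both sums are zero by convention.\<close>
    then show ?thesis using z by simp
  qed
qed

lemma subgroup_finsum_closed:
  assumes "abelian_group G" "additive_subgroup H G" "g \<in> I \<rightarrow> H"
  shows "(\<Oplus>\<^bsub>G\<^esub>i\<in>I. g i) \<in> H"
proof -
  interpret G: abelian_group G by fact
  interpret H: additive_subgroup H G by fact
  show ?thesis
  proof (cases "finite I")
    case True
    then show ?thesis using assms(3)
    proof (induction I)
      case (insert x F)
      have "g \<in> F \<rightarrow> carrier G" "g x \<in> carrier G"
        using insert.prems H.a_Hcarr by blast+
      then show ?case using insert by (simp add: Pi_iff)
    qed simp
  qed simp
qed

section \<open>Homomorphisms and scalar multiplication\<close>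

lemma lmod_homD:
  assumes "f \<in> lmod_hom A M N"
  shows "f \<in> carrier M \<rightarrow> carrier N"
    and "x \<in> carrier M \<Longrightarrow> f x \<in> carrier N"
    and "x \<in> carrier M \<Longrightarrow> y \<in> carrier M \<Longrightarrow> f (x \<oplus>\<^bsub>M\<^esub> y) = f x \<oplus>\<^bsub>N\<^esub> f y"
    and "a \<in> carrier A \<Longrightarrow> x \<in> carrier M \<Longrightarrow> f (a \<odot>\<^bsub>M\<^esub> x) = a \<odot>\<^bsub>N\<^esub> f x"
  using assms unfolding lmod_hom_def by auto

lemma lmod_homI:
  assumes "\<And>x. x \<in> carrier M \<Longrightarrow> f x \<in> carrier N"
    and "\<And>x y. x \<in> carrier M \<Longrightarrow> y \<in> carrier M \<Longrightarrow> f (x \<oplus>\<^bsub>M\<^esub> y) = f x \<oplus>\<^bsub>N\<^esub> f y"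
    and "\<And>a x. a \<in> carrier A \<Longrightarrow> x \<in> carrier M \<Longrightarrow> f (a \<odot>\<^bsub>M\<^esub> x) = a \<odot>\<^bsub>N\<^esub> f x"
  shows "f \<in> lmod_hom A M N"
  using assms unfolding lmod_hom_def by auto

lemma lmod_hom_comp:
  assumes "f \<in> lmod_hom A L M" "g \<in> lmod_hom A M N"
  shows "(\<lambda>x. g (f x)) \<in> lmod_hom A L N"
  using lmod_homD[OF assms(1)] lmod_homD[OF assms(2)] by (intro lmod_homI) auto

lemma left_module_abelian_group: "left_module A M \<Longrightarrow> abelian_group M"
  by (simp add: left_module_def)

lemma lmod_hom_zero:
  assumes "left_module A M" "left_module A N" "f \<in> lmod_hom A M N"
  shows "f \<zero>\<^bsub>M\<^esub> = \<zero>\<^bsub>N\<^esub>"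
  using additive_map_zero[OF assms(1,2)[THEN left_module_abelian_group]] lmod_homD[OF assms(3)]
  by auto

lemma lmod_hom_finsum:
  assumes "left_module A M" "left_module A N" "f \<in> lmod_hom A M N" "g \<in> I \<rightarrow> carrier M"
  shows "f (\<Oplus>\<^bsub>M\<^esub>i\<in>I. g i) = (\<Oplus>\<^bsub>N\<^esub>i\<in>I. f (g i))"
  using additive_map_finsum[OF assms(1,2)[THEN left_module_abelian_group] _ _ assms(4)]
    lmod_homD[OF assms(3)] by auto

context left_module
begin

lemma smult_zero_left: "x \<in> carrier M \<Longrightarrow> \<zero>\<^bsub>R\<^esub> \<odot>\<^bsub>M\<^esub> x = \<zero>\<^bsub>M\<^esub>"
  using additive_map_zero[of R M "\<lambda>a. a \<odot>\<^bsub>M\<^esub> x"] R.is_abelian_group M.abelian_group_axioms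
  by (auto simp: smult_closed smult_l_distr)

lemma smult_zero_right: "a \<in> carrier R \<Longrightarrow> a \<odot>\<^bsub>M\<^esub> \<zero>\<^bsub>M\<^esub> = \<zero>\<^bsub>M\<^esub>"
  using additive_map_zero[of M M "\<lambda>x. a \<odot>\<^bsub>M\<^esub> x"] M.abelian_group_axioms
  by (auto simp: smult_closed smult_r_distr)

lemma smult_finsum:
  "a \<in> carrier R \<Longrightarrow> g \<in> I \<rightarrow> carrier M \<Longrightarrow>
    a \<odot>\<^bsub>M\<^esub> (\<Oplus>\<^bsub>M\<^esub>i\<in>I. g i) = (\<Oplus>\<^bsub>M\<^esub>i\<in>I. a \<odot>\<^bsub>M\<^esub> g i)"
  using additive_map_finsum[of M M "\<lambda>x. a \<odot>\<^bsub>M\<^esub> x"] M.abelian_group_axioms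
  by (auto simp: smult_closed smult_r_distr)

end

text \<open>The constants of free modules only accept module records that are not extended further.\<close>

locale lmod = left_module R M
    for R :: "('a, 'x) ring_scheme" (structure) and M :: "('a, 'm) module" (structure)

section \<open>Free modules and linear extension\<close>

lemma free_module_simps [simp]:
  "c \<in> carrier (free_module A B) \<longleftrightarrow>
     (\<forall>b. c b \<in> carrier A) \<and> (\<forall>b. b \<notin> B \<longrightarrow> c b = \<zero>\<^bsub>A\<^esub>) \<and> finite {b. c b \<noteq> \<zero>\<^bsub>A\<^esub>}"
  "\<zero>\<^bsub>free_module A B\<^esub> = (\<lambda>_. \<zero>\<^bsub>A\<^esub>)"
  "c \<oplus>\<^bsub>free_module A B\<^esub> d = (\<lambda>b. c b \<oplus>\<^bsub>A\<^esub> d b)"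
  "a \<odot>\<^bsub>free_module A B\<^esub> c = (\<lambda>b. a \<otimes>\<^bsub>A\<^esub> c b)"
  by (auto simp: free_module_def)

lemma (in ring) left_module_free_module: "left_module R (free_module R B)"
proof -
  let ?M = "free_module R B"
  have fin_add: "finite {b. c b \<oplus> d b \<noteq> \<zero>}"
    if "finite {b. c b \<noteq> \<zero>}" "finite {b. d b \<noteq> \<zero>}" for c d :: "'c \<Rightarrow> 'a"
    using that by (auto intro!: finite_subset[of "{b. c b \<oplus> d b \<noteq> \<zero>}" "{b. c b \<noteq> \<zero>} \<union> {b. d b \<noteq> \<zero>}"])
  have fin_mul: "finite {b. a \<otimes> c b \<noteq> \<zero>}"
    if "a \<in> carrier R" "finite {b. c b \<noteq> \<zero>}" for c :: "'c \<Rightarrow> 'a" and a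
    using that by (auto intro!: finite_subset[of "{b. a \<otimes> c b \<noteq> \<zero>}" "{b. c b \<noteq> \<zero>}"])
  have "abelian_group ?M"
  proof (rule abelian_groupI)
    fix x assume x: "x \<in> carrier ?M"
    have "{b. \<ominus> x b \<noteq> \<zero>} = {b. x b \<noteq> \<zero>}" using x by auto
    then show "\<exists>y\<in>carrier ?M. y \<oplus>\<^bsub>?M\<^esub> x = \<zero>\<^bsub>?M\<^esub>"
      using x by (intro bexI[of _ "\<lambda>b. \<ominus> x b"]) (auto simp: l_neg)
  qed (auto simp: fin_add a_ac)
  then show ?thesis
    unfolding left_module_def left_module_axioms_def
    using ring_axioms by (auto simp: fin_mul l_distr r_distr m_assoc)
qed

lemma (in ring) single_closed: "b \<in> B \<Longrightarrow> single R b \<in> carrier (free_module R B)"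
  by (auto simp: single_def)

text \<open>Evaluation at \<open>b\<close> is additive and therefore commutes with sums.\<close>

lemma (in ring) finsum_free_module:
  assumes "\<And>i. i \<in> I \<Longrightarrow> g i \<in> carrier (free_module R B)"
  shows "(\<Oplus>\<^bsub>free_module R B\<^esub>i\<in>I. g i) b = (\<Oplus>i\<in>I. g i b)"
  using additive_map_finsum[of "free_module R B" R "\<lambda>c. c b" g I]
    left_module_abelian_group[OF left_module_free_module] is_abelian_group assms
  by (auto simp: Pi_iff)

context lmod
begin

text \<open>\<open>lin_ext\<close> sums over the support of its argument, which changes under
  addition and scaling; a fixed larger index set makes different sums comparable.\<close>

lemma lin_ext_superset:
  assumes "c \<in> carrier (free_module R B)" "f \<in> B \<rightarrow> carrier M"
    and "finite I" "I \<subseteq> B" "{b. c b \<noteq> \<zero>\<^bsub>R\<^esub>} \<subseteq> I"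
  shows "lin_ext R M f c = (\<Oplus>\<^bsub>M\<^esub>b\<in>I. c b \<odot>\<^bsub>M\<^esub> f b)"
  unfolding lin_ext_def
  by (rule M.add.finprod_mono_neutral_cong_left)
     (use assms in \<open>auto simp: smult_zero_left smult_closed Pi_iff subset_iff\<close>)

lemma lin_ext_hom:
  assumes f: "f \<in> B \<rightarrow> carrier M"
  shows "lin_ext R M f \<in> lmod_hom R (free_module R B) M"
proof (rule lmod_homI)
  fix c assume c: "c \<in> carrier (free_module R B)"
  have sc: "{b. c b \<noteq> \<zero>\<^bsub>R\<^esub>} \<subseteq> B" using c by auto
  show "lin_ext R M f c \<in> carrier M"
    unfolding lin_ext_def using c f sc by (intro M.finsum_closed) (auto simp: smult_closed Pi_iff subset_iff)
  fix a assume a: "a \<in> carrier R"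
  have "{b. a \<otimes>\<^bsub>R\<^esub> c b \<noteq> \<zero>\<^bsub>R\<^esub>} \<subseteq> {b. c b \<noteq> \<zero>\<^bsub>R\<^esub>}" using a by auto
  from finite_subset[OF this] have "lin_ext R M f (a \<odot>\<^bsub>free_module R B\<^esub> c) = (\<Oplus>\<^bsub>M\<^esub>b\<in>{b. c b \<noteq> \<zero>\<^bsub>R\<^esub>}. (a \<otimes>\<^bsub>R\<^esub> c b) \<odot>\<^bsub>M\<^esub> f b)"
    using a c f sc
    by (subst lin_ext_superset[of _ B f "{b. c b \<noteq> \<zero>\<^bsub>R\<^esub>}"]) auto
  also have "\<dots> = (\<Oplus>\<^bsub>M\<^esub>b\<in>{b. c b \<noteq> \<zero>\<^bsub>R\<^esub>}. a \<odot>\<^bsub>M\<^esub> (c b \<odot>\<^bsub>M\<^esub> f b))"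
    using a c f sc by (intro M.finsum_cong') (auto simp: smult_closed smult_assoc1 Pi_iff subset_iff)
  finally show "lin_ext R M f (a \<odot>\<^bsub>free_module R B\<^esub> c) = a \<odot>\<^bsub>M\<^esub> lin_ext R M f c"
    unfolding lin_ext_def using a c f sc
    by (subst smult_finsum) (auto simp: smult_closed Pi_iff subset_iff)
next
  fix c d assume c: "c \<in> carrier (free_module R B)" and d: "d \<in> carrier (free_module R B)"
  let ?I = "{b. c b \<noteq> \<zero>\<^bsub>R\<^esub>} \<union> {b. d b \<noteq> \<zero>\<^bsub>R\<^esub>}"
  interpret free: lmod R "free_module R B" by (rule lmod.intro[OF R.left_module_free_module])
  have I: "finite ?I" "?I \<subseteq> B" using c d by auto
  have "lin_ext R M f (c \<oplus>\<^bsub>free_module R B\<^esub> d) = (\<Oplus>\<^bsub>M\<^esub>b\<in>?I. (c b \<oplus>\<^bsub>R\<^esub> d b) \<odot>\<^bsub>M\<^esub> f b)"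
    using free.a_closed[OF c d] f I by (subst lin_ext_superset[of _ B f ?I]) auto
  also have "\<dots> = (\<Oplus>\<^bsub>M\<^esub>b\<in>?I. c b \<odot>\<^bsub>M\<^esub> f b \<oplus>\<^bsub>M\<^esub> d b \<odot>\<^bsub>M\<^esub> f b)"
    using c d f I by (intro M.finsum_cong') (auto simp: smult_closed smult_l_distr Pi_iff subset_iff)
  also have "\<dots> = (\<Oplus>\<^bsub>M\<^esub>b\<in>?I. c b \<odot>\<^bsub>M\<^esub> f b) \<oplus>\<^bsub>M\<^esub> (\<Oplus>\<^bsub>M\<^esub>b\<in>?I. d b \<odot>\<^bsub>M\<^esub> f b)"
    using c d f I by (intro M.finsum_addf) (auto simp: smult_closed Pi_iff subset_iff)
  also have "\<dots> = lin_ext R M f c \<oplus>\<^bsub>M\<^esub> lin_ext R M f d"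
    using c d f I by (simp add: lin_ext_superset[of _ B f ?I])
  finally show "lin_ext R M f (c \<oplus>\<^bsub>free_module R B\<^esub> d) = lin_ext R M f c \<oplus>\<^bsub>M\<^esub> lin_ext R M f d" .
qed

lemma lin_ext_single:
  assumes "f b \<in> carrier M"
  shows "lin_ext R M f (single R b) = f b"
proof -
  have "lin_ext R M f (single R b) = (\<Oplus>\<^bsub>M\<^esub>b'\<in>{b}. single R b b' \<odot>\<^bsub>M\<^esub> f b')"
    using assms by (intro lin_ext_superset[of _ "{b}"]) (auto simp: single_def)
  then show ?thesis using assms by (simp add: single_def smult_one smult_closed)
qed

lemma hom_lin_ext:
  assumes "left_module R N" "h \<in> lmod_hom R M N" "f \<in> B \<rightarrow> carrier M"
    and "c \<in> carrier (free_module R B)"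
  shows "h (lin_ext R M f c) = lin_ext R N (\<lambda>b. h (f b)) c"
proof -
  interpret N: left_module R N by fact
  have sc: "{b. c b \<noteq> \<zero>\<^bsub>R\<^esub>} \<subseteq> B" using assms(4) by auto
  show ?thesis unfolding lin_ext_def
    using lmod_homD[OF assms(2)] assms sc
    by (subst lmod_hom_finsum[OF left_module_axioms assms(1,2)])
       (auto simp: smult_closed N.smult_closed Pi_iff subset_iff intro!: N.finsum_cong')
qed

end

lemma (in ring) lin_ext_singles:
  assumes c: "c \<in> carrier (free_module R B)"
  shows "lin_ext R (free_module R B) (single R) c = c"
proof
  fix b
  interpret free: lmod R "free_module R B" by (rule lmod.intro[OF left_module_free_module])
  have sc: "{b. c b \<noteq> \<zero>} \<subseteq> B" "finite {b. c b \<noteq> \<zero>}" "\<And>b. c b \<in> carrier R"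
    and out: "b \<notin> {b. c b \<noteq> \<zero>} \<Longrightarrow> c b = \<zero>" using c by auto
  have "lin_ext R (free_module R B) (single R) c b = (\<Oplus>b'\<in>{b. c b \<noteq> \<zero>}. c b' \<otimes> single R b' b)"
  proof -
    have "c b' \<odot>\<^bsub>free_module R B\<^esub> single R b' \<in> carrier (free_module R B)" if "c b' \<noteq> \<zero>" for b'
      by (rule free.smult_closed, rule sc, rule single_closed) (use that sc in blast)
    then show ?thesis
      unfolding lin_ext_def by (subst finsum_free_module[where B = B]) (simp_all only: mem_Collect_eq free_module_simps(4))
  qed
  also have "\<dots> = (\<Oplus>b'\<in>{b. c b \<noteq> \<zero>}. if b = b' then c b' else \<zero>)"
    using sc by (intro finsum_cong') (auto simp: single_def)
  also have "\<dots> = c b"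
  \<comment> \<open>The index set contains \<open>b\<close> only if \<open>c b\<close> is nonzero;
    otherwise every summand vanishes.\<close>
  proof (cases "c b = \<zero>")
    case True
    have "(\<Oplus>b'\<in>{b. c b \<noteq> \<zero>}. if b = b' then c b' else \<zero>) = (\<Oplus>b'\<in>{b. c b \<noteq> \<zero>}. \<zero>)"
      using sc True by (intro finsum_cong') auto
    then show ?thesis using True by simp
  next
    case False
    then show ?thesis using sc by (intro finsum_singleton) auto
  qed
  finally show "lin_ext R (free_module R B) (single R) c b = c b" .
qed

section \<open>Coordinates with respect to a basis\<close>

locale based_module = lmod +
  fixes B
  assumes basis: "is_basis R M B"
begin

lemma basis_closed: "b \<in> B \<Longrightarrow> b \<in> carrier M"
  using basis by (auto simp: is_basis_def)

text \<open>Inverse to \<open>coords\<close>. The two maps identify \<open>M\<close> with the free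
  module on \<open>B\<close>, and the resolutions are moved along this identification.\<close>

abbreviation realize where "realize \<equiv> lin_ext R M (\<lambda>b. b)"

lemma realize_hom: "realize \<in> lmod_hom R (free_module R B) M"
  by (rule lin_ext_hom) (auto simp: basis_closed)

lemma coords_props:
  assumes "v \<in> carrier M"
  shows "coords R M B v \<in> carrier (free_module R B)" "realize (coords R M B v) = v"
proof -
  have "\<exists>!c. c \<in> carrier (free_module R B) \<and> v = realize c"
    using basis assms unfolding is_basis_def by blast
  from theI'[OF this] show "coords R M B v \<in> carrier (free_module R B)" "realize (coords R M B v) = v"
    unfolding coords_def by auto
qed

lemma coords_realize:
  assumes "c \<in> carrier (free_module R B)"
  shows "coords R M B (realize c) = c"
proof -
  have v: "realize c \<in> carrier M" using realize_hom assms by (rule lmod_homD)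
  then have "\<exists>!c'. c' \<in> carrier (free_module R B) \<and> realize c = realize c'"
    using basis unfolding is_basis_def by blast
  then show ?thesis using coords_props[OF v] assms by metis
qed

text \<open>The inverse of the linear bijection \<open>realize\<close> is linear.\<close>

lemma coords_hom: "coords R M B \<in> lmod_hom R M (free_module R B)"
proof (rule lmod_homI)
  interpret free: lmod R "free_module R B" by (rule lmod.intro[OF R.left_module_free_module])
  note [simp del] = free_module_simps
  note rl = lmod_homD[OF realize_hom]
  fix x assume x: "x \<in> carrier M"
  then show "coords R M B x \<in> carrier (free_module R B)" by (rule coords_props)
  note cx = coords_props[OF x]
  show "coords R M B (a \<odot>\<^bsub>M\<^esub> x) = a \<odot>\<^bsub>free_module R B\<^esub> coords R M B x" if "a \<in> carrier R" for a
    using that cx rl(4)[OF that cx(1)] coords_realize[OF free.smult_closed[OF that cx(1)]] by simp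
  show "coords R M B (x \<oplus>\<^bsub>M\<^esub> y) = coords R M B x \<oplus>\<^bsub>free_module R B\<^esub> coords R M B y"
    if "y \<in> carrier M" for y
    using cx coords_props[OF that] rl(3)[OF cx(1), of "coords R M B y"]
      coords_realize[OF free.a_closed[OF cx(1), of "coords R M B y"]] by simp
qed

text \<open>The elements whose coordinate at \<open>b\<close> lies in \<open>I\<close> form a
  subgroup. It contains each generator \<open>a x\<close> of \<open>ideal_smult I M\<close>: the
  coordinate of \<open>a x\<close> is \<open>a\<close> times that of \<open>x\<close>, and
  \<open>I\<close> absorbs factors on the right.\<close>

lemma coords_ideal_smult:
  assumes I: "ideal I R" and v: "v \<in> ideal_smult I M"
  shows "coords R M B v b \<in> I"
proof -
  interpret I: ideal I R by fact
  let ?X = "{a \<odot>\<^bsub>M\<^esub> x | a x. a \<in> I \<and> x \<in> carrier M}"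
  let ?Y = "{v \<in> carrier M. coords R M B v b \<in> I}"
  note co = lmod_homD[OF coords_hom]
  have bc: "coords R M B x b \<in> carrier R" if "x \<in> carrier M" for x
    using coords_props(1)[OF that] by auto
  have zero: "coords R M B \<zero>\<^bsub>M\<^esub> b = \<zero>\<^bsub>R\<^esub>"
    using lmod_hom_zero[OF left_module_axioms R.left_module_free_module coords_hom] by simp
  have "subgroup ?Y (add_monoid M)"
  proof (rule M.add.subgroupI)
    show "?Y \<noteq> {}" using zero by (auto intro!: exI[of _ "\<zero>\<^bsub>M\<^esub>"])
    fix x assume x: "x \<in> ?Y"
    have "coords R M B (\<ominus>\<^bsub>M\<^esub> x) b \<oplus>\<^bsub>R\<^esub> coords R M B x b = \<zero>\<^bsub>R\<^esub>"
      using co(3)[of "\<ominus>\<^bsub>M\<^esub> x" x] x zero by (simp add: M.l_neg)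
    then have "coords R M B (\<ominus>\<^bsub>M\<^esub> x) b = \<ominus>\<^bsub>R\<^esub> coords R M B x b"
      using x bc R.minus_equality[symmetric] by auto
    then show "\<ominus>\<^bsub>M\<^esub> x \<in> ?Y" using x by auto
    fix y assume y: "y \<in> ?Y"
    then show "x \<oplus>\<^bsub>M\<^esub> y \<in> ?Y" using x co(3)[of x y] by auto
  qed auto
  moreover have "?X \<subseteq> ?Y"
    using I.I_r_closed I.a_Hcarr bc smult_closed co(4) by (auto simp: bc)
  ultimately have "generate (add_monoid M) ?X \<subseteq> ?Y"
    using M.add.generate_subgroup_incl by blast
  then show ?thesis using v unfolding ideal_smult_def by blast
qed

end

text \<open>\<open>is_basis\<close> indexes coefficients by the basis vectors themselves, so they
  are carried back and forth between \<open>B\<close> and its image under \<open>single R\<close>; a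
  nontrivial ring makes \<open>single R\<close> injective.\<close>

lemma (in ring) is_basis_singles: "is_basis R (free_module R B) (single R ` B)"
  if "\<one> \<noteq> \<zero>"
proof -
  interpret free: lmod R "free_module R B" by (rule lmod.intro[OF left_module_free_module])
  note [simp del] = free_module_simps(1,4)
  have inj: "inj_on (single R) B" 
    using that by (auto simp: inj_on_def single_def fun_eq_iff split: if_splits)
  have eq: "lin_ext R (free_module R B) (\<lambda>b. b) c = (\<lambda>b. if b \<in> B then c (single R b) else \<zero>)"
    if c: "c \<in> carrier (free_module R (single R ` B))" for c
  proof -
    let ?d = "\<lambda>b. if b \<in> B then c (single R b) else \<zero>"
    have fin: "finite {x. c x \<noteq> \<zero>}" using c by (simp add: free_module_simps)
    have img: "{x. c x \<noteq> \<zero>} = single R ` {b. ?d b \<noteq> \<zero>}"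
      using c by (auto simp: free_module_simps)
    have "finite {b. ?d b \<noteq> \<zero>}"
      using fin unfolding img by (rule finite_imageD) (use inj in \<open>auto simp: inj_on_def split: if_splits\<close>)
    then have d: "?d \<in> carrier (free_module R B)"
      using c by (auto simp: free_module_simps)
    have "lin_ext R (free_module R B) (\<lambda>b. b) c
        = (\<Oplus>\<^bsub>free_module R B\<^esub>b\<in>{b. ?d b \<noteq> \<zero>}. c (single R b) \<odot>\<^bsub>free_module R B\<^esub> single R b)"
      unfolding lin_ext_def img using c inj
      by (intro free.finsum_reindex)
         (auto simp: inj_on_def Pi_iff free_module_simps(1)[of c] single_closed split: if_splits intro!: free.smult_closed)
    also have "\<dots> = lin_ext R (free_module R B) (single R) ?d"
      unfolding lin_ext_def using c
      by (intro free.finsum_cong') 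
        (auto simp: Pi_iff free_module_simps(1)[of c] single_closed split: if_splits intro!: free.smult_closed)
    also have "\<dots> = ?d" by (rule lin_ext_singles[OF d])
    finally show ?thesis .
  qed
  show ?thesis unfolding is_basis_def
  proof (intro conjI ballI)
    show "single R ` B \<subseteq> carrier (free_module R B)"
      by (rule image_subsetI) (rule single_closed)
    fix v assume v: "v \<in> carrier (free_module R B)"
    define c where "c = (\<lambda>x. if x \<in> single R ` B then v (the_inv_into B (single R) x) else \<zero>)"
    have cs: "c (single R b) = v b" if "b \<in> B" for b
      using that inj by (simp add: c_def the_inv_into_f_f)
    have "{x. c x \<noteq> \<zero>} \<subseteq> single R ` {b. v b \<noteq> \<zero>}"
      using inj by (auto simp: c_def the_inv_into_f_f)
    then have c: "c \<in> carrier (free_module R (single R ` B))"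
      using v by (auto simp: free_module_simps c_def finite_subset)
    show "\<exists>!c. c \<in> carrier (free_module R (single R ` B)) \<and> v = lin_ext R (free_module R B) (\<lambda>b. b) c"
    proof (intro ex1I[of _ c] conjI c)
      show "v = lin_ext R (free_module R B) (\<lambda>b. b) c"
        using v cs by (auto simp: eq[OF c] fun_eq_iff free_module_simps)
      fix d assume d: "d \<in> carrier (free_module R (single R ` B)) \<and> v = lin_ext R (free_module R B) (\<lambda>b. b) d"
      show "d = c"
      proof
        fix x show "d x = c x"
        proof (cases "x \<in> single R ` B")
          case True
          then show ?thesis using d cs by (auto simp: eq)
        next
          case False
          then show ?thesis using d c by (simp add: free_module_simps)
        qed
      qed
    qed
  qed
qed

section \<open>Restriction of scalars and the regular module\<close>

lemma restrict_scalars_simps [simp]: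
  "carrier (restrict_scalars h M) = carrier M"
  "\<zero>\<^bsub>restrict_scalars h M\<^esub> = \<zero>\<^bsub>M\<^esub>"
  "x \<oplus>\<^bsub>restrict_scalars h M\<^esub> y = x \<oplus>\<^bsub>M\<^esub> y"
  "a \<odot>\<^bsub>restrict_scalars h M\<^esub> x = h a \<odot>\<^bsub>M\<^esub> x"
  by (simp_all add: restrict_scalars_def)

lemma left_module_restrict_scalars:
  assumes "ring R" "h \<in> ring_hom R A" "left_module A M"
  shows "left_module R (restrict_scalars h M)"
proof -
  interpret M: left_module A M by fact
  have "abelian_group (restrict_scalars h M)"
    by (rule abelian_groupI) (auto simp: M.a_ac intro: M.a_inv_closed M.l_neg)
  then show ?thesis
    unfolding left_module_def left_module_axioms_def using assms
    by (auto simp: ring_hom_add ring_hom_mult ring_hom_one ring_hom_closed M.smult_closed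
        M.smult_l_distr M.smult_r_distr M.smult_assoc1 M.smult_one)
qed

lemma regular_module_simps [simp]:
  "carrier (regular_module A) = carrier A"
  "\<zero>\<^bsub>regular_module A\<^esub> = \<zero>\<^bsub>A\<^esub>"
  "x \<oplus>\<^bsub>regular_module A\<^esub> y = x \<oplus>\<^bsub>A\<^esub> y"
  "a \<odot>\<^bsub>regular_module A\<^esub> x = a \<otimes>\<^bsub>A\<^esub> x"
  by (simp_all add: regular_module_def)


section \<open>Coefficients along an injection of bases\<close>

text \<open>Reads one block off a chain of words: \<open>B\<close> is a basis of a module of
  \<open>P\<close>, \<open>E\<close> or \<open>F\<close>, \<open>\<kappa>\<close> puts its elements
  in front of a fixed word, and \<open>h\<close> is \<open>fst\<close> or \<open>snd\<close>. The
  zero outside \<open>B\<close> makes the result an element of the free module on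
  \<open>B\<close>.\<close>

definition pull ::
    "('a, 'x) ring_scheme \<Rightarrow> ('r \<Rightarrow> 'a) \<Rightarrow> ('b \<Rightarrow> 'w) \<Rightarrow> 'b set \<Rightarrow> ('w \<Rightarrow> 'r) \<Rightarrow> 'b \<Rightarrow> 'a" where
  "pull A h \<kappa> B z = (\<lambda>y. if y \<in> B then h (z (\<kappa> y)) else \<zero>\<^bsub>A\<^esub>)"

text \<open>Injectivity of \<open>\<kappa>\<close> is what keeps the support finite.\<close>

lemma pull_hom:
  assumes "ring R" "ring A" "h \<in> ring_hom R A" "inj_on \<kappa> B"
  shows "pull A h \<kappa> B \<in> lmod_hom R (free_module R W) (restrict_scalars h (free_module A B))"
proof (rule lmod_homI)
  interpret A: ring A by fact
  have h0: "h \<zero>\<^bsub>R\<^esub> = \<zero>\<^bsub>A\<^esub>" using ring_hom_zero assms by blast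
  fix z assume z: "z \<in> carrier (free_module R W)"
  have "{y. pull A h \<kappa> B z y \<noteq> \<zero>\<^bsub>A\<^esub>} \<subseteq> \<kappa> -` {w. z w \<noteq> \<zero>\<^bsub>R\<^esub>} \<inter> B"
    using h0 by (auto simp: pull_def split: if_splits)
  moreover have "finite (\<kappa> -` {w. z w \<noteq> \<zero>\<^bsub>R\<^esub>} \<inter> B)"
    using z assms(4) by (intro finite_vimage_IntI) auto
  ultimately have "finite {y. pull A h \<kappa> B z y \<noteq> \<zero>\<^bsub>A\<^esub>}" by (rule finite_subset)
  then show "pull A h \<kappa> B z \<in> carrier (restrict_scalars h (free_module A B))"
    using z assms(3) by (auto simp: pull_def ring_hom_closed)
  show "pull A h \<kappa> B (a \<odot>\<^bsub>free_module R W\<^esub> z)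
      = a \<odot>\<^bsub>restrict_scalars h (free_module A B)\<^esub> pull A h \<kappa> B z" if "a \<in> carrier R" for a
    using z that assms(3) by (auto simp: pull_def ring_hom_mult ring_hom_closed)
  show "pull A h \<kappa> B (z \<oplus>\<^bsub>free_module R W\<^esub> z')
      = pull A h \<kappa> B z \<oplus>\<^bsub>restrict_scalars h (free_module A B)\<^esub> pull A h \<kappa> B z'"
    if "z' \<in> carrier (free_module R W)" for z'
    using z that assms(3) by (auto simp: pull_def ring_hom_add)
qed

lemma lin_ext_reindex:
  fixes N1 :: "('r, 'n) module" and N2 :: "('a, 'm) module"
  assumes N1: "left_module R N1" and N2: "left_module A N2" and h: "h \<in> ring_hom R A"
    and \<phi>: "\<phi> \<in> lmod_hom R N1 (restrict_scalars h N2)"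
    and f: "\<And>w. w \<in> W \<Longrightarrow> f w \<in> carrier N1"
    and z: "z \<in> carrier (free_module R W)"
    and \<kappa>: "inj_on \<kappa> B" "\<kappa> ` B \<subseteq> W"
    and m: "\<And>y. y \<in> B \<Longrightarrow> \<phi> (f (\<kappa> y)) = m y"
    and off: "\<And>w. w \<in> W \<Longrightarrow> w \<notin> \<kappa> ` B \<Longrightarrow> \<phi> (f w) = \<zero>\<^bsub>N2\<^esub>"
  shows "\<phi> (lin_ext R N1 f z) = lin_ext A N2 m (pull A h \<kappa> B z)"
proof -
  interpret N1: lmod R N1 by (rule lmod.intro) fact
  interpret N2: lmod A N2 by (rule lmod.intro) fact
  note hom = lmod_homD[OF \<phi>, simplified]
  have h0: "h \<zero>\<^bsub>R\<^esub> = \<zero>\<^bsub>A\<^esub>" using ring_hom_zero N1.R.ring_axioms N2.R.ring_axioms h by blast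
  have zc: "z w \<in> carrier R" for w using z by auto
  have hz: "h (z w) \<in> carrier A" for w using zc h by (auto simp: ring_hom_closed)
  let ?Z = "{w. z w \<noteq> \<zero>\<^bsub>R\<^esub>}"
  have Z: "finite ?Z" "?Z \<subseteq> W" using z by auto
  \<comment> \<open>The basis elements whose words lie in the support of \<open>z\<close>. The
    support of the pulled back function can be smaller, because \<open>h\<close> may kill a nonzero
    coefficient.\<close>
  define J where "J = \<kappa> -` ?Z \<inter> B"
  have J: "finite J"
    unfolding J_def by (rule finite_vimage_IntI[OF Z(1) \<kappa>(1)])
  have J: "finite J" "J \<subseteq> B" "\<kappa> ` J = ?Z \<inter> \<kappa> ` B" "inj_on \<kappa> J"
    using J unfolding J_def using \<kappa>(1) by (auto intro: inj_on_subset)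
  have my: "m y \<in> carrier N2" if "y \<in> B" for y
    using m[OF that] hom(2) f \<kappa>(2) that by (metis image_subset_iff)
  have "\<phi> (lin_ext R N1 f z) = (\<Oplus>\<^bsub>N2\<^esub>w\<in>?Z. \<phi> (z w \<odot>\<^bsub>N1\<^esub> f w))"
    unfolding lin_ext_def using hom f Z zc
    by (intro additive_map_finsum) (auto simp: N1.M.abelian_group_axioms N2.M.abelian_group_axioms N1.smult_closed)
  also have "\<dots> = (\<Oplus>\<^bsub>N2\<^esub>w\<in>?Z. h (z w) \<odot>\<^bsub>N2\<^esub> \<phi> (f w))"
    using hom f Z zc hz by (intro N2.M.finsum_cong') (auto simp: N2.smult_closed)
  also have "\<dots> = (\<Oplus>\<^bsub>N2\<^esub>w\<in>\<kappa> ` J. h (z w) \<odot>\<^bsub>N2\<^esub> \<phi> (f w))"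
    using hom f Z zc hz J off
    by (intro N2.M.add.finprod_mono_neutral_cong_right) (auto simp: N2.smult_closed N2.smult_zero_right)
  also have "\<dots> = (\<Oplus>\<^bsub>N2\<^esub>y\<in>J. h (z (\<kappa> y)) \<odot>\<^bsub>N2\<^esub> \<phi> (f (\<kappa> y)))"
    using hom f Z zc hz J by (intro N2.M.finsum_reindex) (auto simp: N2.smult_closed)
  also have "\<dots> = (\<Oplus>\<^bsub>N2\<^esub>y\<in>J. pull A h \<kappa> B z y \<odot>\<^bsub>N2\<^esub> m y)"
    using J(2) my hz m by (intro N2.M.finsum_cong') (auto simp: N2.smult_closed pull_def subset_iff)
  also have "\<dots> = lin_ext A N2 m (pull A h \<kappa> B z)"
  proof (rule N2.lin_ext_superset[symmetric])
    show "pull A h \<kappa> B z \<in> carrier (free_module A B)"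
      using lmod_homD(2)[OF pull_hom z] N1.R.ring_axioms N2.R.ring_axioms h \<kappa>(1)
      by (metis restrict_scalars_simps(1))
    show "{b. pull A h \<kappa> B z b \<noteq> \<zero>\<^bsub>A\<^esub>} \<subseteq> J"
      using h0 by (auto simp: pull_def J_def split: if_splits)
  qed (use J my in auto)
  finally show ?thesis .
qed


section \<open>Resolutions in coordinates\<close>

locale minimal_resolution = ring A
  for A :: "('a, 'x) ring_scheme" (structure) +
  fixes X :: "('a, 'b) based_cpx" and \<epsilon> :: "'b \<Rightarrow> 'n" and N :: "('a, 'n) module" and I
  assumes resolution: "free_resolution A X \<epsilon> N" and minimal: "minimal_cpx I X"
    and based: "based A X" and ideal: "ideal I A"
begin

lemma based_module: "based_module A (chn X i) (bas X i)"
  using resolution based unfolding free_resolution_def based_def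
  by (simp add: based_module_def lmod_def based_module_axioms_def)

lemma left_module_target: "left_module A N"
  using resolution unfolding free_resolution_def by simp

abbreviation "coef i \<equiv> free_module A (bas X i)"
abbreviation "crd i \<equiv> coords A (chn X i) (bas X i)"
abbreviation "rlz i \<equiv> lin_ext A (chn X i) (\<lambda>b. b)"

text \<open>The boundary conjugated by the coordinate isomorphisms. The index is that of the target,
  so the irrelevant \<open>bdy X 0\<close> never appears.\<close>

definition "dif i c = crd i (bdy X (Suc i) (rlz (Suc i) c))"
definition "aug c = \<epsilon> (rlz 0 c)"

lemma left_module_coef: "left_module A (free_module A B)"
  by (rule left_module_free_module)

lemma bdy_hom: "bdy X (Suc i) \<in> lmod_hom A (chn X (Suc i)) (chn X i)"
  and eps_hom: "\<epsilon> \<in> lmod_hom A (chn X 0) N"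
  and bdy_exact: "bdy X (Suc (Suc i)) ` carrier (chn X (Suc (Suc i)))
          = a_kernel (chn X (Suc i)) (chn X i) (bdy X (Suc i))"
  and eps_exact: "bdy X (Suc 0) ` carrier (chn X (Suc 0)) = a_kernel (chn X 0) N \<epsilon>"
  and eps_surj: "\<epsilon> ` carrier (chn X 0) = carrier N"
  using resolution unfolding free_resolution_def by auto

lemmas rlz_hom = based_module.realize_hom[OF based_module]
lemmas crd_hom = based_module.coords_hom[OF based_module]
lemmas crd_rlz = based_module.coords_realize[OF based_module]
lemmas rlz_crd = based_module.coords_props(2)[OF based_module]
lemmas crd_closed = based_module.coords_props(1)[OF based_module]

lemma dif_hom: "dif i \<in> lmod_hom A (coef (Suc i)) (coef i)"
  unfolding dif_def[abs_def]
  by (rule lmod_hom_comp[OF lmod_hom_comp[OF rlz_hom bdy_hom] crd_hom])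

lemma dif_minimal: "c \<in> carrier (coef (Suc i)) \<Longrightarrow> dif i c b \<in> I"
  unfolding dif_def
  by (rule based_module.coords_ideal_smult[OF based_module ideal])
     (use minimal lmod_homD(2)[OF rlz_hom] in \<open>unfold minimal_cpx_def, blast\<close>)

lemma basis_closed: "b \<in> bas X i \<Longrightarrow> b \<in> carrier (chn X i)"
  by (rule based_module.basis_closed[OF based_module])

text \<open>This is the shape in which \<open>word_bdy\<close> refers to the resolution, namely
  through the coordinates of boundaries of basis elements, and the shape required by
  \<open>lin_ext_reindex\<close>.\<close>

lemma dif_eq_lin_ext:
  assumes "c \<in> carrier (coef (Suc i))"
  shows "dif i c = lin_ext A (coef i) (\<lambda>y. crd i (bdy X (Suc i) y)) c"
proof -
  interpret M: lmod A "chn X (Suc i)" using based_module by (simp add: based_module_def)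
  show ?thesis unfolding dif_def
    by (rule M.hom_lin_ext[OF left_module_coef lmod_hom_comp[OF bdy_hom crd_hom] _ assms])
       (simp add: basis_closed)
qed

lemma aug_eq_lin_ext:
  assumes "c \<in> carrier (coef 0)"
  shows "aug c = lin_ext A N \<epsilon> c"
proof -
  interpret M: lmod A "chn X 0" using based_module by (simp add: based_module_def)
  show ?thesis unfolding aug_def
    by (rule M.hom_lin_ext[OF left_module_target eps_hom _ assms]) (simp add: basis_closed)
qed

lemma rlz_single: "y \<in> bas X i \<Longrightarrow> rlz i (single A y) = y"
  using based_module[of i] basis_closed by (simp add: based_module_def lmod.lin_ext_single)

lemma crd_bdy_closed: "y \<in> bas X (Suc i) \<Longrightarrow> crd i (bdy X (Suc i) y) \<in> carrier (coef i)"
  by (rule crd_closed, rule lmod_homD(2)[OF bdy_hom], rule basis_closed)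

lemma crd_bdy_minimal: "y \<in> bas X (Suc i) \<Longrightarrow> crd i (bdy X (Suc i) y) b \<in> I"
  using dif_minimal[OF single_closed, of y i b] by (simp add: dif_def rlz_single)

lemma chn_abelian: "abelian_group (chn X i)"
  using based_module by (simp add: based_module_def lmod_def left_module_def)

lemma crd_zero: "crd i \<zero>\<^bsub>chn X i\<^esub> = (\<lambda>_. \<zero>)"
  using lmod_hom_zero[OF _ left_module_coef crd_hom] based_module by (simp add: based_module_def lmod_def)

lemma rlz_zero: "rlz i (\<lambda>_. \<zero>) = \<zero>\<^bsub>chn X i\<^esub>"
  by (simp add: lin_ext_def abelian_monoid.finsum_empty chn_abelian abelian_group.axioms(1))

lemma dif_dif:
  assumes "c \<in> carrier (coef (Suc (Suc i)))"
  shows "dif i (dif (Suc i) c) = (\<lambda>_. \<zero>)"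
proof -
  let ?x = "bdy X (Suc (Suc i)) (rlz (Suc (Suc i)) c)"
  have r: "rlz (Suc (Suc i)) c \<in> carrier (chn X (Suc (Suc i)))"
    using assms by (rule lmod_homD(2)[OF rlz_hom])
  then have x: "?x \<in> carrier (chn X (Suc i))" by (rule lmod_homD(2)[OF bdy_hom])
  have "?x \<in> a_kernel (chn X (Suc i)) (chn X i) (bdy X (Suc i))"
    using r bdy_exact by blast
  then have "bdy X (Suc i) ?x = \<zero>\<^bsub>chn X i\<^esub>" by (simp add: a_kernel_def')
  then show ?thesis unfolding dif_def by (simp add: rlz_crd[OF x] crd_zero)
qed

lemma aug_dif:
  assumes "c \<in> carrier (coef (Suc 0))"
  shows "aug (dif 0 c) = \<zero>\<^bsub>N\<^esub>"
proof -
  let ?x = "bdy X (Suc 0) (rlz (Suc 0) c)"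
  have r: "rlz (Suc 0) c \<in> carrier (chn X (Suc 0))"
    using assms by (rule lmod_homD(2)[OF rlz_hom])
  then have x: "?x \<in> carrier (chn X 0)" by (rule lmod_homD(2)[OF bdy_hom])
  have "?x \<in> a_kernel (chn X 0) N \<epsilon>"
    using r eps_exact by blast
  then have "\<epsilon> ?x = \<zero>\<^bsub>N\<^esub>" by (simp add: a_kernel_def')
  then show ?thesis unfolding dif_def aug_def by (simp add: rlz_crd[OF x])
qed

text \<open>In degree 0 the augmentation takes the place of the differential, so that exactness can
  be used uniformly in all degrees.\<close>

definition "cycle i c \<longleftrightarrow> (case i of 0 \<Rightarrow> aug c = \<zero>\<^bsub>N\<^esub> | Suc j \<Rightarrow> dif j c = (\<lambda>_. \<zero>))"

lemma cycle_exact: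
  assumes c: "c \<in> carrier (coef i)" and cyc: "cycle i c"
  shows "\<exists>c'\<in>carrier (coef (Suc i)). dif i c' = c"
proof -
  have r: "rlz i c \<in> carrier (chn X i)"
    using c by (rule lmod_homD(2)[OF rlz_hom])
  have "rlz i c \<in> bdy X (Suc i) ` carrier (chn X (Suc i))"
  proof (cases i)
    case 0
    then have "\<epsilon> (rlz i c) = \<zero>\<^bsub>N\<^esub>" using cyc by (simp add: cycle_def aug_def)
    then show ?thesis using 0 r eps_exact by (simp add: a_kernel_def')
  next
    case (Suc j)
    have x: "bdy X (Suc j) (rlz i c) \<in> carrier (chn X j)"
      using r Suc lmod_homD(2)[OF bdy_hom] by simp
    have "crd j (bdy X (Suc j) (rlz i c)) = (\<lambda>_. \<zero>)"
      using cyc Suc by (simp add: cycle_def dif_def)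
    then have "bdy X (Suc j) (rlz i c) = \<zero>\<^bsub>chn X j\<^esub>"
      using rlz_crd[OF x] rlz_zero by simp
    then show ?thesis using Suc r bdy_exact by (simp add: a_kernel_def')
  qed
  then obtain x where x: "x \<in> carrier (chn X (Suc i))" "rlz i c = bdy X (Suc i) x" by blast
  have "dif i (crd (Suc i) x) = c"
    unfolding dif_def using x crd_rlz[OF c] by (simp add: rlz_crd)
  then show ?thesis by (rule bexI[OF _ crd_closed[OF x(1)]])
qed

lemma aug_surj:
  assumes "n \<in> carrier N"
  shows "\<exists>c\<in>carrier (coef 0). aug c = n"
proof -
  obtain x where x: "x \<in> carrier (chn X 0)" "\<epsilon> x = n"
    using assms unfolding eps_surj[symmetric] by blast
  have "aug (crd 0 x) = n" unfolding aug_def rlz_crd[OF x(1)] by (rule x(2))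
  then show ?thesis by (rule bexI[OF _ crd_closed[OF x(1)]])
qed

end


section \<open>Fiber products\<close>

lemma fiber_product_simps [simp]:
  "r \<in> carrier (fiber_product S T \<pi>S \<pi>T) \<longleftrightarrow>
     fst r \<in> carrier S \<and> snd r \<in> carrier T \<and> \<pi>S (fst r) = \<pi>T (snd r)"
  "\<zero>\<^bsub>fiber_product S T \<pi>S \<pi>T\<^esub> = (\<zero>\<^bsub>S\<^esub>, \<zero>\<^bsub>T\<^esub>)"
  "\<one>\<^bsub>fiber_product S T \<pi>S \<pi>T\<^esub> = (\<one>\<^bsub>S\<^esub>, \<one>\<^bsub>T\<^esub>)"
  "r \<oplus>\<^bsub>fiber_product S T \<pi>S \<pi>T\<^esub> r' = (fst r \<oplus>\<^bsub>S\<^esub> fst r', snd r \<oplus>\<^bsub>T\<^esub> snd r')"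
  "r \<otimes>\<^bsub>fiber_product S T \<pi>S \<pi>T\<^esub> r' = (fst r \<otimes>\<^bsub>S\<^esub> fst r', snd r \<otimes>\<^bsub>T\<^esub> snd r')"
  by (auto simp: fiber_product_def RDirProd_def DirProd_def monoid.defs split: prod.splits)

lemma ring_fiber_product:
  assumes "ring S" "ring T" "ring k" "\<pi>S \<in> ring_hom S k" "\<pi>T \<in> ring_hom T k"
  shows "ring (fiber_product S T \<pi>S \<pi>T)"
proof -
  interpret S: ring S by fact
  interpret T: ring T by fact
  interpret k: ring k by fact
  interpret hS: ring_hom_ring S k \<pi>S by (intro ring_hom_ringI2 assms)
  interpret hT: ring_hom_ring T k \<pi>T by (intro ring_hom_ringI2 assms)
  show ?thesis
  proof (intro ringI abelian_groupI monoidI)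
    fix x assume x: "x \<in> carrier (fiber_product S T \<pi>S \<pi>T)"
    then show "\<exists>y\<in>carrier (fiber_product S T \<pi>S \<pi>T).
        y \<oplus>\<^bsub>fiber_product S T \<pi>S \<pi>T\<^esub> x = \<zero>\<^bsub>fiber_product S T \<pi>S \<pi>T\<^esub>"
      by (intro bexI[of _ "(\<ominus>\<^bsub>S\<^esub> fst x, \<ominus>\<^bsub>T\<^esub> snd x)"]) (auto simp: S.l_neg T.l_neg)
  qed (auto simp: S.a_ac T.a_ac S.m_assoc T.m_assoc S.l_distr S.r_distr T.l_distr T.r_distr prod_eq_iff)
qed

lemma fst_ring_hom: "fst \<in> ring_hom (fiber_product S T \<pi>S \<pi>T) S"
  and snd_ring_hom: "snd \<in> ring_hom (fiber_product S T \<pi>S \<pi>T) T"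
  by (auto simp: ring_hom_def)


section \<open>Words\<close>

lemma word_deg_Cons [simp]: "word_deg (x # w) = letter_deg x + word_deg w"
  by (simp add: word_deg_def)

lemma words_Nil [simp]: "[] \<notin> words P E F"
  by (simp add: words_def)

lemma words_P [simp]: "LetP j p # w \<in> words P E F \<longleftrightarrow> w = [] \<and> p \<in> bas P j"
  by (auto simp: words_def EF_letters_def Cons_eq_append_conv)

text \<open>\<open>words\<close> describes a word from its end, whereas the differential acts on the
  first letter; this is the passage to a recursion on the first letter. A letter from
  \<open>E\<close> needs a word beginning with \<open>F\<close>, a letter from \<open>F\<close> one
  that does not, so a letter from \<open>P\<close> counts like one from \<open>E\<close>.\<close>

lemma words_EF_aux:
  assumes "\<not> is_P x"
  shows "x # w \<in> words P E F \<longleftrightarrow>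
    x \<in> EF_letters E F \<and> w \<in> words P E F \<and> (if is_F x then \<not> is_F (hd w) else is_F (hd w))"
proof
  assume "x # w \<in> words P E F"
  then obtain us j p where eq: "x # w = us @ [LetP j p]" and p: "p \<in> bas P j"
    and us: "set us \<subseteq> EF_letters E F" "successively (\<lambda>x y. is_E x \<noteq> is_E y) us"
      "us \<noteq> [] \<longrightarrow> is_F (last us)"
    unfolding words_def by blast
  obtain us' where us': "us = x # us'" "w = us' @ [LetP j p]"
    using eq assms by (cases us) auto
  have "w \<in> words P E F"
    unfolding words_def using us' us p by (auto simp: successively_Cons split: if_splits)
  moreover have "if is_F x then \<not> is_F (hd w) else is_F (hd w)"
    using us us' assms
    by (cases us'; cases x) (auto simp: EF_letters_def)
  ultimately show "x \<in> EF_letters E F \<and> w \<in> words P E F \<and> (if is_F x then \<not> is_F (hd w) else is_F (hd w))"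
    using us us' by simp
next
  assume a: "x \<in> EF_letters E F \<and> w \<in> words P E F \<and> (if is_F x then \<not> is_F (hd w) else is_F (hd w))"
  then obtain us j p where eq: "w = us @ [LetP j p]" and p: "p \<in> bas P j"
    and us: "set us \<subseteq> EF_letters E F" "successively (\<lambda>x y. is_E x \<noteq> is_E y) us"
      "us \<noteq> [] \<longrightarrow> is_F (last us)"
    unfolding words_def by blast
  have "x # w = (x # us) @ [LetP j p]" using eq by simp
  moreover have "successively (\<lambda>x y. is_E x \<noteq> is_E y) (x # us)" "is_F (last (x # us))"
    using us a eq assms
    by (cases us; cases x; auto simp: EF_letters_def split: if_splits)+
  ultimately show "x # w \<in> words P E F"
    unfolding words_def using p us a by fastforce
qed

lemma words_E [simp]:
  "LetE j e # w \<in> words P E F \<longleftrightarrow> 1 \<le> j \<and> e \<in> bas E j \<and> w \<in> words P E F \<and> is_F (hd w)"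
  by (auto simp: words_EF_aux EF_letters_def)

lemma words_F [simp]:
  "LetF j f # w \<in> words P E F \<longleftrightarrow> 1 \<le> j \<and> f \<in> bas F j \<and> w \<in> words P E F \<and> \<not> is_F (hd w)"
  by (auto simp: words_EF_aux EF_letters_def)

lemma words_cases [consumes 1, case_names P E F]:
  assumes "v \<in> words P E F"
  obtains j p where "v = [LetP j p]" "p \<in> bas P j"
  | j e w where "v = LetE (Suc j) e # w" "e \<in> bas E (Suc j)" "w \<in> words P E F" "is_F (hd w)"
  | j f w where "v = LetF (Suc j) f # w" "f \<in> bas F (Suc j)" "w \<in> words P E F" "\<not> is_F (hd w)"
proof (cases v)
  case Nil
  then show ?thesis using assms by simp
next
  case (Cons x w)
  show ?thesis
  proof (cases x)
    case (LetP j p)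
    then show ?thesis using that(1)[of j p] assms Cons by simp
  next
    case (LetE j e)
    then obtain i where "j = Suc i" using assms Cons by (cases j) auto
    then show ?thesis using that(2)[of i e w] assms Cons LetE by simp
  next
    case (LetF j f)
    then obtain i where "j = Suc i" using assms Cons by (cases j) auto
    then show ?thesis using that(3)[of i f w] assms Cons LetF by simp
  qed
qed

lemma consE_simps [simp]: "consE 0 e w = w" "consE (Suc j) e w = LetE (Suc j) e # w"
  by (simp_all add: consE_def)

lemma consF_simps [simp]: "consF 0 f w = w" "consF (Suc j) f w = LetF (Suc j) f # w"
  by (simp_all add: consF_def)


section \<open>Prepending a linear combination\<close>

text \<open>\<open>emb\<close> has to land in \<open>R\<close> only on the coefficients of
  \<open>c\<close>, because \<open>(s, 0)\<close> is an element of the fiber product only for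
  \<open>s\<close> of residue zero.\<close>

context
  fixes R :: "('r, 'x) ring_scheme" and A :: "('a, 'y) ring_scheme"
    and emb :: "'a \<Rightarrow> 'r" and cns :: "'b \<Rightarrow> 'w \<Rightarrow> 'w" and c :: "'b \<Rightarrow> 'a" and w :: 'w
    and B :: "'b set" and W :: "'w set"
  assumes R: "ring R" and c: "c \<in> carrier (free_module A B)"
    and emb: "\<And>y. y \<in> B \<Longrightarrow> emb (c y) \<in> carrier R"
    and cns: "\<And>y. y \<in> B \<Longrightarrow> cns y w \<in> W"
begin

interpretation R: ring R by (rule R)
interpretation N: lmod R "free_module R W" by (rule lmod.intro, rule R.left_module_free_module)

lemma prepend_summand:
  assumes "y \<in> {y. c y \<noteq> \<zero>\<^bsub>A\<^esub>}"
  shows "emb (c y) \<odot>\<^bsub>free_module R W\<^esub> single R (cns y w) \<in> carrier (free_module R W)"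
proof -
  have "y \<in> B" using assms c by auto
  then show ?thesis using emb cns by (intro N.smult_closed R.single_closed) auto
qed

lemma prepend_closed: "prepend R (free_module R W) A emb cns c w \<in> carrier (free_module R W)"
  unfolding prepend_def by (rule N.M.finsum_closed) (rule Pi_I, rule prepend_summand)

lemma prepend_eval:
  "prepend R (free_module R W) A emb cns c w v
     = (\<Oplus>\<^bsub>R\<^esub>y\<in>{y. c y \<noteq> \<zero>\<^bsub>A\<^esub>}. if v = cns y w then emb (c y) else \<zero>\<^bsub>R\<^esub>)"
proof -
  have "prepend R (free_module R W) A emb cns c w v
     = (\<Oplus>\<^bsub>R\<^esub>y\<in>{y. c y \<noteq> \<zero>\<^bsub>A\<^esub>}. (emb (c y) \<odot>\<^bsub>free_module R W\<^esub> single R (cns y w)) v)"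
    unfolding prepend_def by (rule R.finsum_free_module) (rule prepend_summand)
  also have "\<dots> = (\<Oplus>\<^bsub>R\<^esub>y\<in>{y. c y \<noteq> \<zero>\<^bsub>A\<^esub>}. if v = cns y w then emb (c y) else \<zero>\<^bsub>R\<^esub>)"
  proof -
    have "emb (c y) \<in> carrier R" if "c y \<noteq> \<zero>\<^bsub>A\<^esub>" for y
      using emb[of y] that c by auto
    then show ?thesis by (intro R.finsum_cong') (auto simp: single_def)
  qed
  finally show ?thesis .
qed

lemma prepend_off:
  assumes "v \<notin> (\<lambda>y. cns y w) ` B"
  shows "prepend R (free_module R W) A emb cns c w v = \<zero>\<^bsub>R\<^esub>"
proof -
  have "v \<noteq> cns y w" if "c y \<noteq> \<zero>\<^bsub>A\<^esub>" for y using assms that c by auto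
  then have "prepend R (free_module R W) A emb cns c w v = (\<Oplus>\<^bsub>R\<^esub>y\<in>{y. c y \<noteq> \<zero>\<^bsub>A\<^esub>}. \<zero>\<^bsub>R\<^esub>)"
    unfolding prepend_eval by (intro R.finsum_cong') auto
  then show ?thesis by simp
qed

lemma prepend_on:
  assumes inj: "inj_on (\<lambda>y. cns y w) B" and b: "b \<in> B" and emb0: "emb \<zero>\<^bsub>A\<^esub> = \<zero>\<^bsub>R\<^esub>"
  shows "prepend R (free_module R W) A emb cns c w (cns b w) = emb (c b)"
proof -
  have sB: "y \<in> B" if "c y \<noteq> \<zero>\<^bsub>A\<^esub>" for y using that c by auto
  have eq: "cns b w = cns y w \<longleftrightarrow> b = y" if "c y \<noteq> \<zero>\<^bsub>A\<^esub>" for y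
    using inj_onD[OF inj, of b y] b sB[OF that] by auto
  have "prepend R (free_module R W) A emb cns c w (cns b w)
      = (\<Oplus>\<^bsub>R\<^esub>y\<in>{y. c y \<noteq> \<zero>\<^bsub>A\<^esub>}. if b = y then emb (c y) else \<zero>\<^bsub>R\<^esub>)"
    unfolding prepend_eval using sB emb eq by (intro R.finsum_cong') auto
  also have "\<dots> = emb (c b)"
  \<comment> \<open>The sum runs over the support of \<open>c\<close>. If \<open>b\<close> is not in
    it, the sum is zero, and this agrees with \<open>emb (c b)\<close> because \<open>emb\<close>
    preserves zero.\<close>
  proof (cases "c b = \<zero>\<^bsub>A\<^esub>")
    case True
    then have "(\<Oplus>\<^bsub>R\<^esub>y\<in>{y. c y \<noteq> \<zero>\<^bsub>A\<^esub>}. if b = y then emb (c y) else \<zero>\<^bsub>R\<^esub>)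
        = (\<Oplus>\<^bsub>R\<^esub>y\<in>{y. c y \<noteq> \<zero>\<^bsub>A\<^esub>}. \<zero>\<^bsub>R\<^esub>)"
      by (intro R.finsum_cong') auto
    then show ?thesis using True emb0 by simp
  next
    case False
    then show ?thesis using sB emb c by (intro R.finsum_singleton) auto
  qed
  finally show ?thesis .
qed

end


section \<open>The word complex\<close>

locale fiber_words =
  fixes S :: "'s ring" and T :: "'t ring" and k :: "'k ring"
    and \<pi>S :: "'s \<Rightarrow> 'k" and \<pi>T :: "'t \<Rightarrow> 'k"
    and M :: "('s, 'm) module"
    and P :: "('s, 'p) based_cpx" and \<epsilon>P :: "'p \<Rightarrow> 'm"
    and E :: "('s, 'e) based_cpx" and \<epsilon>E :: "'e \<Rightarrow> 'k" and \<iota>E :: "'s \<Rightarrow> 'e"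
    and F :: "('t, 'f) based_cpx" and \<epsilon>F :: "'f \<Rightarrow> 'k" and \<iota>F :: "'t \<Rightarrow> 'f"
  assumes S: "ring S" and T: "ring T" and k: "field k"
    and \<pi>S: "\<pi>S \<in> ring_hom S k" and \<pi>S_surj: "\<pi>S ` carrier S = carrier k"
    and \<pi>T: "\<pi>T \<in> ring_hom T k" and \<pi>T_surj: "\<pi>T ` carrier T = carrier k"
    and M: "left_module S M"
    and resP: "free_resolution S P \<epsilon>P M" "minimal_cpx (a_kernel S k \<pi>S) P" "based S P"
    and resE: "free_resolution S E \<epsilon>E (restrict_scalars \<pi>S (regular_module k))"
      "minimal_cpx (a_kernel S k \<pi>S) E" "based S E"
    and unitE: "\<iota>E \<in> lmod_iso S (regular_module S) (chn E 0)" "bas E 0 = {\<iota>E \<one>\<^bsub>S\<^esub>}"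
    and resF: "free_resolution T F \<epsilon>F (restrict_scalars \<pi>T (regular_module k))"
      "minimal_cpx (a_kernel T k \<pi>T) F" "based T F"
    and unitF: "\<iota>F \<in> lmod_iso T (regular_module T) (chn F 0)" "bas F 0 = {\<iota>F \<one>\<^bsub>T\<^esub>}"
begin

sublocale S: ring S by (rule S)
sublocale T: ring T by (rule T)
sublocale k: field k by (rule k)
sublocale \<pi>S: ring_hom_ring S k \<pi>S by (intro ring_hom_ringI2 S k.ring_axioms \<pi>S)
sublocale \<pi>T: ring_hom_ring T k \<pi>T by (intro ring_hom_ringI2 T k.ring_axioms \<pi>T)

abbreviation "\<pp> \<equiv> a_kernel S k \<pi>S"
abbreviation "\<qq> \<equiv> a_kernel T k \<pi>T"
abbreviation "R \<equiv> fiber_product S T \<pi>S \<pi>T"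

sublocale R: ring R by (rule ring_fiber_product[OF S T k.ring_axioms \<pi>S \<pi>T])

sublocale P: minimal_resolution S P \<epsilon>P M \<pp>
  by (intro minimal_resolution.intro minimal_resolution_axioms.intro S resP \<pi>S.kernel_is_ideal)
sublocale E: minimal_resolution S E \<epsilon>E "restrict_scalars \<pi>S (regular_module k)" \<pp>
  by (intro minimal_resolution.intro minimal_resolution_axioms.intro S resE \<pi>S.kernel_is_ideal)
sublocale F: minimal_resolution T F \<epsilon>F "restrict_scalars \<pi>T (regular_module k)" \<qq>
  by (intro minimal_resolution.intro minimal_resolution_axioms.intro T resF \<pi>T.kernel_is_ideal)

abbreviation "oneE \<equiv> \<iota>E \<one>\<^bsub>S\<^esub>"
abbreviation "oneF \<equiv> \<iota>F \<one>\<^bsub>T\<^esub>"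
abbreviation "wordset \<equiv> words P E F"
abbreviation "W i \<equiv> words_of_deg P E F i"
abbreviation "G i \<equiv> free_module R (W i)"
text \<open>Both \<open>wbd i\<close> and \<open>dG i\<close> start in degree \<open>Suc i\<close>
  and end in degree \<open>i\<close>.\<close>

abbreviation "wbd i \<equiv> word_bdy S T \<pi>S \<pi>T P E F (G i)"
abbreviation "dG i \<equiv> lin_ext R (G i) (wbd i)"
abbreviation "blkP j \<equiv> pull S fst (\<lambda>p. [LetP j p] :: ('p, 'e, 'f) word) (bas P j)"
text \<open>For \<open>j = 0\<close> the word \<open>consE 0 e w\<close> is \<open>w\<close>, so
  this block consists of the first component at \<open>w\<close> alone, attached to
  \<open>oneE\<close>.\<close>

abbreviation "blkE w j \<equiv> pull S fst (\<lambda>e. consE j e w :: ('p, 'e, 'f) word) (bas E j)"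
abbreviation "blkF w j \<equiv> pull T snd (\<lambda>f. consF j f w :: ('p, 'e, 'f) word) (bas F j)"

section \<open>Residues, degrees of words and the block embeddings\<close>

lemma mem_pp: "s \<in> \<pp> \<longleftrightarrow> s \<in> carrier S \<and> \<pi>S s = \<zero>\<^bsub>k\<^esub>"
  and mem_qq: "t \<in> \<qq> \<longleftrightarrow> t \<in> carrier T \<and> \<pi>T t = \<zero>\<^bsub>k\<^esub>"
  unfolding a_kernel_def' by blast+

lemma W_iff: "w \<in> W i \<longleftrightarrow> w \<in> wordset \<and> word_deg w = i"
  by (simp add: words_of_deg_def)

text \<open>In degree 0 the letter is dropped, and injectivity holds because \<open>bas E 0\<close>
  has a single element.\<close>

lemma inj_consE: "inj_on (\<lambda>e. consE j e w) (bas E j)"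
  using unitE(2) by (cases j) (auto simp: inj_on_def)

lemma inj_consF: "inj_on (\<lambda>f. consF j f w) (bas F j)"
  using unitF(2) by (cases j) (auto simp: inj_on_def)

lemma inj_LetP: "inj_on (\<lambda>p. [LetP j p]) (bas P j)"
  by (auto simp: inj_on_def)

lemma consE_W: "w \<in> wordset \<Longrightarrow> is_F (hd w) \<Longrightarrow> e \<in> bas E j \<Longrightarrow> consE j e w \<in> W (j + word_deg w)"
  by (cases j) (auto simp: W_iff)

lemma consF_W: "w \<in> wordset \<Longrightarrow> \<not> is_F (hd w) \<Longrightarrow> f \<in> bas F j \<Longrightarrow> consF j f w \<in> W (j + word_deg w)"
  by (cases j) (auto simp: W_iff)

lemma LetP_W: "p \<in> bas P j \<Longrightarrow> [LetP j p] \<in> W j"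
  by (auto simp: W_iff word_deg_def)

lemma blkP_hom: "blkP j \<in> lmod_hom R (free_module R V) (restrict_scalars fst (P.coef j))"
  by (rule pull_hom[OF R.ring_axioms S fst_ring_hom inj_LetP])

lemma blkE_hom: "blkE w j \<in> lmod_hom R (free_module R V) (restrict_scalars fst (E.coef j))"
  by (rule pull_hom[OF R.ring_axioms S fst_ring_hom inj_consE])

lemma blkF_hom: "blkF w j \<in> lmod_hom R (free_module R V) (restrict_scalars snd (F.coef j))"
  by (rule pull_hom[OF R.ring_axioms T snd_ring_hom inj_consF])

lemma blk_closed:
  assumes "z \<in> carrier (free_module R V)"
  shows "blkP j z \<in> carrier (P.coef j)" "blkE w j z \<in> carrier (E.coef j)" "blkF w j z \<in> carrier (F.coef j)"
  using lmod_homD(2)[OF blkP_hom assms] lmod_homD(2)[OF blkE_hom assms] lmod_homD(2)[OF blkF_hom assms]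
  by (simp_all only: restrict_scalars_simps)

text \<open>Minimality enters the construction here: boundary coefficients have residue zero and so
  become elements of the fiber product when paired with zero.\<close>

lemma embS: "s \<in> \<pp> \<Longrightarrow> (s, \<zero>\<^bsub>T\<^esub>) \<in> carrier R"
  and embT: "t \<in> \<qq> \<Longrightarrow> (\<zero>\<^bsub>S\<^esub>, t) \<in> carrier R"
  by (auto simp: mem_pp mem_qq)

section \<open>Boundaries of basis words\<close>

lemma wbd_P:
  assumes p: "p \<in> bas P (Suc j)"
  shows "wbd j [LetP (Suc j) p] \<in> carrier (G j)"
    and "b \<in> bas P j \<Longrightarrow> wbd j [LetP (Suc j) p] [LetP j b] = (P.crd j (bdy P (Suc j) p) b, \<zero>\<^bsub>T\<^esub>)"
    and "v \<notin> (\<lambda>b. [LetP j b]) ` bas P j \<Longrightarrow> wbd j [LetP (Suc j) p] v = (\<zero>\<^bsub>S\<^esub>, \<zero>\<^bsub>T\<^esub>)"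
proof -
  note c = P.crd_bdy_closed[OF p] and min = embS[OF P.crd_bdy_minimal[OF p]]
  note pre = R.ring_axioms c min
  show "wbd j [LetP (Suc j) p] \<in> carrier (G j)"
    unfolding word_bdy.simps diff_Suc_1 by (rule prepend_closed[where emb = "\<lambda>s. (s, \<zero>\<^bsub>T\<^esub>)" and cns = "\<lambda>y w. LetP j y # w", OF pre]) (rule LetP_W)
  show "wbd j [LetP (Suc j) p] [LetP j b] = (P.crd j (bdy P (Suc j) p) b, \<zero>\<^bsub>T\<^esub>)" if "b \<in> bas P j"
    unfolding word_bdy.simps diff_Suc_1
    by (rule prepend_on[where emb = "\<lambda>s. (s, \<zero>\<^bsub>T\<^esub>)" and cns = "\<lambda>y w. LetP j y # w", OF pre]) (auto simp: LetP_W inj_LetP that)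
  show "wbd j [LetP (Suc j) p] v = (\<zero>\<^bsub>S\<^esub>, \<zero>\<^bsub>T\<^esub>)" if "v \<notin> (\<lambda>b. [LetP j b]) ` bas P j"
    unfolding word_bdy.simps diff_Suc_1
    by (subst prepend_off[where emb = "\<lambda>s. (s, \<zero>\<^bsub>T\<^esub>)" and cns = "\<lambda>y w. LetP j y # w", OF pre]) (auto simp: LetP_W that[simplified])
qed

lemma wbd_E:
  assumes e: "e \<in> bas E (Suc j)" and w: "w \<in> wordset" "is_F (hd w)" and i: "i = j + word_deg w"
  shows "wbd i (LetE (Suc j) e # w) \<in> carrier (G i)"
    and "b \<in> bas E j \<Longrightarrow> wbd i (LetE (Suc j) e # w) (consE j b w) = (E.crd j (bdy E (Suc j) e) b, \<zero>\<^bsub>T\<^esub>)"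
    and "v \<notin> (\<lambda>b. consE j b w) ` bas E j \<Longrightarrow> wbd i (LetE (Suc j) e # w) v = (\<zero>\<^bsub>S\<^esub>, \<zero>\<^bsub>T\<^esub>)"
proof -
  have cw: "consE j y w \<in> W i" if "y \<in> bas E j" for y
    using consE_W[OF w that] i by simp
  note c = E.crd_bdy_closed[OF e] and min = embS[OF E.crd_bdy_minimal[OF e]]
  note pre = R.ring_axioms c min cw
  show "wbd i (LetE (Suc j) e # w) \<in> carrier (G i)"
    unfolding word_bdy.simps diff_Suc_1 by (rule prepend_closed[where emb = "\<lambda>s. (s, \<zero>\<^bsub>T\<^esub>)" and cns = "consE j", OF pre])
  show "wbd i (LetE (Suc j) e # w) (consE j b w) = (E.crd j (bdy E (Suc j) e) b, \<zero>\<^bsub>T\<^esub>)" if "b \<in> bas E j"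
    unfolding word_bdy.simps diff_Suc_1
    by (rule prepend_on[where emb = "\<lambda>s. (s, \<zero>\<^bsub>T\<^esub>)" and cns = "consE j", OF pre inj_consE that]) simp_all
  show "wbd i (LetE (Suc j) e # w) v = (\<zero>\<^bsub>S\<^esub>, \<zero>\<^bsub>T\<^esub>)" if "v \<notin> (\<lambda>b. consE j b w) ` bas E j"
    unfolding word_bdy.simps diff_Suc_1
    by (subst prepend_off[where emb = "\<lambda>s. (s, \<zero>\<^bsub>T\<^esub>)" and cns = "consE j", OF pre that]) simp_all
qed

lemma wbd_F:
  assumes f: "f \<in> bas F (Suc j)" and w: "w \<in> wordset" "\<not> is_F (hd w)" and i: "i = j + word_deg w"
  shows "wbd i (LetF (Suc j) f # w) \<in> carrier (G i)"
    and "b \<in> bas F j \<Longrightarrow> wbd i (LetF (Suc j) f # w) (consF j b w) = (\<zero>\<^bsub>S\<^esub>, F.crd j (bdy F (Suc j) f) b)"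
    and "v \<notin> (\<lambda>b. consF j b w) ` bas F j \<Longrightarrow> wbd i (LetF (Suc j) f # w) v = (\<zero>\<^bsub>S\<^esub>, \<zero>\<^bsub>T\<^esub>)"
proof -
  have cw: "consF j y w \<in> W i" if "y \<in> bas F j" for y
    using consF_W[OF w that] i by simp
  note c = F.crd_bdy_closed[OF f] and min = embT[OF F.crd_bdy_minimal[OF f]]
  note pre = R.ring_axioms c min cw
  show "wbd i (LetF (Suc j) f # w) \<in> carrier (G i)"
    unfolding word_bdy.simps diff_Suc_1 by (rule prepend_closed[where emb = "\<lambda>t. (\<zero>\<^bsub>S\<^esub>, t)" and cns = "consF j", OF pre])
  show "wbd i (LetF (Suc j) f # w) (consF j b w) = (\<zero>\<^bsub>S\<^esub>, F.crd j (bdy F (Suc j) f) b)" if "b \<in> bas F j"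
    unfolding word_bdy.simps diff_Suc_1
    by (rule prepend_on[where emb = "\<lambda>t. (\<zero>\<^bsub>S\<^esub>, t)" and cns = "consF j", OF pre inj_consF that]) simp_all
  show "wbd i (LetF (Suc j) f # w) v = (\<zero>\<^bsub>S\<^esub>, \<zero>\<^bsub>T\<^esub>)" if "v \<notin> (\<lambda>b. consF j b w) ` bas F j"
    unfolding word_bdy.simps diff_Suc_1
    by (subst prepend_off[where emb = "\<lambda>t. (\<zero>\<^bsub>S\<^esub>, t)" and cns = "consF j", OF pre that]) simp_all
qed

lemma W_cases [consumes 1, case_names P E F]:
  assumes "v \<in> W i"
  obtains p where "v = [LetP i p]" "p \<in> bas P i"
  | j e w where "v = LetE (Suc j) e # w" "e \<in> bas E (Suc j)" "w \<in> wordset" "is_F (hd w)"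
      "i = Suc (j + word_deg w)"
  | j f w where "v = LetF (Suc j) f # w" "f \<in> bas F (Suc j)" "w \<in> wordset" "\<not> is_F (hd w)"
      "i = Suc (j + word_deg w)"
proof -
  have v: "v \<in> wordset" "word_deg v = i" using assms by (auto simp: W_iff)
  from v(1) show ?thesis
  proof (cases v rule: words_cases)
    case (P j p)
    then show ?thesis using that(1)[of p] v(2) by (simp add: word_deg_def)
  next
    case (E j e w)
    then show ?thesis using that(2)[of j e w] v(2) by simp
  next
    case (F j f w)
    then show ?thesis using that(3)[of j f w] v(2) by simp
  qed
qed

lemma wbd_closed: "w \<in> W (Suc i) \<Longrightarrow> wbd i w \<in> carrier (G i)"
  by (cases w rule: W_cases) (auto simp del: free_module_simps(1) word_bdy.simps intro: wbd_P(1) wbd_E(1) wbd_F(1))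

text \<open>All coefficients in the boundary of such a word have the form \<open>(0, t)\<close>, so
  it is invisible to the first components. With the two lemmas that follow, this separates the
  differential into an \<open>S\<close> part and a \<open>T\<close> part.\<close>

lemma fst_wbd_F:
  "f \<in> bas F (Suc j) \<Longrightarrow> w \<in> wordset \<Longrightarrow> \<not> is_F (hd w) \<Longrightarrow> i = j + word_deg w \<Longrightarrow>
    fst (wbd i (LetF (Suc j) f # w) v) = \<zero>\<^bsub>S\<^esub>"
  using wbd_F(2,3)[of f j w i _ ] by (cases "v \<in> (\<lambda>b. consF j b w) ` bas F j") (auto simp del: word_bdy.simps)

lemma snd_wbd_E:
  "e \<in> bas E (Suc j) \<Longrightarrow> w \<in> wordset \<Longrightarrow> is_F (hd w) \<Longrightarrow> i = j + word_deg w \<Longrightarrow>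
    snd (wbd i (LetE (Suc j) e # w) v) = \<zero>\<^bsub>T\<^esub>"
  using wbd_E(2,3)[of e j w i _ ] by (cases "v \<in> (\<lambda>b. consE j b w) ` bas E j") (auto simp del: word_bdy.simps)

lemma snd_wbd_P:
  "p \<in> bas P (Suc j) \<Longrightarrow> snd (wbd j [LetP (Suc j) p] v) = \<zero>\<^bsub>T\<^esub>"
  using wbd_P(2,3)[of p j] by (cases "v \<in> (\<lambda>b. [LetP j b]) ` bas P j") (auto simp del: word_bdy.simps)

section \<open>The differential read in blocks\<close>

lemma left_module_G: "left_module R (free_module R V)"
  by (rule R.left_module_free_module)

lemma dG_hom: "dG i \<in> lmod_hom R (G (Suc i)) (G i)"
proof -
  interpret G: lmod R "G i" by (rule lmod.intro, rule left_module_G)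
  show ?thesis by (rule G.lin_ext_hom) (rule Pi_I, rule wbd_closed)
qed

lemma dG_closed: "z \<in> carrier (G (Suc i)) \<Longrightarrow> dG i z \<in> carrier (G i)"
  by (rule lmod_homD(2)[OF dG_hom])

text \<open>No other word contributes: a word beginning with \<open>F\<close> has a boundary without
  first components, and the boundary of a word beginning with \<open>E\<close> avoids the one-letter
  words.\<close>

lemma blkP_dG:
  assumes z: "z \<in> carrier (G (Suc i))"
  shows "blkP i (dG i z) = P.dif i (blkP (Suc i) z)"
  unfolding P.dif_eq_lin_ext[OF blk_closed(1)[OF z]]
proof (rule lin_ext_reindex[OF left_module_G P.left_module_coef fst_ring_hom blkP_hom wbd_closed z inj_LetP])
  show "(\<lambda>p. [LetP (Suc i) p]) ` bas P (Suc i) \<subseteq> W (Suc i)" using LetP_W by blast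
  show "blkP i (wbd i [LetP (Suc i) y]) = P.crd i (bdy P (Suc i) y)" if y: "y \<in> bas P (Suc i)" for y
  proof
    fix b
    show "blkP i (wbd i [LetP (Suc i) y]) b = P.crd i (bdy P (Suc i) y) b"
      using wbd_P(2)[OF y, of b] P.crd_bdy_closed[OF y]
      by (simp add: pull_def del: word_bdy.simps)
  qed
  show "blkP i (wbd i w) = \<zero>\<^bsub>P.coef i\<^esub>"
    if w: "w \<in> W (Suc i)" and off: "w \<notin> (\<lambda>p. [LetP (Suc i) p]) ` bas P (Suc i)" for w
  proof
    fix b
    show "blkP i (wbd i w) b = \<zero>\<^bsub>P.coef i\<^esub> b"
    proof (cases "b \<in> bas P i")
      case True
      from w have "fst (wbd i w [LetP i b]) = \<zero>\<^bsub>S\<^esub>"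
      proof (cases w rule: W_cases)
        case (E j e w')
        \<comment> \<open>The right-hand word begins with a letter from \<open>E\<close> or, for
          \<open>j = 0\<close>, with the letter from \<open>F\<close> at the head of
          \<open>w'\<close>.\<close>
        have "[LetP i b] \<noteq> consE j y w'" for y
        proof
          assume eq: "[LetP i b] = consE j y w'"
          have "\<not> is_P (hd (consE j y w'))" using E(4) by (cases j; cases "hd w'") simp_all
          then show False unfolding eq[symmetric] by simp
        qed
        then have "[LetP i b] \<notin> (\<lambda>b. consE j b w') ` bas E j" by blast
        then show ?thesis using E by (simp add: wbd_E(3) del: word_bdy.simps)
      qed (use off in \<open>simp_all add: fst_wbd_F del: word_bdy.simps\<close>)
      then show ?thesis using True by (simp add: pull_def)
    qed (simp add: pull_def)
  qed
qed

text \<open>As \<open>w0\<close> begins with \<open>F\<close>, the word \<open>consE j b w0\<close>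
  determines both \<open>j\<close> and \<open>w0\<close>. Hence different \<open>E\<close> blocks
  occupy disjoint sets of words, and only the block over \<open>w0\<close> contributes.\<close>

lemma blkE_dG:
  assumes w0: "w0 \<in> wordset" "is_F (hd w0)" and i: "i = j + word_deg w0"
    and z: "z \<in> carrier (G (Suc i))"
  shows "blkE w0 j (dG i z) = E.dif j (blkE w0 (Suc j) z)"
  unfolding E.dif_eq_lin_ext[OF blk_closed(2)[OF z]]
proof (rule lin_ext_reindex[OF left_module_G E.left_module_coef fst_ring_hom blkE_hom wbd_closed z inj_consE])
  show "(\<lambda>e. consE (Suc j) e w0) ` bas E (Suc j) \<subseteq> W (Suc i)"
    using consE_W[OF w0, of _ "Suc j"] i by auto
  show "blkE w0 j (wbd i (consE (Suc j) y w0)) = E.crd j (bdy E (Suc j) y)" if y: "y \<in> bas E (Suc j)" for y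
  proof
    fix b
    show "blkE w0 j (wbd i (consE (Suc j) y w0)) b = E.crd j (bdy E (Suc j) y) b"
      using wbd_E(2)[OF y w0 i, of b] E.crd_bdy_closed[OF y]
      by (simp add: pull_def del: word_bdy.simps)
  qed
  show "blkE w0 j (wbd i w) = \<zero>\<^bsub>E.coef j\<^esub>"
    if w: "w \<in> W (Suc i)" and off: "w \<notin> (\<lambda>e. consE (Suc j) e w0) ` bas E (Suc j)" for w
  proof
    fix b
    show "blkE w0 j (wbd i w) b = \<zero>\<^bsub>E.coef j\<^esub> b"
    proof (cases "b \<in> bas E j")
      case True
      from w have "fst (wbd i w (consE j b w0)) = \<zero>\<^bsub>S\<^esub>"
      proof (cases w rule: W_cases)
        case (P p)
        have "consE j b w0 \<notin> (\<lambda>b. [LetP i b]) ` bas P i" using w0 by (cases j) auto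
        then show ?thesis using P by (simp add: wbd_P(3) del: word_bdy.simps)
      next
        case (E j' e w')
        have "consE j b w0 \<notin> (\<lambda>b. consE j' b w') ` bas E j'"
        proof
          assume "consE j b w0 \<in> (\<lambda>b. consE j' b w') ` bas E j'"
          \<comment> \<open>Both \<open>w0\<close> and \<open>w'\<close> begin with
            \<open>F\<close>, so a leading letter from \<open>E\<close> is present exactly in
            positive degree.\<close>
          then have "j = j' \<and> w0 = w'" using E w0 by (cases j; cases j') auto
          then show False using off E by auto
        qed
        then show ?thesis using E by (simp add: wbd_E(3) del: word_bdy.simps)
      qed (simp_all add: fst_wbd_F del: word_bdy.simps)
      then show ?thesis using True by (simp add: pull_def)
    qed (simp add: pull_def)
  qed
qed

text \<open>Here words from \<open>P\<close> are on the same side as words beginning with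
  \<open>E\<close>: their boundaries have no second components.\<close>

lemma blkF_dG:
  assumes w0: "w0 \<in> wordset" "\<not> is_F (hd w0)" and i: "i = j + word_deg w0"
    and z: "z \<in> carrier (G (Suc i))"
  shows "blkF w0 j (dG i z) = F.dif j (blkF w0 (Suc j) z)"
  unfolding F.dif_eq_lin_ext[OF blk_closed(3)[OF z]]
proof (rule lin_ext_reindex[OF left_module_G F.left_module_coef snd_ring_hom blkF_hom wbd_closed z inj_consF])
  show "(\<lambda>f. consF (Suc j) f w0) ` bas F (Suc j) \<subseteq> W (Suc i)"
    using consF_W[OF w0, of _ "Suc j"] i by auto
  show "blkF w0 j (wbd i (consF (Suc j) y w0)) = F.crd j (bdy F (Suc j) y)" if y: "y \<in> bas F (Suc j)" for y
  proof
    fix b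
    show "blkF w0 j (wbd i (consF (Suc j) y w0)) b = F.crd j (bdy F (Suc j) y) b"
      using wbd_F(2)[OF y w0 i, of b] F.crd_bdy_closed[OF y]
      by (simp add: pull_def del: word_bdy.simps)
  qed
  show "blkF w0 j (wbd i w) = \<zero>\<^bsub>F.coef j\<^esub>"
    if w: "w \<in> W (Suc i)" and off: "w \<notin> (\<lambda>f. consF (Suc j) f w0) ` bas F (Suc j)" for w
  proof
    fix b
    show "blkF w0 j (wbd i w) b = \<zero>\<^bsub>F.coef j\<^esub> b"
    proof (cases "b \<in> bas F j")
      case True
      from w have "snd (wbd i w (consF j b w0)) = \<zero>\<^bsub>T\<^esub>"
      proof (cases w rule: W_cases)
        case (F j' e w')
        have "consF j b w0 \<notin> (\<lambda>b. consF j' b w') ` bas F j'"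
        proof
          assume "consF j b w0 \<in> (\<lambda>b. consF j' b w') ` bas F j'"
          then have "j = j' \<and> w0 = w'" using F w0 by (cases j; cases j') auto
          then show False using off F by auto
        qed
        then show ?thesis using F by (simp add: wbd_F(3) del: word_bdy.simps)
      qed (simp_all add: snd_wbd_E snd_wbd_P del: word_bdy.simps)
      then show ?thesis using True by (simp add: pull_def)
    qed (simp add: pull_def)
  qed
qed

end


section \<open>Exactness\<close>

context fiber_words
begin

lemma fst_cases [consumes 1, case_names P E]:
  assumes v: "v \<in> W i"
  obtains p where "v = [LetP i p]" "p \<in> bas P i"
  | w j e where "v = consE j e w" "e \<in> bas E j" "w \<in> wordset" "is_F (hd w)" "i = j + word_deg w"
proof -
  have vi: "v \<in> wordset" "i = 0 + word_deg v" using v by (auto simp: W_iff)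
  from v show thesis
  proof (cases v rule: W_cases)
    case (P p)
    then show thesis by (rule that(1))
  next
    case (E j e w)
    show thesis by (rule that(2)[of "Suc j" e w]) (use E in simp_all)
  next
    case (F j f w)
    then have "is_F (hd v)" by simp
    with vi show thesis by (intro that(2)[of 0 oneE v]) (simp_all add: unitE(2))
  qed
qed

lemma snd_cases [consumes 1, case_names F]:
  assumes v: "v \<in> W i"
  obtains w j f where "v = consF j f w" "f \<in> bas F j" "w \<in> wordset" "\<not> is_F (hd w)" "i = j + word_deg w"
proof -
  have vi: "v \<in> wordset" "i = 0 + word_deg v" using v by (auto simp: W_iff)
  show thesis
  proof (cases "is_F (hd v)")
    case True
    from v show thesis
    proof (cases v rule: W_cases)
      case (F j f w)
      show thesis by (rule that[of "Suc j" f w]) (use F in simp_all)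
    qed (use True in simp_all)
  next
    case False
    with vi show thesis by (intro that[of 0 oneF v]) (simp_all add: unitF(2))
  qed
qed

lemma blk_eval:
  "p \<in> bas P j \<Longrightarrow> blkP j z p = fst (z [LetP j p])"
  "e \<in> bas E j \<Longrightarrow> blkE w j z e = fst (z (consE j e w))"
  "f \<in> bas F j \<Longrightarrow> blkF w j z f = snd (z (consF j f w))"
  by (simp_all add: pull_def)

text \<open>By \<open>fst_cases\<close> and \<open>snd_cases\<close> each component of each
  coefficient occurs in some block, so the blocks determine the chain.\<close>

lemma G_ext:
  assumes z: "z \<in> carrier (G i)" and z': "z' \<in> carrier (G i)"
    and blk: "blkP i z = blkP i z'"
      "\<And>w j. w \<in> wordset \<Longrightarrow> is_F (hd w) \<Longrightarrow> i = j + word_deg w \<Longrightarrow> blkE w j z = blkE w j z'"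
      "\<And>w j. w \<in> wordset \<Longrightarrow> \<not> is_F (hd w) \<Longrightarrow> i = j + word_deg w \<Longrightarrow> blkF w j z = blkF w j z'"
  shows "z = z'"
proof
  fix v
  show "z v = z' v"
  proof (cases "v \<in> W i")
    case True
    from True have "fst (z v) = fst (z' v)"
    proof (cases rule: fst_cases)
      case (P p)
      then show ?thesis using blk(1) blk_eval(1)[of p i] by metis
    next
      case (E w j e)
      then show ?thesis using blk(2)[of w j] blk_eval(2)[of e j w] by metis
    qed
    moreover from True have "snd (z v) = snd (z' v)"
    proof (cases rule: snd_cases)
      case (F w j f)
      then show ?thesis using blk(3)[of w j] blk_eval(3)[of f j w] by metis
    qed
    ultimately show ?thesis by (simp add: prod_eq_iff)
  next
    case False
    then show ?thesis using z z' by simp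
  qed
qed

section \<open>Minimal coefficients and vanishing of the squared differential\<close>

lemma blk_zero:
  "blkP j (\<lambda>_. (\<zero>\<^bsub>S\<^esub>, \<zero>\<^bsub>T\<^esub>)) = (\<lambda>_. \<zero>\<^bsub>S\<^esub>)" "blkE w j (\<lambda>_. (\<zero>\<^bsub>S\<^esub>, \<zero>\<^bsub>T\<^esub>)) = (\<lambda>_. \<zero>\<^bsub>S\<^esub>)"
  "blkF w j (\<lambda>_. (\<zero>\<^bsub>S\<^esub>, \<zero>\<^bsub>T\<^esub>)) = (\<lambda>_. \<zero>\<^bsub>T\<^esub>)"
  by (auto simp: pull_def)

lemma zero_closed_G: "(\<lambda>_. (\<zero>\<^bsub>S\<^esub>, \<zero>\<^bsub>T\<^esub>)) \<in> carrier (free_module R V)"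
  by simp

text \<open>Each component of a coefficient lies in a block, where it is a coefficient of the
  minimal differential of \<open>P\<close>, \<open>E\<close> or \<open>F\<close>. This includes the
  components in degree 0 of their blocks.\<close>

lemma dG_minimal:
  assumes z: "z \<in> carrier (G (Suc i))"
  shows "fst (dG i z v) \<in> \<pp>" "snd (dG i z v) \<in> \<qq>"
proof -
  have "fst (dG i z v) \<in> \<pp> \<and> snd (dG i z v) \<in> \<qq>"
  proof (cases "v \<in> W i")
    case True
    from True have "fst (dG i z v) \<in> \<pp>"
    proof (cases rule: fst_cases)
      case (P p)
      have eq: "fst (dG i z v) = P.dif i (blkP (Suc i) z) p"
        unfolding blkP_dG[OF z, symmetric] P(1) by (rule blk_eval(1)[OF P(2), symmetric])
      show ?thesis unfolding eq by (rule P.dif_minimal[OF blk_closed(1)[OF z]])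
    next
      case (E w j e)
      have eq: "fst (dG i z v) = E.dif j (blkE w (Suc j) z) e"
        unfolding blkE_dG[OF E(3-5) z, symmetric] E(1) by (rule blk_eval(2)[OF E(2), symmetric])
      show ?thesis unfolding eq by (rule E.dif_minimal[OF blk_closed(2)[OF z]])
    qed
    moreover from True have "snd (dG i z v) \<in> \<qq>"
    proof (cases rule: snd_cases)
      case (F w j f)
      have eq: "snd (dG i z v) = F.dif j (blkF w (Suc j) z) f"
        unfolding blkF_dG[OF F(3-5) z, symmetric] F(1) by (rule blk_eval(3)[OF F(2), symmetric])
      show ?thesis unfolding eq by (rule F.dif_minimal[OF blk_closed(3)[OF z]])
    qed
    ultimately show ?thesis ..
  next
    case False
    then have "dG i z v = (\<zero>\<^bsub>S\<^esub>, \<zero>\<^bsub>T\<^esub>)" using dG_closed[OF z] by simp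
    then show ?thesis by (simp add: mem_pp mem_qq)
  qed
  then show "fst (dG i z v) \<in> \<pp>" "snd (dG i z v) \<in> \<qq>" by auto
qed

lemma dG_dG:
  assumes z: "z \<in> carrier (G (Suc (Suc i)))"
  shows "dG i (dG (Suc i) z) = (\<lambda>_. (\<zero>\<^bsub>S\<^esub>, \<zero>\<^bsub>T\<^esub>))"
proof (rule G_ext[OF _ zero_closed_G])
  note z1 = dG_closed[OF z]
  show "dG i (dG (Suc i) z) \<in> carrier (G i)" by (rule dG_closed[OF z1])
  show "blkP i (dG i (dG (Suc i) z)) = blkP i (\<lambda>_. (\<zero>\<^bsub>S\<^esub>, \<zero>\<^bsub>T\<^esub>))"
    unfolding blkP_dG[OF z1] blkP_dG[OF z] blk_zero by (rule P.dif_dif[OF blk_closed(1)[OF z]])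
  fix w j assume w: "w \<in> wordset" and i: "i = j + word_deg w"
  then have i': "Suc i = Suc j + word_deg w" by simp
  show "blkE w j (dG i (dG (Suc i) z)) = blkE w j (\<lambda>_. (\<zero>\<^bsub>S\<^esub>, \<zero>\<^bsub>T\<^esub>))" if "is_F (hd w)"
    unfolding blkE_dG[OF w that i z1] blkE_dG[OF w that i' z] blk_zero
    by (rule E.dif_dif[OF blk_closed(2)[OF z]])
  show "blkF w j (dG i (dG (Suc i) z)) = blkF w j (\<lambda>_. (\<zero>\<^bsub>S\<^esub>, \<zero>\<^bsub>T\<^esub>))" if "\<not> is_F (hd w)"
    unfolding blkF_dG[OF w that i z1] blkF_dG[OF w that i' z] blk_zero
    by (rule F.dif_dif[OF blk_closed(3)[OF z]])
qed

section \<open>The augmentation\<close>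

abbreviation "MR \<equiv> restrict_scalars fst M :: ('s \<times> 't, 'm) module"
abbreviation "augG \<equiv> cpx_aug S T \<pi>S \<pi>T M \<epsilon>P"

lemma left_module_MR: "left_module R MR"
  by (rule left_module_restrict_scalars[OF R.ring_axioms fst_ring_hom M])

lemma word_aug_closed:
  assumes "w \<in> W 0"
  shows "word_aug \<epsilon>P w \<in> carrier MR"
  using assms
proof (cases w rule: W_cases)
  case (P p)
  have "\<epsilon>P p \<in> carrier M" by (rule lmod_homD(2)[OF P.eps_hom], rule P.basis_closed, rule P)
  then show ?thesis by (simp add: P)
qed simp_all

lemma augG_hom: "augG \<in> lmod_hom R (G 0) MR"
proof -
  interpret MR: lmod R MR by (rule lmod.intro, rule left_module_MR)
  show ?thesis unfolding cpx_aug_def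
    by (rule MR.lin_ext_hom) (rule Pi_I, rule word_aug_closed)
qed

text \<open>In degree 0 there are only one-letter words from \<open>P\<close>, and \<open>R\<close>
  acts on \<open>M\<close> through \<open>fst\<close>, so the augmentation sees the \<open>P\<close>
  block only. The target already being a restriction along \<open>fst\<close>, the identity serves
  as \<open>\<phi>\<close>.\<close>

lemma augG_eq:
  assumes z: "z \<in> carrier (G 0)"
  shows "augG z = P.aug (blkP 0 z)"
  unfolding cpx_aug_def P.aug_eq_lin_ext[OF blk_closed(1)[OF z]]
proof (rule lin_ext_reindex[OF left_module_MR M fst_ring_hom, where \<phi> = "\<lambda>x. x", OF _ word_aug_closed z inj_LetP])
  show "(\<lambda>x. x) \<in> lmod_hom R MR MR" by (rule lmod_homI) (assumption | rule refl)+
  show "(\<lambda>p. [LetP 0 p]) ` bas P 0 \<subseteq> W 0" using LetP_W by blast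
  show "word_aug \<epsilon>P w = \<zero>\<^bsub>M\<^esub>" if "w \<in> W 0" "w \<notin> (\<lambda>p. [LetP 0 p]) ` bas P 0" for w
    using that by (cases w rule: W_cases) auto
qed simp_all

lemma augG_dG: "z \<in> carrier (G (Suc 0)) \<Longrightarrow> augG (dG 0 z) = \<zero>\<^bsub>M\<^esub>"
  by (simp only: augG_eq[OF dG_closed] blkP_dG P.aug_dif[OF blk_closed(1)])

text \<open>A set-theoretic section of the residue map, normalised at zero so that completing a zero
  coefficient does not enlarge the support.\<close>

lemma lift_to:
  assumes h: "h \<in> ring_hom A k" and A: "ring A" and surj: "h ` carrier A = carrier k"
  obtains l where "\<And>u. u \<in> carrier k \<Longrightarrow> l u \<in> carrier A" "\<And>u. u \<in> carrier k \<Longrightarrow> h (l u) = u"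
    "l \<zero>\<^bsub>k\<^esub> = \<zero>\<^bsub>A\<^esub>"
proof -
  interpret A: ring A by (rule A)
  have "\<exists>a. (u \<in> carrier k \<longrightarrow> a \<in> carrier A \<and> h a = u) \<and> (u = \<zero>\<^bsub>k\<^esub> \<longrightarrow> a = \<zero>\<^bsub>A\<^esub>)" for u
  proof (cases "u = \<zero>\<^bsub>k\<^esub>")
    case True
    then show ?thesis using ring_hom_zero[OF h A k.ring_axioms] by auto
  next
    case False
    then show ?thesis unfolding surj[symmetric] by auto
  qed
  then obtain l where "\<And>u. (u \<in> carrier k \<longrightarrow> l u \<in> carrier A \<and> h (l u) = u) \<and> (u = \<zero>\<^bsub>k\<^esub> \<longrightarrow> l u = \<zero>\<^bsub>A\<^esub>)"
    by metis
  then show ?thesis using that by blast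
qed

text \<open>At a word beginning with \<open>P\<close> or \<open>E\<close> the first component is
  prescribed, at a word beginning with \<open>F\<close> the second. The remaining component only has
  to have the right residue, so a lift of the residue completes the pair. The families
  \<open>cE\<close> and \<open>cF\<close> carry no degree, because \<open>i\<close> and
  \<open>w\<close> determine the degree of the first letter.\<close>

lemma assemble:
  assumes cP: "cP \<in> carrier (P.coef i)"
    and cE: "\<And>w j. w \<in> wordset \<Longrightarrow> is_F (hd w) \<Longrightarrow> i = Suc j + word_deg w \<Longrightarrow> cE w \<in> carrier (E.coef (Suc j))"
    and cF: "\<And>w j. w \<in> wordset \<Longrightarrow> \<not> is_F (hd w) \<Longrightarrow> i = Suc j + word_deg w \<Longrightarrow> cF w \<in> carrier (F.coef (Suc j))"
    and finE: "finite {w. cE w \<noteq> (\<lambda>_. \<zero>\<^bsub>S\<^esub>)}" and finF: "finite {w. cF w \<noteq> (\<lambda>_. \<zero>\<^bsub>T\<^esub>)}"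
  shows "\<exists>z\<in>carrier (G i). blkP i z = cP \<and>
    (\<forall>w j. w \<in> wordset \<longrightarrow> is_F (hd w) \<longrightarrow> i = Suc j + word_deg w \<longrightarrow> blkE w (Suc j) z = cE w) \<and>
    (\<forall>w j. w \<in> wordset \<longrightarrow> \<not> is_F (hd w) \<longrightarrow> i = Suc j + word_deg w \<longrightarrow> blkF w (Suc j) z = cF w)"
proof -
  obtain lS where lS: "\<And>u. u \<in> carrier k \<Longrightarrow> lS u \<in> carrier S" "\<And>u. u \<in> carrier k \<Longrightarrow> \<pi>S (lS u) = u"
      "lS \<zero>\<^bsub>k\<^esub> = \<zero>\<^bsub>S\<^esub>" using lift_to[OF \<pi>S S \<pi>S_surj] by blast
  obtain lT where lT: "\<And>u. u \<in> carrier k \<Longrightarrow> lT u \<in> carrier T" "\<And>u. u \<in> carrier k \<Longrightarrow> \<pi>T (lT u) = u"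
      "lT \<zero>\<^bsub>k\<^esub> = \<zero>\<^bsub>T\<^esub>" using lift_to[OF \<pi>T T \<pi>T_surj] by blast
  define val where "val v = (case v of [] \<Rightarrow> (\<zero>\<^bsub>S\<^esub>, \<zero>\<^bsub>T\<^esub>)
      | x # w \<Rightarrow> (case x of LetP j p \<Rightarrow> (cP p, lT (\<pi>S (cP p))) | LetE j e \<Rightarrow> (cE w e, lT (\<pi>S (cE w e)))
          | LetF j f \<Rightarrow> (lS (\<pi>T (cF w f)), cF w f)))" for v
  define z where "z v = (if v \<in> W i then val v else (\<zero>\<^bsub>S\<^esub>, \<zero>\<^bsub>T\<^esub>))" for v
  have zP: "z [LetP i p] = (cP p, lT (\<pi>S (cP p)))" if "p \<in> bas P i" for p
    using LetP_W[OF that] by (simp add: z_def val_def)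
  have zE: "z (LetE (Suc j) e # w) = (cE w e, lT (\<pi>S (cE w e)))"
    if "e \<in> bas E (Suc j)" "w \<in> wordset" "is_F (hd w)" "i = Suc j + word_deg w" for j e w
    using consE_W[of w e "Suc j"] that by (simp add: z_def val_def)
  have zF: "z (LetF (Suc j) f # w) = (lS (\<pi>T (cF w f)), cF w f)"
    if "f \<in> bas F (Suc j)" "w \<in> wordset" "\<not> is_F (hd w)" "i = Suc j + word_deg w" for j f w
    using consF_W[of w f "Suc j"] that by (simp add: z_def val_def)
  have cEv: "cE w e \<in> carrier S" if "w \<in> wordset" "is_F (hd w)" "i = Suc j + word_deg w" for w j e
    using cE[OF that] by simp
  have cFv: "cF w f \<in> carrier T" if "w \<in> wordset" "\<not> is_F (hd w)" "i = Suc j + word_deg w" for w j f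
    using cF[OF that] by simp
  have cPv: "cP p \<in> carrier S" for p using cP by simp
  have zR: "z v \<in> carrier R" for v
  proof (cases "v \<in> W i")
    case True
    then show ?thesis
    proof (cases rule: W_cases)
      case (P p)
      then show ?thesis using cPv[of p] lT by (simp add: zP)
    next
      case (E j e w)
      then show ?thesis using cEv[of w j e] lT by (simp add: zE)
    next
      case (F j f w)
      then show ?thesis using cFv[of w j f] lS by (simp add: zF)
    qed
  qed (simp add: z_def)
  \<comment> \<open>The restriction to admissible words is needed because only there
    \<open>cE w\<close> and \<open>cF w\<close> are known to have finite support. The degree of the
    first letter is recovered below as \<open>i - word_deg w\<close>.\<close>
  let ?NE = "{w. cE w \<noteq> (\<lambda>_. \<zero>\<^bsub>S\<^esub>)} \<inter> {w. w \<in> wordset \<and> is_F (hd w) \<and> (\<exists>j. i = Suc j + word_deg w)}"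
  let ?NF = "{w. cF w \<noteq> (\<lambda>_. \<zero>\<^bsub>T\<^esub>)} \<inter> {w. w \<in> wordset \<and> \<not> is_F (hd w) \<and> (\<exists>j. i = Suc j + word_deg w)}"
  let ?supp = "(\<lambda>p. [LetP i p]) ` {p. cP p \<noteq> \<zero>\<^bsub>S\<^esub>}
      \<union> (\<Union>w\<in>?NE. (\<lambda>e. LetE (i - word_deg w) e # w) ` {e. cE w e \<noteq> \<zero>\<^bsub>S\<^esub>})
      \<union> (\<Union>w\<in>?NF. (\<lambda>f. LetF (i - word_deg w) f # w) ` {f. cF w f \<noteq> \<zero>\<^bsub>T\<^esub>})"
  have "{v. z v \<noteq> (\<zero>\<^bsub>S\<^esub>, \<zero>\<^bsub>T\<^esub>)} \<subseteq> ?supp"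
  proof
    fix v assume "v \<in> {v. z v \<noteq> (\<zero>\<^bsub>S\<^esub>, \<zero>\<^bsub>T\<^esub>)}"
    then have nz: "z v \<noteq> (\<zero>\<^bsub>S\<^esub>, \<zero>\<^bsub>T\<^esub>)" and v: "v \<in> W i" by (auto simp: z_def split: if_splits)
    from v show "v \<in> ?supp"
    proof (cases rule: W_cases)
      case (P p)
      then have "cP p \<noteq> \<zero>\<^bsub>S\<^esub>" using nz lT(3) by (auto simp: zP)
      then show ?thesis using P by blast
    next
      case (E j e w)
      then have "cE w e \<noteq> \<zero>\<^bsub>S\<^esub>" using nz lT(3) by (auto simp: zE)
      moreover from this have "w \<in> ?NE" using E by auto
      moreover have "v = LetE (i - word_deg w) e # w" using E by simp
      ultimately show ?thesis by blast
    next
      case (F j f w)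
      then have "cF w f \<noteq> \<zero>\<^bsub>T\<^esub>" using nz lS(3) by (auto simp: zF)
      moreover from this have "w \<in> ?NF" using F by auto
      moreover have "v = LetF (i - word_deg w) f # w" using F by simp
      ultimately show ?thesis by blast
    qed
  qed
  moreover have "finite ?supp"
  proof (intro finite_UnI finite_UN_I finite_imageI)
    show "finite {p. cP p \<noteq> \<zero>\<^bsub>S\<^esub>}" using cP by simp
    show "finite ?NE" "finite ?NF" using finE finF by auto
    show "finite {e. cE w e \<noteq> \<zero>\<^bsub>S\<^esub>}" if wN: "w \<in> ?NE" for w
    proof -
      obtain j where "w \<in> wordset" "is_F (hd w)" "i = Suc j + word_deg w" using wN by blast
      from cE[OF this] show ?thesis by simp
    qed
    show "finite {f. cF w f \<noteq> \<zero>\<^bsub>T\<^esub>}" if wN: "w \<in> ?NF" for w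
    proof -
      obtain j where "w \<in> wordset" "\<not> is_F (hd w)" "i = Suc j + word_deg w" using wN by blast
      from cF[OF this] show ?thesis by simp
    qed
  qed
  ultimately have fin: "finite {v. z v \<noteq> (\<zero>\<^bsub>S\<^esub>, \<zero>\<^bsub>T\<^esub>)}" by (rule finite_subset)
  have out: "z v = (\<zero>\<^bsub>S\<^esub>, \<zero>\<^bsub>T\<^esub>)" if "v \<notin> W i" for v using that by (simp add: z_def)
  have z: "z \<in> carrier (G i)"
    unfolding free_module_simps(1) fiber_product_simps(2) using zR out fin by blast
  moreover have "blkP i z = cP"
  proof
    fix p show "blkP i z p = cP p"
      using zP[of p] cP by (cases "p \<in> bas P i") (simp_all add: pull_def)
  qed
  moreover have "blkE w (Suc j) z = cE w" if "w \<in> wordset" "is_F (hd w)" "i = Suc j + word_deg w" for w j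
  proof
    fix e show "blkE w (Suc j) z e = cE w e"
      using zE[of e j w] cE[OF that] that by (cases "e \<in> bas E (Suc j)") (simp_all add: pull_def)
  qed
  moreover have "blkF w (Suc j) z = cF w" if "w \<in> wordset" "\<not> is_F (hd w)" "i = Suc j + word_deg w" for w j
  proof
    fix f show "blkF w (Suc j) z f = cF w f"
      using zF[of f j w] cF[OF that] that by (cases "f \<in> bas F (Suc j)") (simp_all add: pull_def)
  qed
  ultimately show ?thesis by blast
qed

lemma augG_surj: "augG ` carrier (G 0) = carrier MR"
proof
  show "augG ` carrier (G 0) \<subseteq> carrier MR" using lmod_homD(1)[OF augG_hom] by blast
  show "carrier MR \<subseteq> augG ` carrier (G 0)"
  proof
    fix m assume "m \<in> carrier MR"
    then have "m \<in> carrier M" by simp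
    then obtain c where c: "c \<in> carrier (P.coef 0)" "P.aug c = m" using P.aug_surj by metis
    \<comment> \<open>In degree 0 the conditions on the blocks of \<open>E\<close> and
      \<open>F\<close> are vacuous, so zero families will do.\<close>
    obtain z where z: "z \<in> carrier (G 0)" "blkP 0 z = c"
      using assemble[OF c(1), of "\<lambda>_ _. \<zero>\<^bsub>S\<^esub>" "\<lambda>_ _. \<zero>\<^bsub>T\<^esub>"] by auto
    have "augG z = m" using augG_eq[OF z(1)] z(2) c(2) by metis
    then show "m \<in> augG ` carrier (G 0)" using z(1) by (rule image_eqI[OF sym])
  qed
qed

section \<open>Cycles and boundaries\<close>

definition "cycleG i z \<longleftrightarrow> (case i of 0 \<Rightarrow> augG z = \<zero>\<^bsub>M\<^esub> | Suc j \<Rightarrow> dG j z = (\<lambda>_. (\<zero>\<^bsub>S\<^esub>, \<zero>\<^bsub>T\<^esub>)))"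

text \<open>\<open>E\<close> has rank one in degree 0, and \<open>S\<close> acts on \<open>k\<close>
  through the residue map, so the augmentation is the residue of the single coefficient times
  \<open>\<epsilon>E oneE\<close>. This is how a statement about residues becomes the cycle
  condition at the bottom of a block.\<close>

lemma aug_zero_of_residue_zero:
  shows "c \<in> carrier (E.coef 0) \<Longrightarrow> c oneE \<in> \<pp> \<Longrightarrow> E.aug c = \<zero>\<^bsub>k\<^esub>"
    and "d \<in> carrier (F.coef 0) \<Longrightarrow> d oneF \<in> \<qq> \<Longrightarrow> F.aug d = \<zero>\<^bsub>k\<^esub>"
proof -
  interpret NE: lmod S "restrict_scalars \<pi>S (regular_module k)"
    by (rule lmod.intro, rule E.left_module_target)
  interpret NF: lmod T "restrict_scalars \<pi>T (regular_module k)"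
    by (rule lmod.intro, rule F.left_module_target)
  have e: "\<epsilon>E oneE \<in> carrier k"
    using lmod_homD(2)[OF E.eps_hom E.basis_closed[of oneE 0]] unitE(2) by simp
  have f: "\<epsilon>F oneF \<in> carrier k"
    using lmod_homD(2)[OF F.eps_hom F.basis_closed[of oneF 0]] unitF(2) by simp
  show "E.aug c = \<zero>\<^bsub>k\<^esub>" if c: "c \<in> carrier (E.coef 0)" and res: "c oneE \<in> \<pp>"
  proof -
    have "E.aug c = (\<Oplus>\<^bsub>restrict_scalars \<pi>S (regular_module k)\<^esub>b\<in>{oneE}.
        c b \<odot>\<^bsub>restrict_scalars \<pi>S (regular_module k)\<^esub> \<epsilon>E b)"
      unfolding E.aug_eq_lin_ext[OF c]
      by (rule NE.lin_ext_superset[OF c]) (use c e unitE(2) in auto)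
    then show ?thesis using e res by (simp add: mem_pp)
  qed
  show "F.aug d = \<zero>\<^bsub>k\<^esub>" if d: "d \<in> carrier (F.coef 0)" and res: "d oneF \<in> \<qq>"
  proof -
    have "F.aug d = (\<Oplus>\<^bsub>restrict_scalars \<pi>T (regular_module k)\<^esub>b\<in>{oneF}.
        d b \<odot>\<^bsub>restrict_scalars \<pi>T (regular_module k)\<^esub> \<epsilon>F b)"
      unfolding F.aug_eq_lin_ext[OF d]
      by (rule NF.lin_ext_superset[OF d]) (use d f unitF(2) in auto)
    then show ?thesis using f res by (simp add: mem_qq)
  qed
qed

text \<open>The coefficient of a cycle at a word is minimal on one side, because it comes from a
  boundary there; the equality of residues in \<open>k\<close> transfers this to the other side.\<close>

lemma cycle_coefficients:
  assumes z: "z \<in> carrier (G i)" and cyc: "cycleG i z"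
  shows "P.cycle i (blkP i z)"
    and "w \<in> wordset \<Longrightarrow> is_F (hd w) \<Longrightarrow> i = j + word_deg w \<Longrightarrow> E.cycle j (blkE w j z)"
    and "w \<in> wordset \<Longrightarrow> \<not> is_F (hd w) \<Longrightarrow> i = j + word_deg w \<Longrightarrow> F.cycle j (blkF w j z)"
proof -
  show cP: "P.cycle i (blkP i z)"
  proof (cases i)
    case 0
    then show ?thesis using cyc augG_eq z unfolding P.cycle_def cycleG_def by simp
  next
    case (Suc i')
    then have "dG i' z = (\<lambda>_. (\<zero>\<^bsub>S\<^esub>, \<zero>\<^bsub>T\<^esub>))" using cyc by (simp add: cycleG_def)
    then have "P.dif i' (blkP (Suc i') z) = (\<lambda>_. \<zero>\<^bsub>S\<^esub>)"
      using blkP_dG[where z = z and i = i'] z blk_zero(1)[of i'] unfolding Suc by argo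
    then show ?thesis unfolding P.cycle_def Suc by simp
  qed
  \<comment> \<open>Above the bottom of a block, the cycle condition is the vanishing of the
    corresponding block of the boundary of \<open>z\<close>.\<close>
  have cE: "E.cycle (Suc j) (blkE w (Suc j) z)"
    if w: "w \<in> wordset" "is_F (hd w)" "i = Suc j + word_deg w" for w j
  proof -
    have i: "i = Suc (j + word_deg w)" using w(3) by simp
    then have "dG (j + word_deg w) z = (\<lambda>_. (\<zero>\<^bsub>S\<^esub>, \<zero>\<^bsub>T\<^esub>))" using cyc by (simp add: cycleG_def)
    then have "E.dif j (blkE w (Suc j) z) = (\<lambda>_. \<zero>\<^bsub>S\<^esub>)"
      using blkE_dG[OF w(1,2) refl, where z = z and j = j] z blk_zero(2)[where w = w and j = j] unfolding i by argo
    then show ?thesis unfolding E.cycle_def by simp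
  qed
  have cF: "F.cycle (Suc j) (blkF w (Suc j) z)"
    if w: "w \<in> wordset" "\<not> is_F (hd w)" "i = Suc j + word_deg w" for w j
  proof -
    have i: "i = Suc (j + word_deg w)" using w(3) by simp
    then have "dG (j + word_deg w) z = (\<lambda>_. (\<zero>\<^bsub>S\<^esub>, \<zero>\<^bsub>T\<^esub>))" using cyc by (simp add: cycleG_def)
    then have "F.dif j (blkF w (Suc j) z) = (\<lambda>_. \<zero>\<^bsub>T\<^esub>)"
      using blkF_dG[OF w(1,2) refl, where z = z and j = j] z blk_zero(3)[where w = w and j = j] unfolding i by argo
    then show ?thesis unfolding F.cycle_def by simp
  qed
  have zR: "z v \<in> carrier R" for v using z by simp
  \<comment> \<open>The block containing this component is a cycle in an exact complex, hence a
    boundary, and boundaries have coefficients in \<open>\<pp>\<close>. For the \<open>P\<close>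
    block this also works in degree 0, where cycles are the kernel of the augmentation.\<close>
  have fst_p: "fst (z v) \<in> \<pp>" if v: "v \<in> W i" "\<not> is_F (hd v)" for v
    using v(1)
  proof (cases v rule: W_cases)
    case (P p)
    obtain c where c: "c \<in> carrier (P.coef (Suc i))" "P.dif i c = blkP i z"
      using P.cycle_exact[OF blk_closed(1)[OF z] cP] by metis
    have "fst (z v) = P.dif i c p" unfolding c(2) P(1) by (rule blk_eval(1)[OF P(2), symmetric])
    then show ?thesis using P.dif_minimal[OF c(1), of p] by (rule ssubst)
  next
    case (E j e w)
    have i: "i = Suc j + word_deg w" using E(5) by simp
    obtain c where c: "c \<in> carrier (E.coef (Suc (Suc j)))" "E.dif (Suc j) c = blkE w (Suc j) z"
      using E.cycle_exact[OF blk_closed(2)[OF z] cE[OF E(3,4) i]] by metis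
    have "fst (z v) = E.dif (Suc j) c e"
      unfolding c(2) E(1) using blk_eval(2)[OF E(2), where w = w and z = z] by simp
    then show ?thesis using E.dif_minimal[OF c(1), of e] by (rule ssubst)
  next
    case (F j f w)
    then show ?thesis using v(2) by simp
  qed
  have snd_q: "snd (z v) \<in> \<qq>" if v: "v \<in> W i" "is_F (hd v)" for v
    using v(1)
  proof (cases v rule: W_cases)
    case (F j f w)
    have i: "i = Suc j + word_deg w" using F(5) by simp
    obtain c where c: "c \<in> carrier (F.coef (Suc (Suc j)))" "F.dif (Suc j) c = blkF w (Suc j) z"
      using F.cycle_exact[OF blk_closed(3)[OF z] cF[OF F(3,4) i]] by metis
    have "snd (z v) = F.dif (Suc j) c f"
      unfolding c(2) F(1) using blk_eval(3)[OF F(2), where w = w and z = z] by simp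
    then show ?thesis using F.dif_minimal[OF c(1), of f] by (rule ssubst)
  qed (use v(2) in simp_all)
  have fst_p': "fst (z v) \<in> \<pp>" and snd_q': "snd (z v) \<in> \<qq>" if "v \<in> W i" for v
    using fst_p[OF that] snd_q[OF that] zR[of v] by (auto simp: mem_pp mem_qq)
  show "E.cycle j (blkE w j z)" if w: "w \<in> wordset" "is_F (hd w)" "i = j + word_deg w"
  proof (cases j)
    case 0
    \<comment> \<open>The only coefficient of the degree 0 block over \<open>w\<close> sits at the
      word \<open>w\<close> itself, where the residue is now known to vanish.\<close>
    then have "w \<in> W i" using w by (simp add: W_iff)
    then have "blkE w 0 z oneE \<in> \<pp>" using fst_p' unitE(2) by (simp add: pull_def)
    then show ?thesis
      using aug_zero_of_residue_zero(1)[OF blk_closed(2)[OF z]] unfolding 0 E.cycle_def by simp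
  next
    case (Suc j')
    then show ?thesis using cE w by simp
  qed
  show "F.cycle j (blkF w j z)" if w: "w \<in> wordset" "\<not> is_F (hd w)" "i = j + word_deg w"
  proof (cases j)
    case 0
    then have "w \<in> W i" using w by (simp add: W_iff)
    then have "blkF w 0 z oneF \<in> \<qq>" using snd_q' unitF(2) by (simp add: pull_def)
    then show ?thesis
      using aug_zero_of_residue_zero(2)[OF blk_closed(3)[OF z]] unfolding 0 F.cycle_def by simp
  next
    case (Suc j')
    then show ?thesis using cF w by simp
  qed
qed

text \<open>A nonzero entry of a block over \<open>w\<close> sits at \<open>w\<close> or at
  \<open>w\<close> with one letter in front, so \<open>w\<close> belongs to the support of
  \<open>z\<close> or is the tail of a word in it.\<close>

lemma finite_blocks:
  assumes z: "z \<in> carrier (free_module R V)"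
  shows "finite {w. \<exists>j. blkE w j z \<noteq> (\<lambda>_. \<zero>\<^bsub>S\<^esub>)}" "finite {w. \<exists>j. blkF w j z \<noteq> (\<lambda>_. \<zero>\<^bsub>T\<^esub>)}"
proof -
  let ?Z = "{v. z v \<noteq> (\<zero>\<^bsub>S\<^esub>, \<zero>\<^bsub>T\<^esub>)}"
  have fin: "finite (?Z \<union> tl ` ?Z)" using z by simp
  have sub: "w \<in> ?Z \<union> tl ` ?Z" if "z (x # w) \<noteq> (\<zero>\<^bsub>S\<^esub>, \<zero>\<^bsub>T\<^esub>) \<or> z w \<noteq> (\<zero>\<^bsub>S\<^esub>, \<zero>\<^bsub>T\<^esub>)" for x w
    using that by (force simp: image_iff)
  have "{w. \<exists>j. blkE w j z \<noteq> (\<lambda>_. \<zero>\<^bsub>S\<^esub>)} \<subseteq> ?Z \<union> tl ` ?Z"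
  proof
    fix w assume "w \<in> {w. \<exists>j. blkE w j z \<noteq> (\<lambda>_. \<zero>\<^bsub>S\<^esub>)}"
    then obtain j e where "fst (z (consE j e w)) \<noteq> \<zero>\<^bsub>S\<^esub>" by (auto simp: pull_def fun_eq_iff split: if_splits)
    then show "w \<in> ?Z \<union> tl ` ?Z" by (intro sub[of "LetE j e"]) (auto simp: consE_def split: if_splits)
  qed
  then show "finite {w. \<exists>j. blkE w j z \<noteq> (\<lambda>_. \<zero>\<^bsub>S\<^esub>)}" using fin by (rule finite_subset)
  have "{w. \<exists>j. blkF w j z \<noteq> (\<lambda>_. \<zero>\<^bsub>T\<^esub>)} \<subseteq> ?Z \<union> tl ` ?Z"
  proof
    fix w assume "w \<in> {w. \<exists>j. blkF w j z \<noteq> (\<lambda>_. \<zero>\<^bsub>T\<^esub>)}"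
    then obtain j f where "snd (z (consF j f w)) \<noteq> \<zero>\<^bsub>T\<^esub>" by (auto simp: pull_def fun_eq_iff split: if_splits)
    then show "w \<in> ?Z \<union> tl ` ?Z" by (intro sub[of "LetF j f"]) (auto simp: consF_def split: if_splits)
  qed
  then show "finite {w. \<exists>j. blkF w j z \<noteq> (\<lambda>_. \<zero>\<^bsub>T\<^esub>)}" using fin by (rule finite_subset)
qed

text \<open>Preimages are chosen block by block. The boundary does not depend on the coefficients in
  degree \<open>0\<close> of a block, so that these can be chosen to match the other side in \<open>k\<close>.\<close>

lemma cycleG_exact:
  assumes z: "z \<in> carrier (G i)" and cyc: "cycleG i z"
  shows "\<exists>z'\<in>carrier (G (Suc i)). dG i z' = z"
proof -
  note cy = cycle_coefficients[OF z cyc]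
  obtain cP where cP: "cP \<in> carrier (P.coef (Suc i))" "P.dif i cP = blkP i z"
    using P.cycle_exact[OF blk_closed(1)[OF z] cy(1)] by metis
  let ?okE = "\<lambda>w. w \<in> wordset \<and> is_F (hd w) \<and> word_deg w \<le> i"
  let ?okF = "\<lambda>w. w \<in> wordset \<and> \<not> is_F (hd w) \<and> word_deg w \<le> i"
  \<comment> \<open>The degree within the block over \<open>w\<close>; the truncated subtraction is
    exact under \<open>?okE\<close> and \<open>?okF\<close>.\<close>
  let ?j = "\<lambda>w. i - word_deg w"
  \<comment> \<open>The second conjunct picks the zero preimage over a zero block, so that by
    \<open>finite_blocks\<close> only finitely many preimages are nonzero.\<close>
  let ?QE = "\<lambda>w c. (?okE w \<longrightarrow> c \<in> carrier (E.coef (Suc (?j w))) \<and> E.dif (?j w) c = blkE w (?j w) z) \<and>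
      (blkE w (?j w) z = (\<lambda>_. \<zero>\<^bsub>S\<^esub>) \<or> \<not> ?okE w \<longrightarrow> c = (\<lambda>_. \<zero>\<^bsub>S\<^esub>))"
  have exE: "\<exists>c. ?QE w c" for w
  proof (cases "?okE w \<and> blkE w (?j w) z \<noteq> (\<lambda>_. \<zero>\<^bsub>S\<^esub>)")
    case True
    then have "i = ?j w + word_deg w" by simp
    from E.cycle_exact[OF blk_closed(2)[OF z] cy(2)[OF _ _ this]] True show ?thesis by metis
  next
    case False
    have "E.dif (?j w) (\<lambda>_. \<zero>\<^bsub>S\<^esub>) = (\<lambda>_. \<zero>\<^bsub>S\<^esub>)"
      using lmod_hom_zero[OF E.left_module_coef E.left_module_coef E.dif_hom] by simp
    then show ?thesis using False by (intro exI[of _ "\<lambda>_. \<zero>\<^bsub>S\<^esub>"]) auto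
  qed
  define cE where "cE w = (SOME c. ?QE w c)" for w
  have QE: "?QE w (cE w)" for w unfolding cE_def by (rule someI_ex[OF exE[of w]])
  have cE:
    "?okE w \<Longrightarrow> cE w \<in> carrier (E.coef (Suc (?j w))) \<and> E.dif (?j w) (cE w) = blkE w (?j w) z"
    "blkE w (?j w) z = (\<lambda>_. \<zero>\<^bsub>S\<^esub>) \<Longrightarrow> cE w = (\<lambda>_. \<zero>\<^bsub>S\<^esub>)" for w
    by (rule mp[OF conjunct1[OF QE]], assumption, rule mp[OF conjunct2[OF QE]], rule disjI1)
  let ?QF = "\<lambda>w c. (?okF w \<longrightarrow> c \<in> carrier (F.coef (Suc (?j w))) \<and> F.dif (?j w) c = blkF w (?j w) z) \<and>
      (blkF w (?j w) z = (\<lambda>_. \<zero>\<^bsub>T\<^esub>) \<or> \<not> ?okF w \<longrightarrow> c = (\<lambda>_. \<zero>\<^bsub>T\<^esub>))"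
  have exF: "\<exists>c. ?QF w c" for w
  proof (cases "?okF w \<and> blkF w (?j w) z \<noteq> (\<lambda>_. \<zero>\<^bsub>T\<^esub>)")
    case True
    then have "i = ?j w + word_deg w" by simp
    from F.cycle_exact[OF blk_closed(3)[OF z] cy(3)[OF _ _ this]] True show ?thesis by metis
  next
    case False
    have "F.dif (?j w) (\<lambda>_. \<zero>\<^bsub>T\<^esub>) = (\<lambda>_. \<zero>\<^bsub>T\<^esub>)"
      using lmod_hom_zero[OF F.left_module_coef F.left_module_coef F.dif_hom] by simp
    then show ?thesis using False by (intro exI[of _ "\<lambda>_. \<zero>\<^bsub>T\<^esub>"]) auto
  qed
  define cF where "cF w = (SOME c. ?QF w c)" for w
  have QF: "?QF w (cF w)" for w unfolding cF_def by (rule someI_ex[OF exF[of w]])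
  have cF:
    "?okF w \<Longrightarrow> cF w \<in> carrier (F.coef (Suc (?j w))) \<and> F.dif (?j w) (cF w) = blkF w (?j w) z"
    "blkF w (?j w) z = (\<lambda>_. \<zero>\<^bsub>T\<^esub>) \<Longrightarrow> cF w = (\<lambda>_. \<zero>\<^bsub>T\<^esub>)" for w
    by (rule mp[OF conjunct1[OF QF]], assumption, rule mp[OF conjunct2[OF QF]], rule disjI1)
  have finE: "finite {w. cE w \<noteq> (\<lambda>_. \<zero>\<^bsub>S\<^esub>)}"
    by (rule finite_subset[OF _ finite_blocks(1)[OF z]]) (use cE(2) in blast)
  have finF: "finite {w. cF w \<noteq> (\<lambda>_. \<zero>\<^bsub>T\<^esub>)}"
    by (rule finite_subset[OF _ finite_blocks(2)[OF z]]) (use cF(2) in blast)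
  have eE: "cE w \<in> carrier (E.coef (Suc j))" "E.dif j (cE w) = blkE w j z"
    if w: "w \<in> wordset" "is_F (hd w)" "i = j + word_deg w" for w j
  proof -
    have "?okE w" "?j w = j" using w by simp_all
    with cE(1)[of w] show "cE w \<in> carrier (E.coef (Suc j))" "E.dif j (cE w) = blkE w j z" by metis+
  qed
  have eF: "cF w \<in> carrier (F.coef (Suc j))" "F.dif j (cF w) = blkF w j z"
    if w: "w \<in> wordset" "\<not> is_F (hd w)" "i = j + word_deg w" for w j
  proof -
    have "?okF w" "?j w = j" using w by simp_all
    with cF(1)[of w] show "cF w \<in> carrier (F.coef (Suc j))" "F.dif j (cF w) = blkF w j z" by metis+
  qed
  obtain z' where z': "z' \<in> carrier (G (Suc i))" "blkP (Suc i) z' = cP"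
    "\<And>w j. w \<in> wordset \<Longrightarrow> is_F (hd w) \<Longrightarrow> Suc i = Suc j + word_deg w \<Longrightarrow> blkE w (Suc j) z' = cE w"
    "\<And>w j. w \<in> wordset \<Longrightarrow> \<not> is_F (hd w) \<Longrightarrow> Suc i = Suc j + word_deg w \<Longrightarrow> blkF w (Suc j) z' = cF w"
  proof -
    have 1: "cE w \<in> carrier (E.coef (Suc j))"
      if "w \<in> wordset" "is_F (hd w)" "Suc i = Suc j + word_deg w" for w j
      by (rule eE(1)[OF that(1,2)]) (use that(3) in simp)
    have 2: "cF w \<in> carrier (F.coef (Suc j))"
      if "w \<in> wordset" "\<not> is_F (hd w)" "Suc i = Suc j + word_deg w" for w j
      by (rule eF(1)[OF that(1,2)]) (use that(3) in simp)
    from assemble[OF cP(1) 1 2 finE finF] show thesis using that by blast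
  qed
  have "dG i z' = z"
  proof (rule G_ext[OF dG_closed[OF z'(1)] z])
    show "blkP i (dG i z') = blkP i z" unfolding blkP_dG[OF z'(1)] z'(2) by (rule cP(2))
    fix w j assume w: "w \<in> wordset" and i: "i = j + word_deg w"
    then have i': "Suc i = Suc j + word_deg w" by simp
    show "blkE w j (dG i z') = blkE w j z" if "is_F (hd w)"
      unfolding blkE_dG[OF w that i z'(1)] z'(3)[OF w that i'] by (rule eE(2)[OF w that i])
    show "blkF w j (dG i z') = blkF w j z" if "\<not> is_F (hd w)"
      unfolding blkF_dG[OF w that i z'(1)] z'(4)[OF w that i'] by (rule eF(2)[OF w that i])
  qed
  then show ?thesis using z'(1) by (rule bexI)
qed

section \<open>The word complex as a minimal free resolution\<close>

lemma kernel_zero_G: "\<zero>\<^bsub>free_module R V\<^esub> = (\<lambda>_. (\<zero>\<^bsub>S\<^esub>, \<zero>\<^bsub>T\<^esub>))" by simp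

abbreviation "GG \<equiv> word_cpx S T \<pi>S \<pi>T P E F"

lemma chn_GG: "chn GG i = G i"
  by (simp add: word_cpx_def word_module_def)

lemma bdy_GG: "bdy GG (Suc i) = dG i"
  by (simp add: word_cpx_def word_module_def Let_def)

lemma one_not_zero_R: "\<one>\<^bsub>R\<^esub> \<noteq> \<zero>\<^bsub>R\<^esub>"
proof
  assume "\<one>\<^bsub>R\<^esub> = \<zero>\<^bsub>R\<^esub>"
  then have "\<pi>S \<one>\<^bsub>S\<^esub> = \<pi>S \<zero>\<^bsub>S\<^esub>" by simp
  then show False unfolding \<pi>S.hom_one \<pi>S.hom_zero using k.one_not_zero by simp
qed

lemma GG_resolution: "free_resolution R GG augG MR"
  unfolding free_resolution_def chn_GG bdy_GG
proof (intro conjI allI)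
  show "left_module R MR" by (rule left_module_MR)
  fix i
  show "left_module R (G i)" by (rule left_module_G)
  show "\<exists>B. is_basis R (G i) B" using R.is_basis_singles[OF one_not_zero_R] by (rule exI)
  show "dG i \<in> lmod_hom R (G (Suc i)) (G i)" by (rule dG_hom)
  show "augG \<in> lmod_hom R (G 0) MR" by (rule augG_hom)
  show "augG ` carrier (G 0) = carrier MR" by (rule augG_surj)
  show "dG (Suc i) ` carrier (G (Suc (Suc i))) = a_kernel (G (Suc i)) (G i) (dG i)"
  proof (intro equalityI subsetI)
    fix x assume "x \<in> dG (Suc i) ` carrier (G (Suc (Suc i)))"
    then obtain z where z: "x = dG (Suc i) z" "z \<in> carrier (G (Suc (Suc i)))" by (rule imageE)
    show "x \<in> a_kernel (G (Suc i)) (G i) (dG i)"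
      unfolding a_kernel_def' kernel_zero_G z(1) by (rule CollectI, rule conjI, rule dG_closed[OF z(2)], rule dG_dG[OF z(2)])
  next
    fix x assume "x \<in> a_kernel (G (Suc i)) (G i) (dG i)"
    then have x: "x \<in> carrier (G (Suc i))" "cycleG (Suc i) x"
      unfolding a_kernel_def' kernel_zero_G cycleG_def by simp_all
    from cycleG_exact[OF this] show "x \<in> dG (Suc i) ` carrier (G (Suc (Suc i)))"
      by (elim bexE) (rule image_eqI[OF sym])
  qed
  show "dG 0 ` carrier (G (Suc 0)) = a_kernel (G 0) MR augG"
  proof (intro equalityI subsetI)
    fix x assume "x \<in> dG 0 ` carrier (G (Suc 0))"
    then obtain z where z: "x = dG 0 z" "z \<in> carrier (G (Suc 0))" by (rule imageE)
    show "x \<in> a_kernel (G 0) MR augG"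
      unfolding a_kernel_def' restrict_scalars_simps z(1)
      by (rule CollectI, rule conjI, rule dG_closed[OF z(2)], rule augG_dG[OF z(2)])
  next
    fix x assume "x \<in> a_kernel (G 0) MR augG"
    then have x: "x \<in> carrier (G 0)" "cycleG 0 x"
      unfolding a_kernel_def' cycleG_def by simp_all
    from cycleG_exact[OF this] show "x \<in> dG 0 ` carrier (G (Suc 0))"
      by (elim bexE) (rule image_eqI[OF sym])
  qed
qed

text \<open>All coefficients of a boundary lie in the product of \<open>\<pp>\<close> and
  \<open>\<qq>\<close>. Writing the boundary as the combination of basis elements with these
  coefficients exhibits it as a sum of generators of \<open>ideal_smult\<close>.\<close>

lemma GG_minimal: "minimal_cpx (fiber_max S T k \<pi>S \<pi>T) GG"
  unfolding minimal_cpx_def chn_GG bdy_GG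
proof (intro allI subsetI)
  fix i x assume "x \<in> dG i ` carrier (G (Suc i))"
  then obtain z where z: "x = dG i z" "z \<in> carrier (G (Suc i))" by (rule imageE)
  interpret G: lmod R "G i" by (rule lmod.intro, rule left_module_G)
  have x: "x \<in> carrier (G i)" unfolding z(1) by (rule dG_closed[OF z(2)])
  let ?H = "ideal_smult (fiber_max S T k \<pi>S \<pi>T) (G i)"
  have coef: "x v \<in> fiber_max S T k \<pi>S \<pi>T" for v
    using dG_minimal[OF z(2), of v] unfolding fiber_max_eq z(1) by (simp add: mem_Times_iff)
  have gen: "a \<odot>\<^bsub>G i\<^esub> y \<in> carrier (G i)" if "a \<in> fiber_max S T k \<pi>S \<pi>T" "y \<in> carrier (G i)" for a y
    by (rule G.smult_closed[OF _ that(2)]) (use that(1) in \<open>auto simp: fiber_max_eq mem_pp mem_qq\<close>)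
  have "additive_subgroup ?H (G i)"
    unfolding ideal_smult_def additive_subgroup_def
    by (rule G.M.add.generate_is_subgroup) (use gen in blast)
  moreover have "x v \<odot>\<^bsub>G i\<^esub> single R v \<in> ?H" if "x v \<noteq> \<zero>\<^bsub>R\<^esub>" for v
  proof -
    have "v \<in> W i" using that x by (auto simp: free_module_simps)
    from R.single_closed[OF this] coef show ?thesis
      unfolding ideal_smult_def by (intro generate.incl) blast
  qed
  ultimately have "lin_ext R (G i) (single R) x \<in> ?H"
    unfolding lin_ext_def
    by (intro subgroup_finsum_closed[OF G.M.abelian_group_axioms])
       (assumption, rule Pi_I, simp only: mem_Collect_eq)
  then show "x \<in> ?H" unfolding R.lin_ext_singles[OF x] .
qed

end


section \<open>Gradings\<close>

text \<open>The family of maps covers the grading of a free module, which imposes a condition at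
  every basis element; a family over \<open>unit\<close> gives an ordinary preimage.\<close>

lemma additive_subgroup_vimage:
  assumes M: "abelian_group M" and N: "abelian_group N"
    and f: "\<And>i x. x \<in> carrier M \<Longrightarrow> f i x \<in> carrier N"
    and add: "\<And>i x y. x \<in> carrier M \<Longrightarrow> y \<in> carrier M \<Longrightarrow> f i (x \<oplus>\<^bsub>M\<^esub> y) = f i x \<oplus>\<^bsub>N\<^esub> f i y"
    and H: "\<And>i. additive_subgroup (H i) N"
  shows "additive_subgroup {x \<in> carrier M. \<forall>i. f i x \<in> H i} M"
proof -
  interpret M: abelian_group M by fact
  interpret N: abelian_group N by fact
  have zero: "f i \<zero>\<^bsub>M\<^esub> = \<zero>\<^bsub>N\<^esub>" for i
    by (rule additive_map_zero[OF M N]) (auto simp: f add)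
  have inv: "f i (\<ominus>\<^bsub>M\<^esub> x) = \<ominus>\<^bsub>N\<^esub> f i x" if x: "x \<in> carrier M" for i x
  proof -
    have "f i (\<ominus>\<^bsub>M\<^esub> x) \<oplus>\<^bsub>N\<^esub> f i x = \<zero>\<^bsub>N\<^esub>"
      using x by (simp add: add[symmetric] M.l_neg zero)
    then show ?thesis using x f by (intro N.minus_equality[symmetric]) auto
  qed
  show ?thesis
    unfolding additive_subgroup_def
    by (rule M.add.subgroupI)
       (auto simp: zero inv add additive_subgroup.zero_closed[OF H] additive_subgroup.a_closed[OF H]
          additive_subgroup.a_inv_closed[OF H] N intro!: exI[of _ "\<zero>\<^bsub>M\<^esub>"])
qed

text \<open>Existence is the decomposition into projections. Uniqueness follows by applying the
  additive map \<open>pr m\<close> to an arbitrary decomposition, which isolates its component of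
  degree \<open>m\<close>.\<close>

lemma direct_decompI:
  assumes M: "abelian_group M"
    and sub: "\<And>n. additive_subgroup (gM n) M"
    and pr: "\<And>n x. x \<in> carrier M \<Longrightarrow> pr n x \<in> gM n"
    and add: "\<And>n x y. x \<in> carrier M \<Longrightarrow> y \<in> carrier M \<Longrightarrow> pr n (x \<oplus>\<^bsub>M\<^esub> y) = pr n x \<oplus>\<^bsub>M\<^esub> pr n y"
    and same: "\<And>n x. x \<in> gM n \<Longrightarrow> pr n x = x"
    and diff: "\<And>m n x. x \<in> gM n \<Longrightarrow> m \<noteq> n \<Longrightarrow> pr m x = \<zero>\<^bsub>M\<^esub>"
    and fin: "\<And>x. x \<in> carrier M \<Longrightarrow> finite {n. pr n x \<noteq> \<zero>\<^bsub>M\<^esub>}"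
    and sum: "\<And>x. x \<in> carrier M \<Longrightarrow> x = (\<Oplus>\<^bsub>M\<^esub>n\<in>{n. pr n x \<noteq> \<zero>\<^bsub>M\<^esub>}. pr n x)"
  shows "direct_decomp M gM"
proof -
  interpret M: abelian_group M by fact
  have gc: "x \<in> carrier M" if "x \<in> gM n" for x n
    using additive_subgroup.a_Hcarr[OF sub that] .
  have unique: "c = (\<lambda>n. pr n x)"
    if c: "\<forall>n. c n \<in> gM n" "finite {n. c n \<noteq> \<zero>\<^bsub>M\<^esub>}" "x = (\<Oplus>\<^bsub>M\<^esub>n\<in>{n. c n \<noteq> \<zero>\<^bsub>M\<^esub>}. c n)" for c x
  proof
    fix m
    let ?I = "{n. c n \<noteq> \<zero>\<^bsub>M\<^esub>}"
    have cc: "c n \<in> carrier M" for n using c(1) gc by blast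
    have "pr m x = (\<Oplus>\<^bsub>M\<^esub>n\<in>?I. pr m (c n))"
      unfolding c(3) by (rule additive_map_finsum[OF M M _ add]) (use pr gc cc in auto)
    also have "\<dots> = (\<Oplus>\<^bsub>M\<^esub>n\<in>?I. if m = n then c n else \<zero>\<^bsub>M\<^esub>)"
    proof -
      have "pr m (c n) = (if m = n then c n else \<zero>\<^bsub>M\<^esub>)" for n
        using same[of "c n" m] diff[of "c n" n m] c(1) by auto
      then show ?thesis using cc by (intro M.finsum_cong') auto
    qed
    also have "\<dots> = c m"
    proof (cases "m \<in> ?I")
      case True
      then show ?thesis using c(2) cc by (intro M.finsum_singleton) auto
    next
      case False
      then have "(\<Oplus>\<^bsub>M\<^esub>n\<in>?I. if m = n then c n else \<zero>\<^bsub>M\<^esub>) = (\<Oplus>\<^bsub>M\<^esub>n\<in>?I. \<zero>\<^bsub>M\<^esub>)"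
        by (intro M.finsum_cong') auto
      then show ?thesis using False by simp
    qed
    finally show "c m = pr m x" by simp
  qed
  show ?thesis unfolding direct_decomp_def
  proof (intro conjI allI ballI)
    show "additive_subgroup (gM n) M" for n by (rule sub)
    fix x assume x: "x \<in> carrier M"
    show "\<exists>!c. (\<forall>n. c n \<in> gM n) \<and> finite {n. c n \<noteq> \<zero>\<^bsub>M\<^esub>} \<and>
        x = (\<Oplus>\<^bsub>M\<^esub>n\<in>{n. c n \<noteq> \<zero>\<^bsub>M\<^esub>}. c n)"
    proof (rule ex1I[of _ "\<lambda>n. pr n x"])
      show "(\<forall>n. pr n x \<in> gM n) \<and> finite {n. pr n x \<noteq> \<zero>\<^bsub>M\<^esub>} \<and>
        x = (\<Oplus>\<^bsub>M\<^esub>n\<in>{n. pr n x \<noteq> \<zero>\<^bsub>M\<^esub>}. pr n x)"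
        using pr[OF x] fin[OF x] sum[OF x] by blast
    qed (use unique in blast)
  qed
qed

section \<open>Homogeneous components\<close>

locale graded_group = abelian_group M for M :: "('a, 'x) ring_scheme" (structure) +
  fixes gM :: "int \<Rightarrow> 'a set"
  assumes decomp: "direct_decomp M gM"
begin

definition "family x c \<longleftrightarrow> (\<forall>n. c n \<in> gM n) \<and> finite {n. c n \<noteq> \<zero>} \<and> x = (\<Oplus>n\<in>{n. c n \<noteq> \<zero>}. c n)"

definition "hcomp n x = (THE c. family x c) n"

lemma subgroup_part: "additive_subgroup (gM n) M"
  using decomp unfolding direct_decomp_def by blast

lemma part_closed: "x \<in> gM n \<Longrightarrow> x \<in> carrier M"
  using additive_subgroup.a_Hcarr[OF subgroup_part] .

lemma zero_part: "\<zero> \<in> gM n"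
  by (rule additive_subgroup.zero_closed[OF subgroup_part])

lemma ex1_family: "x \<in> carrier M \<Longrightarrow> \<exists>!c. family x c"
  using decomp unfolding direct_decomp_def family_def by blast

lemma family_hcomp: "x \<in> carrier M \<Longrightarrow> family x (\<lambda>n. hcomp n x)"
  unfolding hcomp_def by (rule theI'[OF ex1_family])

lemma family_unique: "family x c \<Longrightarrow> x \<in> carrier M \<Longrightarrow> hcomp n x = c n"
  using ex1_family[of x] family_hcomp[of x] by (metis (no_types))

lemma hcomp_part: "x \<in> carrier M \<Longrightarrow> hcomp n x \<in> gM n"
  and finite_hcomp: "x \<in> carrier M \<Longrightarrow> finite {n. hcomp n x \<noteq> \<zero>}"
  and hcomp_sum: "x \<in> carrier M \<Longrightarrow> x = (\<Oplus>n\<in>{n. hcomp n x \<noteq> \<zero>}. hcomp n x)"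
  using family_hcomp unfolding family_def by blast+

lemma hcomp_closed: "x \<in> carrier M \<Longrightarrow> hcomp n x \<in> carrier M"
  using hcomp_part part_closed by blast

lemma finsum_superset:
  assumes "finite I" "{n. c n \<noteq> \<zero>} \<subseteq> I" "\<And>n. c n \<in> carrier M"
  shows "(\<Oplus>n\<in>{n. c n \<noteq> \<zero>}. c n) = (\<Oplus>n\<in>I. c n)"
  using assms by (intro add.finprod_mono_neutral_cong_left) auto

text \<open>Adding the two decompositions gives a decomposition of the sum, and decompositions are
  unique. Cancellation can shrink the support, so the sums are taken over the union of both
  supports.\<close>

lemma hcomp_add:
  assumes x: "x \<in> carrier M" and y: "y \<in> carrier M"
  shows "hcomp n (x \<oplus> y) = hcomp n x \<oplus> hcomp n y"
proof (rule family_unique)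
  let ?c = "\<lambda>n. hcomp n x \<oplus> hcomp n y"
  let ?I = "{n. hcomp n x \<noteq> \<zero>} \<union> {n. hcomp n y \<noteq> \<zero>}"
  have I: "finite ?I" using finite_hcomp x y by simp
  have sub: "{n. ?c n \<noteq> \<zero>} \<subseteq> ?I" by auto
  have "x \<oplus> y = (\<Oplus>n\<in>?I. hcomp n x) \<oplus> (\<Oplus>n\<in>?I. hcomp n y)"
    using finsum_superset[OF I, of "\<lambda>n. hcomp n x"] finsum_superset[OF I, of "\<lambda>n. hcomp n y"]
      hcomp_sum[OF x] hcomp_sum[OF y] hcomp_closed x y by simp
  also have "\<dots> = (\<Oplus>n\<in>?I. ?c n)"
    using hcomp_closed x y by (intro finsum_addf[symmetric]) auto
  also have "\<dots> = (\<Oplus>n\<in>{n. ?c n \<noteq> \<zero>}. ?c n)"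
    using hcomp_closed x y by (intro finsum_superset[OF I sub, symmetric]) auto
  finally show "family (x \<oplus> y) ?c"
    unfolding family_def
    using additive_subgroup.a_closed[OF subgroup_part] hcomp_part x y finite_subset[OF sub I] by simp
qed (use x y in simp)

lemma hcomp_of_part:
  assumes "x \<in> gM n"
  shows "hcomp m x = (if m = n then x else \<zero>)"
proof (rule family_unique)
  have "(\<Oplus>m\<in>{m. (if m = n then x else \<zero>) \<noteq> \<zero>}. if m = n then x else \<zero>) = (\<Oplus>m\<in>{n}. if m = n then x else \<zero>)"
    using part_closed[OF assms] by (intro finsum_superset) auto
  then show "family x (\<lambda>m. if m = n then x else \<zero>)"
    unfolding family_def using assms zero_part part_closed[OF assms] by auto
qed (use assms part_closed in blast)

text \<open>Zero is homogeneous of every degree, but a nonzero homogeneous element has exactly one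
  nonzero component.\<close>

lemma idegree_eq:
  assumes "x \<in> gM n" "x \<noteq> \<zero>"
  shows "idegree gM x = n"
  unfolding idegree_def
proof (rule the_equality)
  fix m assume "x \<in> gM m"
  then have "hcomp m x = x" by (simp add: hcomp_of_part)
  then show "m = n" using assms by (auto simp: hcomp_of_part split: if_splits)
qed (rule assms)

end

text \<open>The image of the decomposition of \<open>x\<close> is a decomposition of
  \<open>f x\<close>. Applied to \<open>realize\<close>, this yields the homogeneity of
  coordinates.\<close>

lemma hcomp_natural:
  assumes M: "graded_group M gM" and N: "graded_group N gN"
    and f: "f \<in> carrier M \<rightarrow> carrier N"
    and add: "\<And>x y. x \<in> carrier M \<Longrightarrow> y \<in> carrier M \<Longrightarrow> f (x \<oplus>\<^bsub>M\<^esub> y) = f x \<oplus>\<^bsub>N\<^esub> f y"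
    and deg: "\<And>n x. x \<in> gM n \<Longrightarrow> f x \<in> gN n"
    and x: "x \<in> carrier M"
  shows "graded_group.hcomp N gN n (f x) = f (graded_group.hcomp M gM n x)"
proof -
  interpret M: graded_group M gM by fact
  interpret N: graded_group N gN by fact
  have f0: "f \<zero>\<^bsub>M\<^esub> = \<zero>\<^bsub>N\<^esub>"
    by (rule additive_map_zero[OF M.abelian_group_axioms N.abelian_group_axioms f add])
  have fin: "finite {n. M.hcomp n x \<noteq> \<zero>\<^bsub>M\<^esub>}" by (rule M.finite_hcomp[OF x])
  have fc: "f (M.hcomp m x) \<in> carrier N" for m using f M.hcomp_closed[OF x] by blast
  have sub: "{n. f (M.hcomp n x) \<noteq> \<zero>\<^bsub>N\<^esub>} \<subseteq> {n. M.hcomp n x \<noteq> \<zero>\<^bsub>M\<^esub>}" using f0 by auto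
  have "f x = f (\<Oplus>\<^bsub>M\<^esub>m\<in>{m. M.hcomp m x \<noteq> \<zero>\<^bsub>M\<^esub>}. M.hcomp m x)" using M.hcomp_sum[OF x] by simp
  also have "\<dots> = (\<Oplus>\<^bsub>N\<^esub>m\<in>{m. M.hcomp m x \<noteq> \<zero>\<^bsub>M\<^esub>}. f (M.hcomp m x))"
    by (rule additive_map_finsum[OF M.abelian_group_axioms N.abelian_group_axioms f add])
       (auto simp: M.hcomp_closed[OF x])
  also have "\<dots> = (\<Oplus>\<^bsub>N\<^esub>m\<in>{m. f (M.hcomp m x) \<noteq> \<zero>\<^bsub>N\<^esub>}. f (M.hcomp m x))"
    by (rule N.finsum_superset[OF fin sub fc, symmetric])
  finally have "N.family (f x) (\<lambda>m. f (M.hcomp m x))"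
    unfolding N.family_def using finite_subset[OF sub fin] deg[OF M.hcomp_part[OF x]] by simp
  then show ?thesis by (rule N.family_unique) (rule funcset_mem[OF f x])
qed

section \<open>Graded free modules\<close>

lemma graded_moduleD:
  assumes "graded_module A gA M gM"
  shows "left_module A M" "graded_ring A gA" "graded_group M gM"
    and "a \<in> gA m \<Longrightarrow> x \<in> gM n \<Longrightarrow> a \<odot>\<^bsub>M\<^esub> x \<in> gM (m + n)"
  using assms unfolding graded_module_def
  by (auto simp: graded_group_def graded_group_axioms_def left_module_abelian_group)

lemma graded_ringD:
  assumes "graded_ring A gA"
  shows "ring A" "graded_group A gA" "\<one>\<^bsub>A\<^esub> \<in> gA 0"
    and "a \<in> gA m \<Longrightarrow> b \<in> gA n \<Longrightarrow> a \<otimes>\<^bsub>A\<^esub> b \<in> gA (m + n)"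
  using assms unfolding graded_ring_def
  by (auto simp: graded_group_def graded_group_axioms_def ring.is_abelian_group)

lemma graded_free_module:
  assumes A: "graded_ring A gA"
  shows "graded_module A gA (free_module A B) (free_grading gA \<delta> (free_module A B))"
proof -
  note gr = graded_ringD[OF A]
  interpret A: ring A by (rule gr)
  interpret g: graded_group A gA by (rule gr)
  let ?M = "free_module A B"
  interpret M: lmod A ?M by (rule lmod.intro, rule A.left_module_free_module)
  \<comment> \<open>The basis element \<open>b\<close> contributes \<open>\<delta> b\<close> to the
    total degree \<open>n\<close>, which leaves \<open>n - \<delta> b\<close> for its
    coefficient.\<close>
  let ?pr = "\<lambda>n c b. g.hcomp (n - \<delta> b) (c b)"
  have cv: "c b \<in> carrier A" if "c \<in> carrier ?M" for c b using that by simp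
  have h0: "g.hcomp m \<zero>\<^bsub>A\<^esub> = \<zero>\<^bsub>A\<^esub>" for m using g.hcomp_of_part[OF g.zero_part] by simp
  have nz: "c b \<noteq> \<zero>\<^bsub>A\<^esub>" if "g.hcomp m (c b) \<noteq> \<zero>\<^bsub>A\<^esub>" for c m b using that h0 by auto
  have pr_closed: "?pr n c \<in> carrier ?M" if c: "c \<in> carrier ?M" for n c
  proof -
    have "{b. ?pr n c b \<noteq> \<zero>\<^bsub>A\<^esub>} \<subseteq> {b. c b \<noteq> \<zero>\<^bsub>A\<^esub>}"
      by (rule Collect_mono) (rule impI, erule nz)
    then have "finite {b. ?pr n c b \<noteq> \<zero>\<^bsub>A\<^esub>}" by (rule finite_subset) (use c in simp)
    then show ?thesis using c by (simp add: g.hcomp_closed h0)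
  qed
  have "direct_decomp ?M (free_grading gA \<delta> ?M)"
  proof (rule direct_decompI[where pr = ?pr, OF M.M.abelian_group_axioms])
    show "additive_subgroup (free_grading gA \<delta> ?M n) ?M" for n
      unfolding free_grading_def
      by (rule additive_subgroup_vimage[OF M.M.abelian_group_axioms A.is_abelian_group])
         (auto simp: g.subgroup_part)
    fix n c assume c: "c \<in> carrier ?M"
    show "?pr n c \<in> free_grading gA \<delta> ?M n"
      unfolding free_grading_def using pr_closed[OF c] g.hcomp_part[OF cv[OF c]] by blast
    show "?pr n (c \<oplus>\<^bsub>?M\<^esub> d) = ?pr n c \<oplus>\<^bsub>?M\<^esub> ?pr n d" if "d \<in> carrier ?M" for d
      using cv[OF c] cv[OF that] by (simp add: g.hcomp_add)
    \<comment> \<open>A degree occurring in \<open>c\<close> is \<open>m + \<delta> b\<close> for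
      some \<open>b\<close> in the support of \<open>c\<close> and some degree \<open>m\<close>
      occurring in \<open>c b\<close>.\<close>
    have "{n. ?pr n c \<noteq> \<zero>\<^bsub>?M\<^esub>} \<subseteq> (\<Union>b\<in>{b. c b \<noteq> \<zero>\<^bsub>A\<^esub>}. (\<lambda>m. m + \<delta> b) ` {m. g.hcomp m (c b) \<noteq> \<zero>\<^bsub>A\<^esub>})"
    proof
      fix n assume "n \<in> {n. ?pr n c \<noteq> \<zero>\<^bsub>?M\<^esub>}"
      then obtain b where b: "?pr n c b \<noteq> \<zero>\<^bsub>A\<^esub>" by (auto simp: fun_eq_iff)
      have "n \<in> (\<lambda>m. m + \<delta> b) ` {m. g.hcomp m (c b) \<noteq> \<zero>\<^bsub>A\<^esub>}"
        using b by (intro image_eqI[of _ _ "n - \<delta> b"]) auto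
      then show "n \<in> (\<Union>b\<in>{b. c b \<noteq> \<zero>\<^bsub>A\<^esub>}. (\<lambda>m. m + \<delta> b) ` {m. g.hcomp m (c b) \<noteq> \<zero>\<^bsub>A\<^esub>})"
        by (rule UN_I[rotated]) (use b h0 in auto)
    qed
    moreover have "finite (\<Union>b\<in>{b. c b \<noteq> \<zero>\<^bsub>A\<^esub>}. (\<lambda>m. m + \<delta> b) ` {m. g.hcomp m (c b) \<noteq> \<zero>\<^bsub>A\<^esub>})"
      using c cv[OF c] by (intro finite_UN_I finite_imageI g.finite_hcomp) auto
    ultimately show fin: "finite {n. ?pr n c \<noteq> \<zero>\<^bsub>?M\<^esub>}" by (rule finite_subset)
    show "c = (\<Oplus>\<^bsub>?M\<^esub>n\<in>{n. ?pr n c \<noteq> \<zero>\<^bsub>?M\<^esub>}. ?pr n c)"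
    proof
      fix b
      let ?I = "{n. ?pr n c \<noteq> \<zero>\<^bsub>?M\<^esub>}"
      have hc: "g.hcomp m (c b) \<in> carrier A" for m by (rule g.hcomp_closed[OF cv[OF c]])
      have inj: "inj_on (\<lambda>n. n - \<delta> b) ?I" by (auto simp: inj_on_def)
      have "c b = (\<Oplus>\<^bsub>A\<^esub>m\<in>{m. g.hcomp m (c b) \<noteq> \<zero>\<^bsub>A\<^esub>}. g.hcomp m (c b))"
        by (rule g.hcomp_sum[OF cv[OF c]])
      \<comment> \<open>\<open>?I\<close> collects the degrees from all basis elements; those that
        do not occur at \<open>b\<close> contribute zero.\<close>
      also have "\<dots> = (\<Oplus>\<^bsub>A\<^esub>m\<in>(\<lambda>n. n - \<delta> b) ` ?I. g.hcomp m (c b))"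
      proof (rule g.finsum_superset[OF finite_imageI[OF fin] _ hc])
        show "{m. g.hcomp m (c b) \<noteq> \<zero>\<^bsub>A\<^esub>} \<subseteq> (\<lambda>n. n - \<delta> b) ` ?I"
        proof
          fix m assume "m \<in> {m. g.hcomp m (c b) \<noteq> \<zero>\<^bsub>A\<^esub>}"
          then have "m + \<delta> b \<in> ?I" by (auto simp: fun_eq_iff intro!: exI[of _ b])
          then show "m \<in> (\<lambda>n. n - \<delta> b) ` ?I" by (rule image_eqI[rotated]) simp
        qed
      qed
      also have "\<dots> = (\<Oplus>\<^bsub>A\<^esub>n\<in>?I. ?pr n c b)"
        by (rule A.finsum_reindex[OF _ inj]) (use hc in auto)
      also have "\<dots> = (\<Oplus>\<^bsub>?M\<^esub>n\<in>?I. ?pr n c) b"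
        by (rule A.finsum_free_module[symmetric]) (rule pr_closed[OF c])
      finally show "c b = (\<Oplus>\<^bsub>?M\<^esub>n\<in>?I. ?pr n c) b" .
    qed
  next
    fix n c assume "c \<in> free_grading gA \<delta> ?M n"
    then have c: "c b \<in> gA (n - \<delta> b)" for b by (simp add: free_grading_def)
    show "?pr n c = c" using g.hcomp_of_part[OF c] by simp
    show "?pr m c = \<zero>\<^bsub>?M\<^esub>" if "m \<noteq> n" for m
      using g.hcomp_of_part[OF c] that by (simp add: fun_eq_iff)
  qed
  moreover have "a \<odot>\<^bsub>?M\<^esub> c \<in> free_grading gA \<delta> ?M (m + n)"
    if a: "a \<in> gA m" and c: "c \<in> free_grading gA \<delta> ?M n" for a c m n
  proof -
    have "a \<odot>\<^bsub>?M\<^esub> c \<in> carrier ?M"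
      by (rule M.smult_closed[OF g.part_closed[OF a]]) (use c in \<open>simp add: free_grading_def\<close>)
    moreover have "a \<otimes>\<^bsub>A\<^esub> c b \<in> gA (m + n - \<delta> b)" for b
      using gr(4)[OF a, of "c b" "n - \<delta> b"] c by (simp add: free_grading_def add_diff_eq)
    ultimately show ?thesis unfolding free_grading_def by simp
  qed
  ultimately show ?thesis
    unfolding graded_module_def using A M.left_module_axioms by blast
qed

lemma lin_ext_graded:
  assumes N: "graded_module A gA N gN" and f: "\<And>b. b \<in> B \<Longrightarrow> f b \<in> gN (\<delta> b)"
    and c: "c \<in> free_grading gA \<delta> (free_module A B) n"
  shows "lin_ext A N f c \<in> gN n"
proof -
  note g = graded_moduleD[OF N]
  interpret N: graded_group N gN by (rule g)
  show ?thesis unfolding lin_ext_def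
  proof (rule subgroup_finsum_closed[OF N.abelian_group_axioms N.subgroup_part], rule Pi_I)
    fix b assume "b \<in> {b. c b \<noteq> \<zero>\<^bsub>A\<^esub>}"
    then have "b \<in> B" using c by (auto simp: free_grading_def)
    moreover have "c b \<in> gA (n - \<delta> b)" using c by (simp add: free_grading_def)
    ultimately show "c b \<odot>\<^bsub>N\<^esub> f b \<in> gN n" using g(4)[of "c b" "n - \<delta> b" "f b" "\<delta> b"] f by simp
  qed
qed

section \<open>Homogeneous coordinates\<close>

context based_module
begin

text \<open>A zero basis element would have both \<open>single R b\<close> and the zero function as
  coordinates.\<close>

lemma basis_nonzero:
  assumes "\<one>\<^bsub>R\<^esub> \<noteq> \<zero>\<^bsub>R\<^esub>" "b \<in> B"
  shows "b \<noteq> \<zero>\<^bsub>M\<^esub>"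
proof
  assume b0: "b = \<zero>\<^bsub>M\<^esub>"
  have "single R b = coords R M B (realize (single R b))"
    by (rule coords_realize[symmetric]) (rule R.single_closed[OF assms(2)])
  also have "\<dots> = coords R M B b"
    by (simp only: lin_ext_single[where f = "\<lambda>b. b", OF basis_closed[OF assms(2)]])
  also have "\<dots> = coords R M B \<zero>\<^bsub>M\<^esub>" unfolding b0 ..
  also have "\<dots> = (\<lambda>_. \<zero>\<^bsub>R\<^esub>)"
    using lmod_hom_zero[OF left_module_axioms R.left_module_free_module coords_hom] by simp
  finally have "single R b b = \<zero>\<^bsub>R\<^esub>" by simp
  then show False using assms(1) by (simp add: single_def)
qed

lemma idegree_basis:
  assumes M: "graded_module R gR M gM" and hom: "homogeneous gM B"
    and one: "\<one>\<^bsub>R\<^esub> \<noteq> \<zero>\<^bsub>R\<^esub>" and b: "b \<in> B"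
  shows "b \<in> gM (idegree gM b)"
proof -
  interpret g: graded_group M gM by (rule graded_moduleD[OF M])
  obtain n where n: "b \<in> gM n" using hom b unfolding homogeneous_def by blast
  then show ?thesis using g.idegree_eq[OF n basis_nonzero[OF one b]] by simp
qed

text \<open>\<open>realize\<close> preserves degrees and so commutes with taking components. As
  \<open>v\<close> is its own component of degree \<open>n\<close>, uniqueness of coordinates makes
  its coordinate function equal to its component of degree \<open>n\<close>.\<close>

lemma coords_graded:
  assumes M: "graded_module R gR M gM" and hom: "homogeneous gM B"
    and one: "\<one>\<^bsub>R\<^esub> \<noteq> \<zero>\<^bsub>R\<^esub>" and v: "v \<in> gM n"
  shows "coords R M B v b \<in> gR (n - idegree gM b)"
proof -
  let ?F = "free_module R B" and ?g = "free_grading gR (idegree gM) (free_module R B)"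
  note gM = graded_moduleD[OF M]
  note gF = graded_moduleD[OF graded_free_module[OF gM(2), where B = B and \<delta> = "idegree gM"]]
  interpret g: graded_group M gM by (rule gM)
  interpret f: graded_group ?F ?g by (rule gF)
  have vc: "v \<in> carrier M" by (rule g.part_closed[OF v])
  note cp = coords_props[OF vc]
  have "g.hcomp n (realize (coords R M B v)) = realize (f.hcomp n (coords R M B v))"
  proof (rule hcomp_natural[OF gF(3) gM(3) lmod_homD(1)[OF realize_hom] lmod_homD(3)[OF realize_hom] _ cp(1)])
    show "realize x \<in> gM m" if "x \<in> ?g m" for m x
      by (rule lin_ext_graded[OF M _ that]) (rule idegree_basis[OF M hom one])
  qed
  then have "v = realize (f.hcomp n (coords R M B v))"
    using cp(2) g.hcomp_of_part[OF v, of n] by simp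
  then have "coords R M B v = f.hcomp n (coords R M B v)"
    using coords_realize[OF f.hcomp_closed[OF cp(1)]] by metis
  then have "coords R M B v \<in> ?g n" using f.hcomp_part[OF cp(1)] by metis
  then show ?thesis by (simp add: free_grading_def)
qed

end

section \<open>Gradings of restricted modules and of fiber products\<close>

lemma direct_decomp_restrict_scalars:
  assumes M: "graded_group M gM" and N: "abelian_group (restrict_scalars h M)"
  shows "direct_decomp (restrict_scalars h M) gM"
proof -
  interpret g: graded_group M gM by fact
  show ?thesis
  proof (rule direct_decompI[where pr = g.hcomp, OF N])
    show "additive_subgroup (gM n) (restrict_scalars h M)" for n
    proof -
      have "additive_subgroup {x \<in> carrier (restrict_scalars h M). \<forall>_::unit. x \<in> gM n} (restrict_scalars h M)"
        by (rule additive_subgroup_vimage[OF N g.abelian_group_axioms]) (auto simp: g.subgroup_part)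
      moreover have "{x \<in> carrier (restrict_scalars h M). \<forall>_::unit. x \<in> gM n} = gM n"
        using g.part_closed by auto
      ultimately show ?thesis by simp
    qed
    fix x assume "x \<in> carrier (restrict_scalars h M)"
    then have x: "x \<in> carrier M" by simp
    have "x = (\<Oplus>\<^bsub>M\<^esub>n\<in>{n. g.hcomp n x \<noteq> \<zero>\<^bsub>M\<^esub>}. g.hcomp n x)" by (rule g.hcomp_sum[OF x])
    \<comment> \<open>The two sums are formed in different structures with the same addition, so the
      equality is transported along the identity map.\<close>
    also have "\<dots> = (\<Oplus>\<^bsub>restrict_scalars h M\<^esub>n\<in>{n. g.hcomp n x \<noteq> \<zero>\<^bsub>M\<^esub>}. g.hcomp n x)"
      by (rule additive_map_finsum[where f = "\<lambda>x. x", OF g.abelian_group_axioms N])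
         (auto simp: g.hcomp_closed[OF x])
    finally show "x = (\<Oplus>\<^bsub>restrict_scalars h M\<^esub>n\<in>{n. g.hcomp n x \<noteq> \<zero>\<^bsub>restrict_scalars h M\<^esub>}. g.hcomp n x)"
      by simp
  qed (simp_all add: g.hcomp_part g.hcomp_add g.hcomp_of_part g.finite_hcomp)
qed

text \<open>Of the homogeneous summands of \<open>x\<close> only the one of degree 0 survives. The
  maps of interest are the residue maps.\<close>

lemma additive_map_hcomp_0:
  assumes A: "graded_group A gA" and k: "abelian_group k" and f: "f \<in> carrier A \<rightarrow> carrier k"
    and add: "\<And>x y. x \<in> carrier A \<Longrightarrow> y \<in> carrier A \<Longrightarrow> f (x \<oplus>\<^bsub>A\<^esub> y) = f x \<oplus>\<^bsub>k\<^esub> f y"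
    and kill: "\<And>n x. n \<noteq> 0 \<Longrightarrow> x \<in> gA n \<Longrightarrow> f x = \<zero>\<^bsub>k\<^esub>"
    and x: "x \<in> carrier A"
  shows "f (graded_group.hcomp A gA 0 x) = f x"
proof -
  interpret A: graded_group A gA by fact
  interpret k: abelian_group k by fact
  have f0: "f \<zero>\<^bsub>A\<^esub> = \<zero>\<^bsub>k\<^esub>" by (rule additive_map_zero[OF A.abelian_group_axioms k f add])
  \<comment> \<open>The degree 0 is inserted because the component of that degree may vanish and so
    be missing from the support.\<close>
  let ?I = "insert 0 {n. A.hcomp n x \<noteq> \<zero>\<^bsub>A\<^esub>}"
  have fc: "f (A.hcomp n x) \<in> carrier k" for n using f A.hcomp_closed[OF x] by blast
  have "f x = f (\<Oplus>\<^bsub>A\<^esub>n\<in>?I. A.hcomp n x)"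
    using A.hcomp_sum[OF x] A.finsum_superset[of ?I "\<lambda>n. A.hcomp n x"] A.finite_hcomp[OF x] A.hcomp_closed[OF x]
    by (simp add: subset_insertI)
  also have "\<dots> = (\<Oplus>\<^bsub>k\<^esub>n\<in>?I. f (A.hcomp n x))"
    by (rule additive_map_finsum[OF A.abelian_group_axioms k f add]) (auto simp: A.hcomp_closed[OF x])
  also have "\<dots> = (\<Oplus>\<^bsub>k\<^esub>n\<in>?I. if 0 = n then f (A.hcomp n x) else \<zero>\<^bsub>k\<^esub>)"
    using fc kill[OF _ A.hcomp_part[OF x]] by (intro k.finsum_cong') auto
  also have "\<dots> = f (A.hcomp 0 x)"
    using fc A.finite_hcomp[OF x] by (intro k.finsum_singleton) auto
  finally show ?thesis by simp
qed

text \<open>Taking components on both sides does not leave the fiber product: the components of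
  degree 0 keep the residues of the pair, and in all other degrees both residues are zero.\<close>

lemma fiber_graded_ring:
  assumes gS: "graded_ring S gS" and gT: "graded_ring T gT" and k: "ring k"
    and \<pi>S: "\<pi>S \<in> ring_hom S k" and \<pi>T: "\<pi>T \<in> ring_hom T k"
    and kerS: "\<And>n s. n \<noteq> 0 \<Longrightarrow> s \<in> gS n \<Longrightarrow> \<pi>S s = \<zero>\<^bsub>k\<^esub>"
    and kerT: "\<And>n t. n \<noteq> 0 \<Longrightarrow> t \<in> gT n \<Longrightarrow> \<pi>T t = \<zero>\<^bsub>k\<^esub>"
  shows "graded_ring (fiber_product S T \<pi>S \<pi>T) (fiber_grading gS gT \<pi>S \<pi>T)"
proof -
  note S = graded_ringD[OF gS] and T = graded_ringD[OF gT]
  interpret S: ring S by (rule S)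
  interpret T: ring T by (rule T)
  interpret k: ring k by (rule k)
  interpret hS: ring_hom_ring S k \<pi>S by (intro ring_hom_ringI2 S k \<pi>S)
  interpret hT: ring_hom_ring T k \<pi>T by (intro ring_hom_ringI2 T k \<pi>T)
  interpret gS: graded_group S gS by (rule S)
  interpret gT: graded_group T gT by (rule T)
  let ?R = "fiber_product S T \<pi>S \<pi>T" and ?g = "fiber_grading gS gT \<pi>S \<pi>T"
  interpret R: ring ?R by (rule ring_fiber_product[OF S(1) T(1) k \<pi>S \<pi>T])
  let ?pr = "\<lambda>n r. (gS.hcomp n (fst r), gT.hcomp n (snd r))"
  note hS = additive_map_hcomp_0[OF S(2) k.is_abelian_group _ hS.hom_add kerS]
  note hT = additive_map_hcomp_0[OF T(2) k.is_abelian_group _ hT.hom_add kerT]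
  have fiber: "\<pi>S (gS.hcomp n (fst r)) = \<pi>T (gT.hcomp n (snd r))" if r: "r \<in> carrier ?R" for n r
  proof (cases "n = 0")
    case True
    have "\<pi>S (gS.hcomp 0 (fst r)) = \<pi>S (fst r)" by (rule hS) (use r in auto)
    moreover have "\<pi>T (gT.hcomp 0 (snd r)) = \<pi>T (snd r)" by (rule hT) (use r in auto)
    ultimately show ?thesis using True r by simp
  next
    case False
    then show ?thesis using r kerS[OF False gS.hcomp_part] kerT[OF False gT.hcomp_part] by simp
  qed
  \<comment> \<open>An intersection of two preimages is a subgroup; the quantifiers over
    \<open>unit\<close> put each of them in the form of
    \<open>additive_subgroup_vimage\<close>.\<close>
  have grading_eq: "?g n = {r \<in> carrier ?R. \<forall>_::unit. fst r \<in> gS n} \<inter> {r \<in> carrier ?R. \<forall>_::unit. snd r \<in> gT n}" for n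
    unfolding fiber_grading_def by (auto simp: gS.part_closed gT.part_closed)
  have pr_closed: "?pr n r \<in> carrier ?R" if "r \<in> carrier ?R" for n r
    using that fiber[OF that] gS.hcomp_closed gT.hcomp_closed by simp
  have supp: "{n. ?pr n r \<noteq> \<zero>\<^bsub>?R\<^esub>} = {n. gS.hcomp n (fst r) \<noteq> \<zero>\<^bsub>S\<^esub>} \<union> {n. gT.hcomp n (snd r) \<noteq> \<zero>\<^bsub>T\<^esub>}" for r
    by auto
  have "direct_decomp ?R ?g"
  proof (rule direct_decompI[where pr = ?pr, OF R.is_abelian_group])
    show "additive_subgroup (?g n) ?R" for n
    proof -
      have 1: "additive_subgroup {r \<in> carrier ?R. \<forall>_::unit. fst r \<in> gS n} ?R"
        by (rule additive_subgroup_vimage[OF R.is_abelian_group S.is_abelian_group])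
           (auto simp: gS.subgroup_part)
      have 2: "additive_subgroup {r \<in> carrier ?R. \<forall>_::unit. snd r \<in> gT n} ?R"
        by (rule additive_subgroup_vimage[OF R.is_abelian_group T.is_abelian_group])
           (auto simp: gT.subgroup_part)
      show ?thesis
        using R.add.subgroups_Inter_pair[of "{r \<in> carrier ?R. \<forall>_::unit. fst r \<in> gS n}"
            "{r \<in> carrier ?R. \<forall>_::unit. snd r \<in> gT n}"] 1 2
        unfolding grading_eq additive_subgroup_def by simp
    qed
    fix n r assume r: "r \<in> carrier ?R"
    then have rS: "fst r \<in> carrier S" and rT: "snd r \<in> carrier T" by auto
    show "?pr n r \<in> ?g n"
      using fiber[OF r, of n] gS.hcomp_part[OF rS] gT.hcomp_part[OF rT] by (simp add: fiber_grading_def)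
    show "?pr n (r \<oplus>\<^bsub>?R\<^esub> r') = ?pr n r \<oplus>\<^bsub>?R\<^esub> ?pr n r'" if "r' \<in> carrier ?R" for r'
      using that rS rT by (simp add: gS.hcomp_add gT.hcomp_add)
    show fin: "finite {n. ?pr n r \<noteq> \<zero>\<^bsub>?R\<^esub>}"
      unfolding supp using gS.finite_hcomp[OF rS] gT.finite_hcomp[OF rT] by simp
    let ?I = "{n. ?pr n r \<noteq> \<zero>\<^bsub>?R\<^esub>}"
    have pcl: "(\<lambda>n. ?pr n r) \<in> ?I \<rightarrow> carrier ?R" using pr_closed[OF r] by blast
    have "fst (\<Oplus>\<^bsub>?R\<^esub>n\<in>?I. ?pr n r) = (\<Oplus>\<^bsub>S\<^esub>n\<in>?I. fst (?pr n r))"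
      by (rule additive_map_finsum[OF R.is_abelian_group S.is_abelian_group _ _ pcl]) auto
    also have "\<dots> = (\<Oplus>\<^bsub>S\<^esub>n\<in>{n. gS.hcomp n (fst r) \<noteq> \<zero>\<^bsub>S\<^esub>}. gS.hcomp n (fst r))"
      unfolding fst_conv by (rule gS.finsum_superset[OF fin _ gS.hcomp_closed[OF rS], symmetric]) auto
    also have "\<dots> = fst r" by (rule gS.hcomp_sum[OF rS, symmetric])
    finally have f: "fst (\<Oplus>\<^bsub>?R\<^esub>n\<in>?I. ?pr n r) = fst r" .
    have "snd (\<Oplus>\<^bsub>?R\<^esub>n\<in>?I. ?pr n r) = (\<Oplus>\<^bsub>T\<^esub>n\<in>?I. snd (?pr n r))"
      by (rule additive_map_finsum[OF R.is_abelian_group T.is_abelian_group _ _ pcl]) auto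
    also have "\<dots> = (\<Oplus>\<^bsub>T\<^esub>n\<in>{n. gT.hcomp n (snd r) \<noteq> \<zero>\<^bsub>T\<^esub>}. gT.hcomp n (snd r))"
      unfolding snd_conv by (rule gT.finsum_superset[OF fin _ gT.hcomp_closed[OF rT], symmetric]) auto
    also have "\<dots> = snd r" by (rule gT.hcomp_sum[OF rT, symmetric])
    finally show "r = (\<Oplus>\<^bsub>?R\<^esub>n\<in>?I. ?pr n r)" using f by (simp only: prod_eq_iff)
  next
    fix n r assume "r \<in> ?g n"
    then have r: "fst r \<in> gS n" "snd r \<in> gT n" by (auto simp: fiber_grading_def)
    show "?pr n r = r" using gS.hcomp_of_part[OF r(1)] gT.hcomp_of_part[OF r(2)] by simp
    show "?pr m r = \<zero>\<^bsub>?R\<^esub>" if "m \<noteq> n" for m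
      using gS.hcomp_of_part[OF r(1)] gT.hcomp_of_part[OF r(2)] that by simp
  qed
  then show ?thesis
    unfolding graded_ring_def using R.ring_axioms S(3,4) T(3,4)
    by (auto simp: fiber_grading_def hS.hom_one hT.hom_one gS.part_closed gT.part_closed)
qed

lemma (in minimal_resolution) crd_bdy_graded:
  assumes gr: "graded_free_resolution A gA X gX \<epsilon> N gN" and hom: "\<And>i. homogeneous (gX i) (bas X i)"
    and one: "\<one> \<noteq> \<zero>" and y: "y \<in> bas X (Suc i)"
  shows "crd i (bdy X (Suc i) y) b \<in> gA (idegree (gX (Suc i)) y - idegree (gX i) b)"
proof -
  have gm: "graded_module A gA (chn X j) (gX j)" for j
    using gr unfolding graded_free_resolution_def by blast
  have bd: "bdy X (Suc j) ` gX (Suc j) n \<subseteq> gX j n" for j n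
    using gr unfolding graded_free_resolution_def by blast
  have "y \<in> gX (Suc i) (idegree (gX (Suc i)) y)"
    by (rule based_module.idegree_basis[OF based_module gm hom one y])
  then have "bdy X (Suc i) y \<in> gX i (idegree (gX (Suc i)) y)" using bd by blast
  then show ?thesis by (rule based_module.coords_graded[OF based_module gm hom one])
qed

text \<open>Components of negative degree are zero, and those of positive degree are generators of
  \<open>irrelevant_part\<close>, which is the kernel of the residue map.\<close>

lemma connected_algebra_residue:
  assumes A: "connected_algebra k A gA \<eta>" and ker: "a_kernel A k \<pi> = irrelevant_part A gA"
    and k: "ring k" and \<pi>: "\<pi> \<in> ring_hom A k" and n: "n \<noteq> 0" and a: "a \<in> gA n"
  shows "\<pi> a = \<zero>\<^bsub>k\<^esub>"
proof (cases "n < 0")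
  case True
  then have "a = \<zero>\<^bsub>A\<^esub>" using A a unfolding connected_algebra_def by blast
  moreover have "ring A" using A unfolding connected_algebra_def graded_ring_def by blast
  ultimately show ?thesis using ring_hom_zero[OF \<pi> _ k] by simp
next
  case False
  then have "a \<in> a_kernel A k \<pi>"
    unfolding ker irrelevant_part_def using n a by (intro generate.incl) (auto intro!: bexI[of _ n])
  then show ?thesis by (simp add: a_kernel_def')
qed

section \<open>Internal degrees in the word complex\<close>

locale graded_fiber_words = fiber_words +
  fixes gS \<eta>S gT \<eta>T gM gP gE gF
  assumes graded: "graded_case S T k \<pi>S \<pi>T M gS \<eta>S gT \<eta>T gM"
    and gradedP: "graded_free_resolution S gS P gP \<epsilon>P M gM" "\<And>i. homogeneous (gP i) (bas P i)"
    and gradedE: "graded_free_resolution S gS E gE \<epsilon>E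
            (restrict_scalars \<pi>S (regular_module k)) (concentrated_in_0 k)"
      "\<And>i. homogeneous (gE i) (bas E i)" "\<And>n. \<iota>E ` gS n = gE 0 n"
    and gradedF: "graded_free_resolution T gT F gF \<epsilon>F
            (restrict_scalars \<pi>T (regular_module k)) (concentrated_in_0 k)"
      "\<And>i. homogeneous (gF i) (bas F i)" "\<And>n. \<iota>F ` gT n = gF 0 n"
begin

abbreviation "gR \<equiv> fiber_grading gS gT \<pi>S \<pi>T"
abbreviation "\<delta> \<equiv> word_ideg gP gE gF"
abbreviation "gG i \<equiv> free_grading gR \<delta> (G i)"

lemma graded_S: "graded_ring S gS" and graded_T: "graded_ring T gT" and graded_M: "graded_module S gS M gM"
  using graded unfolding graded_case_def connected_algebra_def by blast+

lemma residue_S: "n \<noteq> 0 \<Longrightarrow> s \<in> gS n \<Longrightarrow> \<pi>S s = \<zero>\<^bsub>k\<^esub>"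
  using graded unfolding graded_case_def
  by (elim conjE) (rule connected_algebra_residue[OF _ _ k.ring_axioms \<pi>S])

lemma residue_T: "n \<noteq> 0 \<Longrightarrow> t \<in> gT n \<Longrightarrow> \<pi>T t = \<zero>\<^bsub>k\<^esub>"
  using graded unfolding graded_case_def
  by (elim conjE) (rule connected_algebra_residue[OF _ _ k.ring_axioms \<pi>T])

sublocale gS: graded_group S gS by (rule graded_ringD[OF graded_S])
sublocale gT: graded_group T gT by (rule graded_ringD[OF graded_T])

lemma graded_R: "graded_ring R gR"
  by (rule fiber_graded_ring[OF graded_S graded_T k.ring_axioms \<pi>S \<pi>T residue_S residue_T])

sublocale gR: graded_group R gR by (rule graded_ringD[OF graded_R])

lemma graded_G: "graded_module R gR (free_module R V) (free_grading gR d (free_module R V))"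
  by (rule graded_free_module[OF graded_R])

lemma graded_MR: "graded_module R gR MR gM"
proof -
  note gM = graded_moduleD[OF graded_M]
  have "direct_decomp MR gM"
    by (rule direct_decomp_restrict_scalars[OF gM(3) left_module_abelian_group[OF left_module_MR]])
  then show ?thesis
    unfolding graded_module_def using graded_R left_module_MR gM(4)
    by (auto simp: fiber_grading_def)
qed

lemma one_not_zero_S: "\<one>\<^bsub>S\<^esub> \<noteq> \<zero>\<^bsub>S\<^esub>" and one_not_zero_T: "\<one>\<^bsub>T\<^esub> \<noteq> \<zero>\<^bsub>T\<^esub>"
  using \<pi>S.hom_one \<pi>S.hom_zero \<pi>T.hom_one \<pi>T.hom_zero k.one_not_zero by metis+

text \<open>\<open>consE 0\<close> drops the unit, so \<open>word_ideg\<close> is additive under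
  \<open>consE\<close> only if the unit has internal degree 0. It does, because
  \<open>\<iota>E\<close> carries the grading of \<open>S\<close> to that of \<open>E\<close> in
  degree 0.\<close>

lemma idegree_oneE: "idegree (gE 0) oneE = 0"
proof -
  have gm: "graded_module S gS (chn E 0) (gE 0)"
    using gradedE(1) unfolding graded_free_resolution_def by blast
  interpret g: graded_group "chn E 0" "gE 0" by (rule graded_moduleD[OF gm])
  have "oneE \<in> gE 0 0" using gradedE(3)[of 0] graded_ringD(3)[OF graded_S] by blast
  moreover have "oneE \<noteq> \<zero>\<^bsub>chn E 0\<^esub>"
    using based_module.basis_nonzero[OF E.based_module one_not_zero_S] unitE(2) by blast
  ultimately show ?thesis by (rule g.idegree_eq)
qed

lemma idegree_oneF: "idegree (gF 0) oneF = 0"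
proof -
  have gm: "graded_module T gT (chn F 0) (gF 0)"
    using gradedF(1) unfolding graded_free_resolution_def by blast
  interpret g: graded_group "chn F 0" "gF 0" by (rule graded_moduleD[OF gm])
  have "oneF \<in> gF 0 0" using gradedF(3)[of 0] graded_ringD(3)[OF graded_T] by blast
  moreover have "oneF \<noteq> \<zero>\<^bsub>chn F 0\<^esub>"
    using based_module.basis_nonzero[OF F.based_module one_not_zero_T] unitF(2) by blast
  ultimately show ?thesis by (rule g.idegree_eq)
qed

lemma word_ideg_simps:
  "\<delta> [] = 0" "\<delta> (x # w) = letter_ideg gP gE gF x + \<delta> w"
  by (simp_all add: word_ideg_def)

lemma ideg_consE: "e \<in> bas E j \<Longrightarrow> \<delta> (consE j e w) = idegree (gE j) e + \<delta> w"
  using idegree_oneE unitE(2) by (cases j) (auto simp: word_ideg_simps)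

lemma ideg_consF: "f \<in> bas F j \<Longrightarrow> \<delta> (consF j f w) = idegree (gF j) f + \<delta> w"
  using idegree_oneF unitF(2) by (cases j) (auto simp: word_ideg_simps)

lemma embS_graded: "s \<in> gS n \<Longrightarrow> s \<in> \<pp> \<Longrightarrow> (s, \<zero>\<^bsub>T\<^esub>) \<in> gR n"
  and embT_graded: "t \<in> gT n \<Longrightarrow> t \<in> \<qq> \<Longrightarrow> (\<zero>\<^bsub>S\<^esub>, t) \<in> gR n"
  by (auto simp: fiber_grading_def mem_pp mem_qq gS.zero_part gT.zero_part)

lemma zero_gR: "(\<zero>\<^bsub>S\<^esub>, \<zero>\<^bsub>T\<^esub>) \<in> gR n"
  using gR.zero_part[of n] by simp

text \<open>The rest of the word contributes the same amount to the degree of \<open>w\<close> and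
  to the degrees of the words in its boundary, so the claim reduces to the homogeneity of the
  boundary of the first letter.\<close>

lemma wbd_graded:
  assumes w: "w \<in> W (Suc i)"
  shows "wbd i w \<in> gG i (\<delta> w)"
proof -
  have "wbd i w v \<in> gR (\<delta> w - \<delta> v)" for v
    using w
  proof (cases w rule: W_cases)
    case (P p)
    show ?thesis
    proof (cases "v \<in> (\<lambda>b. [LetP i b]) ` bas P i")
      case True
      then obtain b where b: "b \<in> bas P i" "v = [LetP i b]" by blast
      have "(P.crd i (bdy P (Suc i) p) b, \<zero>\<^bsub>T\<^esub>) \<in> gR (idegree (gP (Suc i)) p - idegree (gP i) b)"
        by (rule embS_graded[OF P.crd_bdy_graded[OF gradedP one_not_zero_S P(2)] P.crd_bdy_minimal[OF P(2)]])
      then show ?thesis unfolding P(1) b(2) wbd_P(2)[OF P(2) b(1)] by (simp add: word_ideg_simps)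
    next
      case False
      show ?thesis unfolding P(1) wbd_P(3)[OF P(2) False] by (rule zero_gR)
    qed
  next
    case (E j e w')
    have i: "i = j + word_deg w'" using E(5) by simp
    note wb = wbd_E[OF E(2-4) i]
    show ?thesis
    proof (cases "v \<in> (\<lambda>b. consE j b w') ` bas E j")
      case True
      then obtain b where b: "b \<in> bas E j" "v = consE j b w'" by blast
      have "(E.crd j (bdy E (Suc j) e) b, \<zero>\<^bsub>T\<^esub>) \<in> gR (idegree (gE (Suc j)) e - idegree (gE j) b)"
        by (rule embS_graded[OF E.crd_bdy_graded[OF gradedE(1,2) one_not_zero_S E(2)] E.crd_bdy_minimal[OF E(2)]])
      then show ?thesis unfolding E(1) b(2) wb(2)[OF b(1)] by (simp add: word_ideg_simps ideg_consE[OF b(1)])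
    next
      case False
      show ?thesis unfolding E(1) wb(3)[OF False] by (rule zero_gR)
    qed
  next
    case (F j f w')
    have i: "i = j + word_deg w'" using F(5) by simp
    note wb = wbd_F[OF F(2-4) i]
    show ?thesis
    proof (cases "v \<in> (\<lambda>b. consF j b w') ` bas F j")
      case True
      then obtain b where b: "b \<in> bas F j" "v = consF j b w'" by blast
      have "(\<zero>\<^bsub>S\<^esub>, F.crd j (bdy F (Suc j) f) b) \<in> gR (idegree (gF (Suc j)) f - idegree (gF j) b)"
        by (rule embT_graded[OF F.crd_bdy_graded[OF gradedF(1,2) one_not_zero_T F(2)] F.crd_bdy_minimal[OF F(2)]])
      then show ?thesis unfolding F(1) b(2) wb(2)[OF b(1)] by (simp add: word_ideg_simps ideg_consF[OF b(1)])
    next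
      case False
      show ?thesis unfolding F(1) wb(3)[OF False] by (rule zero_gR)
    qed
  qed
  then show ?thesis unfolding free_grading_def using wbd_closed[OF w] by blast
qed

lemma single_graded:
  assumes "w \<in> V"
  shows "single R w \<in> free_grading gR d (free_module R V) (d w)"
  unfolding free_grading_def using R.single_closed[OF assms] graded_ringD(3)[OF graded_R] zero_gR
  by (auto simp: single_def simp del: free_module_simps(1))

lemma word_aug_graded:
  assumes "w \<in> W 0"
  shows "word_aug \<epsilon>P w \<in> gM (\<delta> w)"
  using assms
proof (cases w rule: W_cases)
  case (P p)
  have gm: "graded_module S gS (chn P 0) (gP 0)" and eps: "\<epsilon>P ` gP 0 n \<subseteq> gM n" for n
    using gradedP(1) unfolding graded_free_resolution_def by blast+
  have "p \<in> gP 0 (idegree (gP 0) p)"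
    by (rule based_module.idegree_basis[OF P.based_module gm gradedP(2) one_not_zero_S P(2)])
  then have "\<epsilon>P p \<in> gM (idegree (gP 0) p)" using eps by blast
  then show ?thesis by (simp add: P(1) word_ideg_simps)
qed simp_all

lemma GG_graded_resolution:
  "graded_free_resolution R gR GG (\<lambda>i. free_grading gR \<delta> (chn GG i)) augG MR gM"
  unfolding graded_free_resolution_def chn_GG bdy_GG
proof (intro conjI allI)
  show "free_resolution R GG augG MR" by (rule GG_resolution)
  show "graded_module R gR MR gM" by (rule graded_MR)
  fix i
  show "graded_module R gR (G i) (gG i)" by (rule graded_G)
  show "\<exists>B. is_basis R (G i) B \<and> homogeneous (gG i) B"
  proof (intro exI conjI)
    show "is_basis R (G i) (single R ` W i)" by (rule R.is_basis_singles[OF one_not_zero_R])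
    show "homogeneous (gG i) (single R ` W i)"
      unfolding homogeneous_def by (rule image_subsetI, rule UN_I[OF UNIV_I], rule single_graded)
  qed
  fix n
  show "dG i ` gG (Suc i) n \<subseteq> gG i n"
    by (rule image_subsetI) (rule lin_ext_graded[OF graded_G wbd_graded])
  show "augG ` gG 0 n \<subseteq> gM n"
    unfolding cpx_aug_def by (rule image_subsetI) (rule lin_ext_graded[OF graded_MR word_aug_graded])
qed

end

section \<open>Deduction of the local and the graded statement\<close>

theorem theorem2p6:
  fixes S :: "'s ring" and T :: "'t ring" and k :: "'k ring"
    and \<pi>S :: "'s \<Rightarrow> 'k" and \<pi>T :: "'t \<Rightarrow> 'k"
    and M :: "('s, 'm) module"
    and P :: "('s, 'p) based_cpx" and \<epsilon>P :: "'p \<Rightarrow> 'm"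
    and E :: "('s, 'e) based_cpx" and \<epsilon>E :: "'e \<Rightarrow> 'k" and \<iota>E :: "'s \<Rightarrow> 'e"
    and F :: "('t, 'f) based_cpx" and \<epsilon>F :: "'f \<Rightarrow> 'k" and \<iota>F :: "'t \<Rightarrow> 'f"
    and gS :: "int \<Rightarrow> 's set" and \<eta>S :: "'k \<Rightarrow> 's"
    and gT :: "int \<Rightarrow> 't set" and \<eta>T :: "'k \<Rightarrow> 't"
    and gM :: "int \<Rightarrow> 'm set"
    and gP :: "nat \<Rightarrow> int \<Rightarrow> 'p set" and gE :: "nat \<Rightarrow> int \<Rightarrow> 'e set" and gF :: "nat \<Rightarrow> int \<Rightarrow> 'f set"
  defines "R \<equiv> fiber_product S T \<pi>S \<pi>T"
    and "\<pp> \<equiv> a_kernel S k \<pi>S" and "\<qq> \<equiv> a_kernel T k \<pi>T"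
    and "\<mm> \<equiv> fiber_max S T k \<pi>S \<pi>T"
    and "G \<equiv> word_cpx S T \<pi>S \<pi>T P E F"
    and "\<epsilon>G \<equiv> cpx_aug S T \<pi>S \<pi>T M \<epsilon>P"
  assumes "ring S" and "ring T" and "field k"
    and "\<pi>S \<in> ring_hom S k" and "\<pi>S ` carrier S = carrier k"
    and "\<pi>T \<in> ring_hom T k" and "\<pi>T ` carrier T = carrier k"
    and "left_module S M"
    and "free_resolution S P \<epsilon>P M" and "minimal_cpx \<pp> P" and "based S P"
    and "free_resolution S E \<epsilon>E (restrict_scalars \<pi>S (regular_module k))"
    and "minimal_cpx \<pp> E" and "based S E"
    and "\<iota>E \<in> lmod_iso S (regular_module S) (chn E 0)" and "bas E 0 = {\<iota>E \<one>\<^bsub>S\<^esub>}"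
    and "free_resolution T F \<epsilon>F (restrict_scalars \<pi>T (regular_module k))"
    and "minimal_cpx \<qq> F" and "based T F"
    and "\<iota>F \<in> lmod_iso T (regular_module T) (chn F 0)" and "bas F 0 = {\<iota>F \<one>\<^bsub>T\<^esub>}"
  shows "(local_case S T k \<pi>S \<pi>T M \<longrightarrow>
            free_resolution R G \<epsilon>G (restrict_scalars fst M) \<and> minimal_cpx \<mm> G) \<and>
         (graded_case S T k \<pi>S \<pi>T M gS \<eta>S gT \<eta>T gM \<and>
          graded_free_resolution S gS P gP \<epsilon>P M gM \<and>
          (\<forall>i. homogeneous (gP i) (bas P i)) \<and>
          graded_free_resolution S gS E gE \<epsilon>E
            (restrict_scalars \<pi>S (regular_module k)) (concentrated_in_0 k) \<and>
          (\<forall>i. homogeneous (gE i) (bas E i)) \<and> (\<forall>n. \<iota>E ` gS n = gE 0 n) \<and>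
          graded_free_resolution T gT F gF \<epsilon>F
            (restrict_scalars \<pi>T (regular_module k)) (concentrated_in_0 k) \<and>
          (\<forall>i. homogeneous (gF i) (bas F i)) \<and> (\<forall>n. \<iota>F ` gT n = gF 0 n) \<longrightarrow>
            graded_free_resolution R (fiber_grading gS gT \<pi>S \<pi>T)
              G (\<lambda>i. free_grading (fiber_grading gS gT \<pi>S \<pi>T) (word_ideg gP gE gF) (chn G i))
              \<epsilon>G (restrict_scalars fst M) gM \<and>
            minimal_cpx \<mm> G)"
proof -
  \<comment> \<open>The first six facts in \<open>assms\<close> are the defining equations of the
    abbreviations, so the hypotheses proper start with the seventh.\<close>
  interpret G: fiber_words S T k \<pi>S \<pi>T M P \<epsilon>P E \<epsilon>E \<iota>E F \<epsilon>F \<iota>F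
    using assms(7-) unfolding assms(2,3) by (intro fiber_words.intro)
  show ?thesis
  proof (intro conjI impI; (elim conjE)?)
    show "free_resolution R G \<epsilon>G (restrict_scalars fst M)"
      unfolding assms(1,5,6) by (rule G.GG_resolution)
    show "minimal_cpx \<mm> G" "minimal_cpx \<mm> G"
      unfolding assms(4,5) by (rule G.GG_minimal)+
  next
    assume graded: "graded_case S T k \<pi>S \<pi>T M gS \<eta>S gT \<eta>T gM"
      "graded_free_resolution S gS P gP \<epsilon>P M gM" "\<forall>i. homogeneous (gP i) (bas P i)"
      "graded_free_resolution S gS E gE \<epsilon>E (restrict_scalars \<pi>S (regular_module k)) (concentrated_in_0 k)"
      "\<forall>i. homogeneous (gE i) (bas E i)" "\<forall>n. \<iota>E ` gS n = gE 0 n"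
      "graded_free_resolution T gT F gF \<epsilon>F (restrict_scalars \<pi>T (regular_module k)) (concentrated_in_0 k)"
      "\<forall>i. homogeneous (gF i) (bas F i)" "\<forall>n. \<iota>F ` gT n = gF 0 n"
    interpret G: graded_fiber_words S T k \<pi>S \<pi>T M P \<epsilon>P E \<epsilon>E \<iota>E F \<epsilon>F \<iota>F gS \<eta>S gT \<eta>T gM gP gE gF
      by unfold_locales (use graded in blast)+
    show "graded_free_resolution R (fiber_grading gS gT \<pi>S \<pi>T)
        G (\<lambda>i. free_grading (fiber_grading gS gT \<pi>S \<pi>T) (word_ideg gP gE gF) (chn G i))
        \<epsilon>G (restrict_scalars fst M) gM"
      unfolding assms(1,5,6) by (rule G.GG_graded_resolution)
  qed
qed

end
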